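(* Let $H$ be a quasi-Hopf $*$-algebra over $\mathbb{C}$ with $*$-canonical element $\Omega$, let $F_\delta$ be the Drinfeld twist of $H$, let $F_0=(S^{-1}\otimes S^{-1})(F_\delta^T)$ be the second Drinfeld twist, let $w\in H$ be the canonical invertible element attached to $(H,\Omega)$ (defined in the context), and put $W=S^{-1}(w)\otimes S^{-1}(w)$. Then $$F_\delta^\dagger=\Omega\;\Delta\big(S^{-1}(w^{-1})\big)\;F_0^{-1}\;(S^{-1}\otimes S^{-1})(\Omega^T)\;W .$$
   Context: Base field $\mathbb{C}$; $1$ also denotes the identity map; $m$ is multiplication; $T(a\otimes b)=b\otimes a$, $X^T=T(X)$ for $X\in H\otimes H$, $\Delta^T=T\circ\Delta$. Sums over repeated indices are understood. A conjugation operation on $H$ is an antilinear map $\dagger:H\to H$ with $(a^\dagger)^\dagger=a$, $(ab)^\dagger=b^\dagger a^\dagger$, extended to tensor powers by $(a\otimes b)^\dagger=a^\dagger\otimes b^\dagger$, etc. A quasi-Hopf algebra (QHA) is a unital associative algebra $H$ with algebra homomorphisms $\varepsilon:H\to\mathbb{C}$, $\Delta:H\to H\otimes H$, an invertible $\Phi=X_\nu\otimes Y_\nu\otimes Z_\nu\in H^{\otimes3}$ (write $\Phi^{-1}=\bar X_\nu\otimes\bar Y_\nu\otimes\bar Z_\nu$), a bijective algebra anti-homomorphism $S$ and $\alpha,\beta\in H$ such that: $(\varepsilon\otimes1)\Delta=1=(1\otimes\varepsilon)\Delta$; $(1\otimes\Delta)\Delta(a)=\Phi^{-1}(\Delta\otimes1)\Delta(a)\Phi$;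 $(\Delta\otimes1\otimes1)\Phi\cdot(1\otimes1\otimes\Delta)\Phi=(\Phi\otimes1)\cdot(1\otimes\Delta\otimes1)\Phi\cdot(1\otimes\Phi)$; $(1\otimes\varepsilon\otimes1)\Phi=1$; $S(X_\nu)\alpha Y_\nu\beta S(Z_\nu)=1=\bar X_\nu\beta S(\bar Y_\nu)\alpha\bar Z_\nu$; $S(a_{(1)})\alpha a_{(2)}=\varepsilon(a)\alpha$, $a_{(1)}\beta S(a_{(2)})=\varepsilon(a)\beta$. A twist is an invertible $F\in H\otimes H$ with $(\varepsilon\otimes1)F=(1\otimes\varepsilon)F=1$. For a twist $F$: $\Delta_F(a)=F\Delta(a)F^{-1}$, $\Phi_F=(F\otimes1)(\Delta\otimes1)(F)\,\Phi\,(1\otimes\Delta)(F^{-1})(1\otimes F^{-1})$, $\alpha_F=m(1\otimes\alpha)(S\otimes1)F^{-1}$, $\beta_F=m(1\otimes\beta)(1\otimes S)F$. A quasi-Hopf $*$-algebra is a QHA with a conjugation operation $\dagger$ and a twist $\Omega$ ($*$-canonical element) such that $\varepsilon(a^\dagger)=\overline{\varepsilon(a)}$, $\Delta(a)^\dagger=\Omega\Delta(a^\dagger)\Omega^{-1}$, $(\Phi^\dagger)^{-1}=\Phi_\Omega$. Put $\tilde S(a)=(S^{-1}(a^\dagger))^\dagger$. The element $w\in H$ is the unique invertible element with $w\,S^{-1}(\beta)^\dagger=\alpha_\Omega$, $\beta_\Omega w=S^{-1}(\alpha)^\dagger$ and $S(a)=w\tilde S(a)w^{-1}$ for all $a\in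 H$; explicitly $w=S(\bar X_\nu^\dagger)\alpha_\Omega\bar Y_\nu^\dagger S^{-1}(\alpha)^\dagger\tilde S(\bar Z_\nu^\dagger)$. Drinfeld twist: $F_\delta=(S\otimes S)(\Delta^T(X_\nu))\cdot\gamma\cdot\Delta(Y_\nu\beta S(Z_\nu))$ with $\gamma=S(B_i)\alpha C_i\otimes S(A_i)\alpha D_i$, where $A_i\otimes B_i\otimes C_i\otimes D_i=(\Phi^{-1}\otimes1)\cdot(\Delta\otimes1\otimes1)\Phi$. It is a twist (Drinfeld) satisfying $F_\delta\Delta(a)F_\delta^{-1}=(S\otimes S)\Delta^T(S^{-1}(a))$. Its inverse is $F_\delta^{-1}=\Delta(\bar X_\nu)\cdot\bar\gamma\cdot(S\otimes S)\Delta^T\big(S^{-1}(S(\bar Y_\nu)\alpha\bar Z_\nu)\big)$ with $\bar\gamma=\bar A_i\beta S(\bar D_i)\otimes\bar B_i\beta S(\bar C_i)$, $\bar A_i\otimes\bar B_i\otimes\bar C_i\otimes\bar D_i=(\Delta\otimes1\otimes1)\Phi^{-1}\cdot(\Phi\otimes1)$. *)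

theory Defs
  imports Complex_Main "HOL-Library.Multiset"
begin

section \<open>Complex vector spaces and complex algebras\<close>

class scaleC =
  fixes scaleC :: "complex \<Rightarrow> 'a \<Rightarrow> 'a"  (infixr "*\<^sub>C" 75)

class complex_vector = scaleC + ab_group_add +
  assumes scaleC_add_right: "a *\<^sub>C (x + y) = a *\<^sub>C x + a *\<^sub>C y"
    and scaleC_add_left: "(a + b) *\<^sub>C x = a *\<^sub>C x + b *\<^sub>C x"
    and scaleC_scaleC: "a *\<^sub>C (b *\<^sub>C x) = (a * b) *\<^sub>C x"
    and scaleC_one: "1 *\<^sub>C x = x"

class complex_algebra_1 = complex_vector + ring_1 +
  assumes mult_scaleC_left: "(a *\<^sub>C x) * y = a *\<^sub>C (x * y)"
    and mult_scaleC_right: "x * (a *\<^sub>C y) = a *\<^sub>C (x * y)"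

interpretation complex_vector: vector_space "scaleC :: complex \<Rightarrow> 'a \<Rightarrow> 'a::complex_vector"
  by unfold_locales (simp_all add: scaleC_add_right scaleC_add_left scaleC_scaleC scaleC_one)

instantiation complex :: complex_algebra_1
begin
definition scaleC_complex :: "complex \<Rightarrow> complex \<Rightarrow> complex"
  where "scaleC_complex a x = a * x"
instance by standard (simp_all add: scaleC_complex_def algebra_simps)
end

abbreviation clinear :: "('a::complex_vector \<Rightarrow> 'b::complex_vector) \<Rightarrow> bool"
  where "clinear \<equiv> Vector_Spaces.linear scaleC scaleC"

lemma clinearI:
  assumes "\<And>x y. f (x + y) = f x + f y" "\<And>c x. f (c *\<^sub>C x) = c *\<^sub>C f x"
  shows "clinear f"
  by unfold_locales (fact assms)+

lemma clinear_add: "clinear f \<Longrightarrow> f (x + y) = f x + f y"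
  by (rule module_hom.add[OF Vector_Spaces.linear.axioms(3)])

lemma clinear_scaleC: "clinear f \<Longrightarrow> f (c *\<^sub>C x) = c *\<^sub>C f x"
  by (rule module_hom.scale[OF Vector_Spaces.linear.axioms(3)])

lemma clinear_functional_exists:
  assumes "(x::'a::complex_vector) \<noteq> 0"
  shows "\<exists>f :: 'a \<Rightarrow> complex. clinear f \<and> f x = 1"
proof -
  interpret vp: vector_space_pair "scaleC :: complex \<Rightarrow> 'a \<Rightarrow> 'a" "scaleC :: complex \<Rightarrow> complex \<Rightarrow> complex"
    by unfold_locales
  have "complex_vector.independent {x}"
    using assms by (simp add: complex_vector.dependent_single)
  from vp.linear_independent_extend[OF this, of "\<lambda>_. 1"] show ?thesis by auto
qed


section \<open>The tensor product of complex vector spaces\<close>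

text \<open>Formal finite sums of pairs (as finite multisets), modulo the congruence generated by the
  bilinearity relations. No coefficients are needed, as \<open>c (a \<otimes> b)\<close> is \<open>(c a) \<otimes> b\<close>.\<close>

inductive tensor_eq ::
  "('a::complex_vector \<times> 'b::complex_vector) multiset \<Rightarrow> ('a \<times> 'b) multiset \<Rightarrow> bool"
where
  tensor_eq_refl: "tensor_eq t t"
| tensor_eq_sym: "tensor_eq t u \<Longrightarrow> tensor_eq u t"
| tensor_eq_trans: "tensor_eq t u \<Longrightarrow> tensor_eq u v \<Longrightarrow> tensor_eq t v"
| tensor_eq_cong: "tensor_eq t u \<Longrightarrow> tensor_eq (t + v) (u + v)"
| tensor_eq_zero: "tensor_eq {#(0, b)#} {#}"
| tensor_eq_add_left: "tensor_eq {#(a + a', b)#} {#(a, b), (a', b)#}"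
| tensor_eq_add_right: "tensor_eq {#(a, b + b')#} {#(a, b), (a, b')#}"
| tensor_eq_scale: "tensor_eq {#(c *\<^sub>C a, b)#} {#(a, c *\<^sub>C b)#}"

quotient_type (overloaded) ('a, 'b) tensor (infixr "\<otimes>" 72) =
  "('a::complex_vector \<times> 'b::complex_vector) multiset" / tensor_eq
  by (intro equivpI reflpI sympI transpI) (blast intro: tensor_eq.intros)+

lemma tensor_eq_cong2:
  assumes "tensor_eq t t'" "tensor_eq u u'"
  shows "tensor_eq (t + u) (t' + u')"
proof -
  have "tensor_eq (t + u) (t' + u)" by (rule tensor_eq_cong[OF assms(1)])
  moreover have "tensor_eq (u + t') (u' + t')" by (rule tensor_eq_cong[OF assms(2)])
  ultimately show ?thesis by (metis add.commute tensor_eq_trans)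
qed

lemma tensor_eq_scale_cong:
  assumes "tensor_eq t u"
  shows "tensor_eq (image_mset (\<lambda>(a, b). (c *\<^sub>C a, b)) t) (image_mset (\<lambda>(a, b). (c *\<^sub>C a, b)) u)"
  using assms
proof induction
  case (tensor_eq_scale d a b)
  then show ?case
    using tensor_eq.tensor_eq_scale[of d "c *\<^sub>C a" b] by (simp add: scaleC_scaleC mult.commute)
qed (auto simp: scaleC_add_right intro: tensor_eq.intros)

lemma tensor_eq_inverse:
  "tensor_eq (image_mset (\<lambda>(a, b). (- 1 *\<^sub>C a, b)) t + t) {#}"
proof (induction t)
  case empty
  show ?case by (simp add: tensor_eq_refl)
next
  case (add x t)
  obtain a b where x: "x = (a, b)" by (cases x)
  have "tensor_eq {#(- 1 *\<^sub>C a + a, b)#} {#(- 1 *\<^sub>C a, b), (a, b)#}" by (rule tensor_eq_add_left)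
  moreover have "- 1 *\<^sub>C a + a = 0"
    using scaleC_add_left[of "- 1" 1 a] by (simp add: scaleC_one)
  ultimately have "tensor_eq {#(- 1 *\<^sub>C a, b), (a, b)#} {#}"
    by (metis tensor_eq_sym tensor_eq_trans tensor_eq_zero)
  from tensor_eq_cong2[OF this add] show ?case by (simp add: x add_mset_commute)
qed

instantiation tensor :: (complex_vector, complex_vector) complex_vector
begin

lift_definition zero_tensor :: "'a \<otimes> 'b" is "{#}" .

lift_definition plus_tensor :: "'a \<otimes> 'b \<Rightarrow> 'a \<otimes> 'b \<Rightarrow> 'a \<otimes> 'b" is "(+)"
  by (rule tensor_eq_cong2)

lift_definition scaleC_tensor :: "complex \<Rightarrow> 'a \<otimes> 'b \<Rightarrow> 'a \<otimes> 'b"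
  is "\<lambda>c. image_mset (\<lambda>(a, b). (c *\<^sub>C a, b))"
  by (rule tensor_eq_scale_cong)

definition uminus_tensor :: "'a \<otimes> 'b \<Rightarrow> 'a \<otimes> 'b"
  where "uminus_tensor t = (- 1) *\<^sub>C t"

definition minus_tensor :: "'a \<otimes> 'b \<Rightarrow> 'a \<otimes> 'b \<Rightarrow> 'a \<otimes> 'b"
  where "minus_tensor t u = t + - u"

instance
proof
  fix t u v :: "'a \<otimes> 'b" and c d :: complex
  show "t + u + v = t + (u + v)" by transfer (simp add: add.assoc tensor_eq_refl)
  show "t + u = u + t" by transfer (simp add: add.commute tensor_eq_refl)
  show "0 + t = t" by transfer (simp add: tensor_eq_refl)
  show "- t + t = 0" unfolding uminus_tensor_def by transfer (rule tensor_eq_inverse)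
  show "t - u = t + - u" by (fact minus_tensor_def)
  show "c *\<^sub>C (t + u) = c *\<^sub>C t + c *\<^sub>C u" by transfer (simp add: tensor_eq_refl)
  show "c *\<^sub>C (d *\<^sub>C t) = (c * d) *\<^sub>C t"
    by transfer (simp add: image_mset.compositionality o_def split_def scaleC_scaleC tensor_eq_refl)
  show "1 *\<^sub>C t = t" by transfer (simp add: scaleC_one case_prod_beta tensor_eq_refl)
  show "(c + d) *\<^sub>C t = c *\<^sub>C t + d *\<^sub>C t"
  proof transfer
    fix c d and t :: "('a \<times> 'b) multiset"
    show "tensor_eq (image_mset (\<lambda>(a, b). ((c + d) *\<^sub>C a, b)) t)
       (image_mset (\<lambda>(a, b). (c *\<^sub>C a, b)) t + image_mset (\<lambda>(a, b). (d *\<^sub>C a, b)) t)"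
    proof (induction t)
      case (add x t)
      obtain a b where x: "x = (a, b)" by (cases x)
      have "tensor_eq {#((c + d) *\<^sub>C a, b)#} {#(c *\<^sub>C a, b), (d *\<^sub>C a, b)#}"
        unfolding scaleC_add_left by (rule tensor_eq_add_left)
      from tensor_eq_cong2[OF this add] show ?case by (simp add: x add_mset_commute)
    qed (simp add: tensor_eq_refl)
  qed
qed

end

lift_definition tensor :: "'a::complex_vector \<Rightarrow> 'b::complex_vector \<Rightarrow> 'a \<otimes> 'b" (infixr "\<otimes>" 72)
  is "\<lambda>a b. {#(a, b)#}" .

lemma tensor_add_left: "((a::'a::complex_vector) + a') \<otimes> (b::'b::complex_vector) = a \<otimes> b + a' \<otimes> b"
  proof transfer
  show "tensor_eq {#(a + a', b)#} ({#(a, b)#} + {#(a', b)#})" for a a' :: 'a and b :: 'b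
    using tensor_eq_add_left[of a a' b] by (simp add: add_mset_commute)
qed

lemma tensor_add_right: "(a::'a::complex_vector) \<otimes> ((b::'b::complex_vector) + b') = a \<otimes> b + a \<otimes> b'"
  proof transfer
  show "tensor_eq {#(a, b + b')#} ({#(a, b)#} + {#(a, b')#})" for a :: 'a and b b' :: 'b
    using tensor_eq_add_right[of a b b'] by (simp add: add_mset_commute)
qed

lemma tensor_scaleC_left: "(c *\<^sub>C a) \<otimes> b = c *\<^sub>C (a \<otimes> b)"
  by transfer (simp add: tensor_eq_refl)

lemma tensor_scaleC_right: "a \<otimes> (c *\<^sub>C b) = c *\<^sub>C (a \<otimes> b)"
  by transfer (simp add: tensor_eq_sym tensor_eq_scale)

lemma tensor_induct [case_names zero add]:
  assumes zero: "P 0" and add: "\<And>a b t. P t \<Longrightarrow> P (a \<otimes> b + t)"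
  shows "P t"
proof -
  have "P (abs_tensor m)" for m
  proof (induction m)
    case empty
    then show ?case using zero by (simp add: zero_tensor.abs_eq)
  next
    case (add x m)
    obtain a b where x: "x = (a, b)" by (cases x)
    from assms(2)[OF add, of a b] show ?case
      by (simp add: x tensor.abs_eq plus_tensor.abs_eq)
  qed
  then show ?thesis by (induction t rule: tensor.abs_induct)
qed

text \<open>\<open>tlift B\<close> is the additive map \<open>a \<otimes> b \<mapsto> B a b\<close>. The value does not depend on the representative
  when \<open>B\<close> is balanced. Balanced maps include the bilinear and also the
  conjugate-bilinear ones, so that conjugations extend to tensor products as well.\<close>

definition tlift :: "('a::complex_vector \<Rightarrow> 'b::complex_vector \<Rightarrow> 'c::comm_monoid_add) \<Rightarrow> 'a \<otimes> 'b \<Rightarrow> 'c"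
  where "tlift B t = (\<Sum>(a, b)\<in>#rep_tensor t. B a b)"

definition balanced :: "('a::complex_vector \<Rightarrow> 'b::complex_vector \<Rightarrow> 'c::comm_monoid_add) \<Rightarrow> bool"
  where "balanced B \<longleftrightarrow>
    (\<forall>b. B 0 b = 0) \<and>
    (\<forall>a a' b. B (a + a') b = B a b + B a' b) \<and>
    (\<forall>a b b'. B a (b + b') = B a b + B a b') \<and>
    (\<forall>c a b. B (c *\<^sub>C a) b = B a (c *\<^sub>C b))"

lemma balancedI:
  fixes B :: "'a::complex_vector \<Rightarrow> 'b::complex_vector \<Rightarrow> 'c::ab_group_add"
  assumes "\<And>a a' b. B (a + a') b = B a b + B a' b"
    and "\<And>a b b'. B a (b + b') = B a b + B a b'"
    and "\<And>c a b. B (c *\<^sub>C a) b = B a (c *\<^sub>C b)"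
  shows "balanced B"
  using assms(1)[of 0 0] assms(2,3) unfolding balanced_def by (auto simp: assms(1))

lemma tlift_abs:
  assumes "balanced B"
  shows "tlift B (abs_tensor m) = (\<Sum>(a, b)\<in>#m. B a b)"
proof -
  have "(\<Sum>(a, b)\<in>#t. B a b) = (\<Sum>(a, b)\<in>#u. B a b)" if "tensor_eq t u" for t u
    using that assms by induction (simp_all add: balanced_def)
  moreover have "tensor_eq (rep_tensor (abs_tensor m)) m"
    by (rule Quotient3_rep_abs[OF Quotient3_tensor]) (rule tensor_eq_refl)
  ultimately show ?thesis unfolding tlift_def by blast
qed

lemma tlift_zero: "balanced B \<Longrightarrow> tlift B 0 = 0"
  by (simp add: zero_tensor_def tlift_abs)

lemma tlift_tensor: "balanced B \<Longrightarrow> tlift B (a \<otimes> b) = B a b"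
  by (simp add: tensor.abs_eq tlift_abs)

lemma tlift_add: "balanced B \<Longrightarrow> tlift B (t + u) = tlift B t + tlift B u"
  by (induction t rule: tensor.abs_induct, induction u rule: tensor.abs_induct)
    (simp add: plus_tensor.abs_eq tlift_abs)

lemma tlift_add_fun:
  assumes "balanced B" "balanced B'" "balanced B''" "\<And>a b. B a b = B' a b + B'' a b"
  shows "tlift B t = tlift B' t + tlift B'' t"
  using assms(4)
  by (induction t rule: tensor_induct)
    (simp_all only: tlift_zero tlift_tensor tlift_add assms(1-3) ac_simps add_0)

lemma tlift_scaleC:
  fixes B :: "'a::complex_vector \<Rightarrow> 'b::complex_vector \<Rightarrow> 'c::complex_vector"
  assumes "balanced B" "\<And>c a b. B (c *\<^sub>C a) b = c *\<^sub>C B a b"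
  shows "tlift B (c *\<^sub>C t) = c *\<^sub>C tlift B t"
proof (induction t rule: tensor_induct)
  case zero
  then show ?case by (simp add: tlift_zero assms(1))
next
  case (add a b t)
  then show ?case
    by (simp add: scaleC_add_right tlift_add tlift_tensor assms flip: tensor_scaleC_left)
qed

definition tmap :: "('a::complex_vector \<Rightarrow> 'c::complex_vector) \<Rightarrow> ('b::complex_vector \<Rightarrow> 'd::complex_vector)
    \<Rightarrow> 'a \<otimes> 'b \<Rightarrow> 'c \<otimes> 'd"
  where "tmap f g = tlift (\<lambda>a b. f a \<otimes> g b)"

definition tswap :: "'a::complex_vector \<otimes> 'b::complex_vector \<Rightarrow> 'b \<otimes> 'a"
  where "tswap = tlift (\<lambda>a b. b \<otimes> a)"

text \<open>Higher tensor powers are bracketed to the right, \<open>H \<otimes> (H \<otimes> H)\<close>; rebracketing is explicit.\<close>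

definition tassoc :: "('a::complex_vector \<otimes> 'b::complex_vector) \<otimes> 'c::complex_vector \<Rightarrow> 'a \<otimes> 'b \<otimes> 'c"
  where "tassoc = tlift (\<lambda>t c. tlift (\<lambda>a b. a \<otimes> b \<otimes> c) t)"

definition tlift3 :: "('a::complex_vector \<Rightarrow> 'b::complex_vector \<Rightarrow> 'c::complex_vector \<Rightarrow> 'd::comm_monoid_add)
    \<Rightarrow> 'a \<otimes> 'b \<otimes> 'c \<Rightarrow> 'd"
  where "tlift3 G = tlift (\<lambda>a. tlift (G a))"

definition tlift4 :: "('a::complex_vector \<Rightarrow> 'b::complex_vector \<Rightarrow> 'c::complex_vector \<Rightarrow> 'd::complex_vector
    \<Rightarrow> 'e::comm_monoid_add) \<Rightarrow> 'a \<otimes> 'b \<otimes> 'c \<otimes> 'd \<Rightarrow> 'e"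
  where "tlift4 G = tlift (\<lambda>a. tlift3 (G a))"

text \<open>The algebra structure \<open>(a \<otimes> b) (c \<otimes> d) = a c \<otimes> b d\<close>.\<close>

lemma balanced_tensor_mult:
  "balanced (\<lambda>(c :: 'a::complex_algebra_1) (d :: 'b::complex_algebra_1). (a * c) \<otimes> (b * d))"
  by (rule balancedI)
    (simp_all add: distrib_left tensor_add_left tensor_add_right mult_scaleC_right
      tensor_scaleC_left tensor_scaleC_right)

lemma balanced_tensor_mult_left:
  "balanced (\<lambda>(a :: 'a::complex_algebra_1) (b :: 'b::complex_algebra_1).
     tlift (\<lambda>c d. (a * c) \<otimes> (b * d)) u)"
proof (rule balancedI)
  fix a a' :: 'a and b b' :: 'b and k
  note bal = balanced_tensor_mult
  show "tlift (\<lambda>c d. ((a + a') * c) \<otimes> (b * d)) u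
      = tlift (\<lambda>c d. (a * c) \<otimes> (b * d)) u + tlift (\<lambda>c d. (a' * c) \<otimes> (b * d)) u"
    by (rule tlift_add_fun[OF bal bal bal]) (simp add: distrib_right tensor_add_left)
  show "tlift (\<lambda>c d. (a * c) \<otimes> ((b + b') * d)) u
      = tlift (\<lambda>c d. (a * c) \<otimes> (b * d)) u + tlift (\<lambda>c d. (a * c) \<otimes> (b' * d)) u"
    by (rule tlift_add_fun[OF bal bal bal]) (simp add: distrib_right tensor_add_right)
  show "tlift (\<lambda>c d. ((k *\<^sub>C a) * c) \<otimes> (b * d)) u = tlift (\<lambda>c d. (a * c) \<otimes> ((k *\<^sub>C b) * d)) u"
    by (simp add: mult_scaleC_left tensor_scaleC_left tensor_scaleC_right)
qed

instantiation tensor :: (complex_algebra_1, complex_algebra_1) complex_algebra_1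
begin

definition one_tensor :: "'a \<otimes> 'b"
  where "one_tensor = 1 \<otimes> 1"

definition times_tensor :: "'a \<otimes> 'b \<Rightarrow> 'a \<otimes> 'b \<Rightarrow> 'a \<otimes> 'b"
  where "times_tensor t u = tlift (\<lambda>a b. tlift (\<lambda>c d. (a * c) \<otimes> (b * d)) u) t"

instance
proof
  fix t u v :: "'a \<otimes> 'b" and k :: complex
  have pure: "(a \<otimes> b) * (c \<otimes> d) = (a * c) \<otimes> (b * d)" for a c :: 'a and b d :: 'b
    unfolding times_tensor_def
    by (subst tlift_tensor[OF balanced_tensor_mult_left]) (rule tlift_tensor[OF balanced_tensor_mult])
  have zl: "0 * u = 0" for u :: "'a \<otimes> 'b"
    by (simp add: times_tensor_def tlift_zero balanced_tensor_mult_left)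
  show dr: "(t + u) * v = t * v + u * v" for t u v :: "'a \<otimes> 'b"
    by (simp add: times_tensor_def tlift_add balanced_tensor_mult_left)
  have pl: "(a \<otimes> b) * u = tlift (\<lambda>c d. (a * c) \<otimes> (b * d)) u" for a b and u :: "'a \<otimes> 'b"
    by (simp add: times_tensor_def tlift_tensor balanced_tensor_mult_left)
  have zr: "t * 0 = 0" for t :: "'a \<otimes> 'b"
    by (induction t rule: tensor_induct) (simp_all add: zl dr pl tlift_zero balanced_tensor_mult)
  have pdl: "(a \<otimes> b) * (u + v) = (a \<otimes> b) * u + (a \<otimes> b) * v" for a b and u v :: "'a \<otimes> 'b"
    by (simp add: pl tlift_add balanced_tensor_mult)
  show dl: "t * (u + v) = t * u + t * v" for t u v :: "'a \<otimes> 'b"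
    by (induction t rule: tensor_induct) (simp_all add: zl dr pdl)
  have a1: "(a \<otimes> b) * (c \<otimes> d) * v = (a \<otimes> b) * ((c \<otimes> d) * v)" for a b c d and v :: "'a \<otimes> 'b"
    by (induction v rule: tensor_induct) (simp_all add: zr dl pure mult.assoc)
  have a2: "(a \<otimes> b) * u * v = (a \<otimes> b) * (u * v)" for a b and u v :: "'a \<otimes> 'b"
    by (induction u rule: tensor_induct) (simp_all add: zl zr dl dr a1)
  show "t * u * v = t * (u * v)"
    by (induction t rule: tensor_induct) (simp_all add: zl dr a2)
  show "1 * t = t"
    by (induction t rule: tensor_induct) (simp_all add: one_tensor_def zr dl pure)
  show "t * 1 = t"
    by (induction t rule: tensor_induct) (simp_all add: one_tensor_def zl dr pure)
  have ps: "(k *\<^sub>C (a \<otimes> b)) * u = k *\<^sub>C ((a \<otimes> b) * u)" for a b and u :: "'a \<otimes> 'b"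
    by (induction u rule: tensor_induct)
      (simp_all add: zr dl pure mult_scaleC_left scaleC_add_right flip: tensor_scaleC_left)
  show "(k *\<^sub>C t) * u = k *\<^sub>C (t * u)"
    by (induction t rule: tensor_induct) (simp_all add: zl dr ps scaleC_add_right)
  have pr: "(a \<otimes> b) * (k *\<^sub>C u) = k *\<^sub>C ((a \<otimes> b) * u)" for a b and u :: "'a \<otimes> 'b"
    unfolding pl by (rule tlift_scaleC[OF balanced_tensor_mult])
      (simp add: mult_scaleC_right tensor_scaleC_left)
  show "t * (k *\<^sub>C u) = k *\<^sub>C (t * u)"
    by (induction t rule: tensor_induct) (simp_all add: zl dr pr scaleC_add_right)
  show "(0 :: 'a \<otimes> 'b) \<noteq> 1"
  proof
    assume 0: "(0 :: 'a \<otimes> 'b) = 1"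
    obtain f :: "'a \<Rightarrow> complex" where f: "clinear f" "f 1 = 1"
      using clinear_functional_exists[of "1 :: 'a"] by auto
    obtain g :: "'b \<Rightarrow> complex" where g: "clinear g" "g 1 = 1"
      using clinear_functional_exists[of "1 :: 'b"] by auto
    have bal: "balanced (\<lambda>a b. f a * g b)"
      by (rule balancedI)
        (simp_all add: clinear_add clinear_scaleC f g scaleC_complex_def algebra_simps)
    from 0 have "tlift (\<lambda>a b. f a * g b) (1 \<otimes> 1) = tlift (\<lambda>a b. f a * g b) 0"
      by (simp add: one_tensor_def)
    then show False by (simp add: tlift_tensor tlift_zero bal f g)
  qed
qed

end

lemma tensor_mult_tensor: "(a \<otimes> b) * (c \<otimes> d) = (a * c) \<otimes> (b * d)"
  unfolding times_tensor_def
    by (subst tlift_tensor[OF balanced_tensor_mult_left]) (rule tlift_tensor[OF balanced_tensor_mult])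


section \<open>Inverses and homomorphisms\<close>

definition minvertible :: "'a::monoid_mult \<Rightarrow> bool"
  where "minvertible x \<longleftrightarrow> (\<exists>y. x * y = 1 \<and> y * x = 1)"

definition minv :: "'a::monoid_mult \<Rightarrow> 'a"
  where "minv x = (THE y. x * y = 1 \<and> y * x = 1)"

lemma minv_eqI:
  assumes "x * y = 1" "y * x = (1::'a::monoid_mult)"
  shows "minv x = y"
  unfolding minv_def
proof (rule the_equality)
  fix z assume "x * z = 1 \<and> z * x = 1"
  then show "z = y" using assms by (metis mult.assoc mult_1_left mult_1_right)
qed (use assms in simp)

lemma minvertible_minv:
  assumes "minvertible x"
  shows "x * minv x = 1" "minv x * x = 1"
  using assms unfolding minvertible_def by (metis minv_eqI)+

definition alg_hom :: "('a::complex_algebra_1 \<Rightarrow> 'b::complex_algebra_1) \<Rightarrow> bool"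
  where "alg_hom f \<longleftrightarrow> clinear f \<and> f 1 = 1 \<and> (\<forall>a b. f (a * b) = f a * f b)"

definition alg_antihom :: "('a::complex_algebra_1 \<Rightarrow> 'b::complex_algebra_1) \<Rightarrow> bool"
  where "alg_antihom f \<longleftrightarrow> clinear f \<and> f 1 = 1 \<and> (\<forall>a b. f (a * b) = f b * f a)"

definition conjugation_operation :: "('a::complex_algebra_1 \<Rightarrow> 'a) \<Rightarrow> bool"
  where "conjugation_operation dag \<longleftrightarrow>
    (\<forall>a b. dag (a + b) = dag a + dag b) \<and>
    (\<forall>c a. dag (c *\<^sub>C a) = cnj c *\<^sub>C dag a) \<and>
    (\<forall>a. dag (dag a) = a) \<and>
    (\<forall>a b. dag (a * b) = dag b * dag a)"


section \<open>Quasi-Hopf algebras\<close>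

text \<open>\<open>\<epsilon> \<otimes> 1\<close> and \<open>1 \<otimes> \<epsilon>\<close>, with \<open>\<complex> \<otimes> A\<close> and \<open>A \<otimes> \<complex>\<close> identified with \<open>A\<close>.\<close>

definition counit_left :: "('a::complex_vector \<Rightarrow> complex) \<Rightarrow> 'a \<otimes> 'b::complex_vector \<Rightarrow> 'b"
  where "counit_left eps = tlift (\<lambda>a b. eps a *\<^sub>C b)"

definition counit_right :: "('b::complex_vector \<Rightarrow> complex) \<Rightarrow> 'a::complex_vector \<otimes> 'b \<Rightarrow> 'a"
  where "counit_right eps = tlift (\<lambda>a b. eps b *\<^sub>C a)"

locale quasi_hopf_algebra =
  fixes eps :: "'h::complex_algebra_1 \<Rightarrow> complex"
    and \<Delta> :: "'h \<Rightarrow> 'h \<otimes> 'h"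
    and \<Phi> :: "'h \<otimes> 'h \<otimes> 'h"
    and S :: "'h \<Rightarrow> 'h"
    and \<alpha> \<beta> :: 'h
  assumes counit_hom: "alg_hom eps"
    and coproduct_hom: "alg_hom \<Delta>"
    and coassociator_invertible: "minvertible \<Phi>"
    and antipode_antihom: "alg_antihom S"
    and antipode_bij: "bij S"
    and counit_coproduct_left: "counit_left eps (\<Delta> a) = a"
    and counit_coproduct_right: "counit_right eps (\<Delta> a) = a"
    and quasi_coassoc: "tmap id \<Delta> (\<Delta> a) = minv \<Phi> * tassoc (tmap \<Delta> id (\<Delta> a)) * \<Phi>"
    and pentagon: "tassoc (tmap \<Delta> id \<Phi>) * tmap id (tmap id \<Delta>) \<Phi> =
      tmap id tassoc (tassoc (\<Phi> \<otimes> (1::'h))) * tmap id tassoc (tmap id (tmap \<Delta> id) \<Phi>) * (1 \<otimes> \<Phi>)"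
    and counit_coassociator: "tmap id (counit_left eps) \<Phi> = 1"
    and antipode_coassociator: "tlift3 (\<lambda>x y z. S x * \<alpha> * y * \<beta> * S z) \<Phi> = 1"
    and antipode_coassociator_inv: "tlift3 (\<lambda>x y z. x * \<beta> * S y * \<alpha> * z) (minv \<Phi>) = 1"
    and antipode_left: "tlift (\<lambda>x y. S x * \<alpha> * y) (\<Delta> a) = eps a *\<^sub>C \<alpha>"
    and antipode_right: "tlift (\<lambda>x y. x * \<beta> * S y) (\<Delta> a) = eps a *\<^sub>C \<beta>"

definition is_twist :: "('h::complex_algebra_1 \<Rightarrow> complex) \<Rightarrow> 'h \<otimes> 'h \<Rightarrow> bool"
  where "is_twist eps F \<longleftrightarrow> minvertible F \<and> counit_left eps F = 1 \<and> counit_right eps F = 1"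

definition twisted_coproduct ::
  "'h::complex_algebra_1 \<otimes> 'h \<Rightarrow> ('h \<Rightarrow> 'h \<otimes> 'h) \<Rightarrow> 'h \<Rightarrow> 'h \<otimes> 'h"
  where "twisted_coproduct F \<Delta> a = F * \<Delta> a * minv F"

definition twisted_coassociator ::
  "'h::complex_algebra_1 \<otimes> 'h \<Rightarrow> ('h \<Rightarrow> 'h \<otimes> 'h) \<Rightarrow> 'h \<otimes> 'h \<otimes> 'h \<Rightarrow> 'h \<otimes> 'h \<otimes> 'h"
  where "twisted_coassociator F \<Delta> \<Phi> =
    tassoc (F \<otimes> (1::'h)) * tassoc (tmap \<Delta> id F) * \<Phi> * tmap id \<Delta> (minv F) * (1 \<otimes> minv F)"

definition twisted_alpha :: "'h::complex_algebra_1 \<otimes> 'h \<Rightarrow> ('h \<Rightarrow> 'h) \<Rightarrow> 'h \<Rightarrow> 'h"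
  where "twisted_alpha F S \<alpha> = tlift (*) ((1 \<otimes> \<alpha>) * tmap S id (minv F))"

definition twisted_beta :: "'h::complex_algebra_1 \<otimes> 'h \<Rightarrow> ('h \<Rightarrow> 'h) \<Rightarrow> 'h \<Rightarrow> 'h"
  where "twisted_beta F S \<beta> = tlift (*) ((1 \<otimes> \<beta>) * tmap id S F)"

locale quasi_hopf_star_algebra = quasi_hopf_algebra eps \<Delta> \<Phi> S \<alpha> \<beta>
  for eps :: "'h::complex_algebra_1 \<Rightarrow> complex"
    and \<Delta> :: "'h \<Rightarrow> 'h \<otimes> 'h"
    and \<Phi> :: "'h \<otimes> 'h \<otimes> 'h"
    and S :: "'h \<Rightarrow> 'h"
    and \<alpha> \<beta> :: 'h +
  fixes dag :: "'h \<Rightarrow> 'h"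
    and \<Omega> :: "'h \<otimes> 'h"
  assumes conjugation: "conjugation_operation dag"
    and canonical_twist: "is_twist eps \<Omega>"
    and counit_dag: "eps (dag a) = cnj (eps a)"
    and coproduct_dag: "tmap dag dag (\<Delta> a) = twisted_coproduct \<Omega> \<Delta> (dag a)"
    and coassociator_dag:
      "minv (tmap dag (tmap dag dag) \<Phi>) = twisted_coassociator \<Omega> \<Delta> \<Phi>"

definition conj_antipode :: "('h \<Rightarrow> 'h) \<Rightarrow> ('h \<Rightarrow> 'h) \<Rightarrow> 'h::complex_algebra_1 \<Rightarrow> 'h"
  where "conj_antipode S dag a = dag (inv S (dag a))"

definition canonical_w ::
  "('h \<Rightarrow> 'h) \<Rightarrow> 'h \<Rightarrow> 'h \<Rightarrow> ('h \<Rightarrow> 'h) \<Rightarrow> 'h::complex_algebra_1 \<otimes> 'h \<Rightarrow> 'h"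
  where "canonical_w S \<alpha> \<beta> dag \<Omega> =
    (THE w. minvertible w \<and>
      w * dag (inv S \<beta>) = twisted_alpha \<Omega> S \<alpha> \<and>
      twisted_beta \<Omega> S \<beta> * w = dag (inv S \<alpha>) \<and>
      (\<forall>a. S a = w * conj_antipode S dag a * minv w))"

definition drinfeld_gamma ::
  "('h \<Rightarrow> 'h \<otimes> 'h) \<Rightarrow> 'h \<otimes> 'h \<otimes> 'h \<Rightarrow> ('h \<Rightarrow> 'h) \<Rightarrow> 'h \<Rightarrow> 'h::complex_algebra_1 \<otimes> 'h"
  where "drinfeld_gamma \<Delta> \<Phi> S \<alpha> =
    tlift4 (\<lambda>a b c d. (S b * \<alpha> * c) \<otimes> (S a * \<alpha> * d))
      (tmap id tassoc (tassoc (minv \<Phi> \<otimes> (1::'h))) * tassoc (tmap \<Delta> id \<Phi>))"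

definition drinfeld_twist ::
  "('h \<Rightarrow> 'h \<otimes> 'h) \<Rightarrow> 'h \<otimes> 'h \<otimes> 'h \<Rightarrow> ('h \<Rightarrow> 'h) \<Rightarrow> 'h \<Rightarrow> 'h \<Rightarrow> 'h::complex_algebra_1 \<otimes> 'h"
  where "drinfeld_twist \<Delta> \<Phi> S \<alpha> \<beta> =
    tlift3 (\<lambda>x y z. tmap S S (tswap (\<Delta> x)) * drinfeld_gamma \<Delta> \<Phi> S \<alpha> * \<Delta> (y * \<beta> * S z)) \<Phi>"

definition second_drinfeld_twist ::
  "('h \<Rightarrow> 'h \<otimes> 'h) \<Rightarrow> 'h \<otimes> 'h \<otimes> 'h \<Rightarrow> ('h \<Rightarrow> 'h) \<Rightarrow> 'h \<Rightarrow> 'h \<Rightarrow> 'h::complex_algebra_1 \<otimes> 'h"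
  where "second_drinfeld_twist \<Delta> \<Phi> S \<alpha> \<beta> =
    tmap (inv S) (inv S) (tswap (drinfeld_twist \<Delta> \<Phi> S \<alpha> \<beta>))"

end

theory Submission
  imports Defs
begin

text \<open>Antipode data \<open>(\<sigma>, a, b)\<close> along an algebra homomorphism \<open>f : H \<rightarrow> A\<close> are unique up to
  a unique invertible element of \<open>A\<close>, given by an explicit sum over \<open>\<Phi>\<close>. The Drinfeld twist is this
  element for \<open>f = \<Delta>\<close>, the data \<open>(\<Delta> S, \<Delta>(\<alpha>), \<Delta>(\<beta>))\<close> and the data \<open>((S \<otimes> S) \<Delta>\<^sup>T, \<gamma>, \<delta>)\<close>,
  where \<open>\<delta>\<close> is the element called \<open>\<gamma>\<close>-bar in the formula for \<open>F\<^sub>\<delta>\<^sup>-\<^sup>1\<close>; likewise \<open>w\<close> is the element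
  comparing \<open>S\<close> with the conjugate antipode. Hence \<open>F\<^sub>\<delta>\<close> is the only \<open>v\<close> with
  \<open>v \<Delta>(S(h)) = (S \<otimes> S)(\<Delta>\<^sup>T(h)) v\<close> and \<open>v \<Delta>(\<alpha>) = \<gamma>\<close>, and the theorem follows once these two
  equations are checked for the conjugate of the right-hand side. The first is immediate from the
  properties of \<open>w\<close>; the second amounts to the behaviour of \<open>\<delta>\<close> under twisting by \<open>\<Omega>\<close>.\<close>

section \<open>Calculus in tensor products\<close>

text \<open>Conjugation followed by S^-1 exchanges the roles of \<alpha> and \<beta>. The conjugate
  of \<gamma> is therefore an expression of the shape of \<delta>, with the twisted \<beta> in it;
  this is why \<delta> must be treated on the same footing as \<gamma>, although it does not occur
  in the definition of the twist, and why the relation \<delta> F = \<Delta>(\<beta>) is needed. The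
  price is the verification that \<gamma> and \<delta> together satisfy the two antipode axioms that
  involve \<Phi>, a pentagon calculation with six slots. Sweedler-style sums would bury that
  calculation in indices. Instead, the slots of a tensor power are legs, that is, pairwise commuting
  algebra homomorphisms into one algebra, and identities between \<Phi>, \<Delta> and \<Omega> are
  equations between products in that algebra. The antipode axioms are not such equations. They enter
  through a linear functional that evaluates the slots, as the rule that a coproduct at the outer
  end of a product may be replaced by the counit.\<close>

lemma additive_clinear: "clinear f \<Longrightarrow> additive f"
  by (simp add: additive_def clinear_add)

lemma additive_sum_mset: "additive g \<Longrightarrow> g (\<Sum>x\<in>#M. f x) = (\<Sum>x\<in>#M. g (f x))"
  by (induction M) (simp_all add: additive.zero additive.add)

lemma additive_tlift: "additive g \<Longrightarrow> g (tlift B t) = tlift (\<lambda>a b. g (B a b)) t"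
  by (simp add: tlift_def additive_sum_mset split_def)

lemma additive_tlift3: "additive g \<Longrightarrow> g (tlift3 B t) = tlift3 (\<lambda>a b c. g (B a b c)) t"
  by (simp add: tlift3_def additive_tlift)

text \<open>Additivity suffices because a scalar can be absorbed into a pure tensor; in this form
  the principle also covers conjugations.\<close>

lemma tensor_ext:
  assumes "additive F" "additive G" "\<And>a b. F (a \<otimes> b) = G (a \<otimes> b)"
  shows "F t = G t"
  by (induction t rule: tensor_induct) (simp_all add: assms additive.zero additive.add)

lemma additive_mult_left: "additive (\<lambda>x. c * x :: 'a::ring)"
  by (simp add: additive_def distrib_left)

lemma additive_mult_right: "additive (\<lambda>x. x * c :: 'a::ring)"
  by (simp add: additive_def distrib_right)

lemma additive_scaleC: "additive (\<lambda>x::'a::complex_vector. c *\<^sub>C x)"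
  by (simp add: additive_def scaleC_add_right)

named_theorems lin

lemma clinear_id [lin]: "clinear (\<lambda>x::'a::complex_vector. x)"
  by (rule clinearI) auto

lemma clinear_compose: "clinear g \<Longrightarrow> clinear f \<Longrightarrow> clinear (\<lambda>x. g (f x))"
  by (rule clinearI) (simp_all add: clinear_add clinear_scaleC)

lemma clinear_mult_right [lin]:
  "clinear f \<Longrightarrow> clinear (\<lambda>x. f x * (c::'a::complex_algebra_1))"
  by (rule clinearI) (simp_all add: clinear_add clinear_scaleC distrib_right mult_scaleC_left)

lemma clinear_mult_left [lin]:
  "clinear f \<Longrightarrow> clinear (\<lambda>x. (c::'a::complex_algebra_1) * f x)"
  by (rule clinearI) (simp_all add: clinear_add clinear_scaleC distrib_left mult_scaleC_right)

lemma clinear_tensor_left [lin]: "clinear f \<Longrightarrow> clinear (\<lambda>x. c \<otimes> f x)"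
  by (rule clinearI) (simp_all add: clinear_add clinear_scaleC tensor_add_right tensor_scaleC_right)

lemma clinear_tensor_right [lin]: "clinear f \<Longrightarrow> clinear (\<lambda>x. f x \<otimes> c)"
  by (rule clinearI) (simp_all add: clinear_add clinear_scaleC tensor_add_left tensor_scaleC_left)

lemma clinear_scaleC_left [lin]: "clinear f \<Longrightarrow> clinear (\<lambda>x. f x *\<^sub>C c)"
  by (rule clinearI)
    (simp_all add: clinear_add clinear_scaleC scaleC_add_left scaleC_scaleC scaleC_complex_def)

lemma clinear_scaleC_right [lin]: "clinear f \<Longrightarrow> clinear (\<lambda>x. c *\<^sub>C f x)"
  by (rule clinearI) (simp_all add: clinear_add clinear_scaleC scaleC_add_right scaleC_scaleC mult.commute)

text \<open>For a fixed tensor, \<open>tlift\<close> is a finite sum over one chosen representative,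
  so linearity in the parameter holds summand by summand.\<close>

lemma clinear_tlift_fun:
  assumes "\<And>a b. clinear (\<lambda>x. B x a b)"
  shows "clinear (\<lambda>x. tlift (B x) t)"
proof (rule clinearI)
  show "tlift (B (x + y)) t = tlift (B x) t + tlift (B y) t" for x y
    by (simp add: tlift_def clinear_add[OF assms] split_def sum_mset.distrib)
  show "tlift (B (c *\<^sub>C x)) t = c *\<^sub>C tlift (B x) t" for c x
    by (simp add: additive_tlift[OF additive_scaleC] flip: clinear_scaleC[OF assms])
qed

definition cbilinear :: "('a::complex_vector \<Rightarrow> 'b::complex_vector \<Rightarrow> 'c::complex_vector) \<Rightarrow> bool"
  where "cbilinear B \<longleftrightarrow> (\<forall>b. clinear (\<lambda>a. B a b)) \<and> (\<forall>a. clinear (B a))"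

lemma cbilinearI:
  "(\<And>b. clinear (\<lambda>a. B a b)) \<Longrightarrow> (\<And>a. clinear (\<lambda>b. B a b)) \<Longrightarrow> cbilinear B"
  by (simp add: cbilinear_def)

lemma balanced_cbilinear:
  assumes "cbilinear B"
  shows "balanced B"
proof (rule balancedI)
  have l: "clinear (\<lambda>a. B a b)" and r: "clinear (B a)" for a b
    using assms by (auto simp: cbilinear_def)
  show "B (a + a') b = B a b + B a' b" for a a' b by (rule clinear_add[OF l])
  show "B a (b + b') = B a b + B a b'" for a b b' by (rule clinear_add[OF r])
  show "B (c *\<^sub>C a) b = B a (c *\<^sub>C b)" for a b c
    by (simp add: clinear_scaleC[OF l] clinear_scaleC[OF r])
qed

lemma tlift_pure: "cbilinear B \<Longrightarrow> tlift B (a \<otimes> b) = B a b"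
  by (simp add: tlift_tensor balanced_cbilinear)

lemma clinear_tlift: "cbilinear B \<Longrightarrow> clinear (tlift B)"
  by (rule clinearI) (auto simp: tlift_add balanced_cbilinear cbilinear_def
      intro!: tlift_scaleC balanced_cbilinear clinear_scaleC[of "\<lambda>a. B a b" for b])

subsection \<open>Maps built from additive maps\<close>

text \<open>Linear maps are the semilinear ones for \<open>\<phi> = id\<close>, conjugations those for \<open>\<phi> = cnj\<close>.\<close>

definition semilinear :: "(complex \<Rightarrow> complex) \<Rightarrow> ('a::complex_vector \<Rightarrow> 'b::complex_vector) \<Rightarrow> bool"
  where "semilinear \<phi> f \<longleftrightarrow> additive f \<and> (\<forall>c x. f (c *\<^sub>C x) = \<phi> c *\<^sub>C f x)"

lemma semilinear_id: "semilinear id f \<longleftrightarrow> clinear f"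
  by (auto simp: semilinear_def additive_clinear clinear_scaleC additive.add intro: clinearI)

context
  fixes \<phi> :: "complex \<Rightarrow> complex"
    and f :: "'a::complex_vector \<Rightarrow> 'c::complex_vector" and g :: "'b::complex_vector \<Rightarrow> 'd::complex_vector"
  assumes sl: "semilinear \<phi> f" "semilinear \<phi> g"
begin

lemma balanced_tmap: "balanced (\<lambda>a b. f a \<otimes> g b)"
  using sl by (intro balancedI) (simp_all add: semilinear_def additive.add tensor_add_left
      tensor_add_right tensor_scaleC_left tensor_scaleC_right)

lemma tmap_pure: "tmap f g (a \<otimes> b) = f a \<otimes> g b"
  by (simp add: tmap_def tlift_tensor balanced_tmap)

lemma semilinear_tmap: "semilinear \<phi> (tmap f g)"
proof -
  have *: "tmap f g (c *\<^sub>C (a \<otimes> b)) = \<phi> c *\<^sub>C tmap f g (a \<otimes> b)" for c a b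
    using sl tmap_pure[of "c *\<^sub>C a" b]
    by (simp add: semilinear_def tensor_scaleC_left tmap_pure)
  have "tmap f g (c *\<^sub>C t) = \<phi> c *\<^sub>C tmap f g t" for c t
    by (induction t rule: tensor_induct)
      (simp_all add: tmap_def tlift_zero tlift_add balanced_tmap scaleC_add_right *[unfolded tmap_def])
  then show ?thesis
    by (simp add: semilinear_def additive_def tmap_def tlift_add balanced_tmap)
qed

end

lemmas clinear_tmap = semilinear_tmap[of id, unfolded semilinear_id]
lemmas clinear_tmap_pure = tmap_pure[of id, unfolded semilinear_id]

lemma cbilinear_swap: "cbilinear (\<lambda>a b. b \<otimes> a)"
  by (intro cbilinearI lin)

lemma tswap_pure: "tswap (a \<otimes> b) = b \<otimes> a"
  by (simp add: tswap_def tlift_pure cbilinear_swap)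

lemma clinear_tswap: "clinear tswap"
  unfolding tswap_def by (rule clinear_tlift[OF cbilinear_swap])

lemma cbilinear_tassoc1: "cbilinear (\<lambda>a b. a \<otimes> b \<otimes> c)"
  by (intro cbilinearI lin)

lemma cbilinear_tassoc2: "cbilinear (\<lambda>t c. tlift (\<lambda>a b. a \<otimes> b \<otimes> c) t)"
  by (intro cbilinearI clinear_tlift cbilinear_tassoc1 clinear_tlift_fun lin)

lemma tassoc_pure: "tassoc ((a \<otimes> b) \<otimes> c) = a \<otimes> b \<otimes> c"
  by (simp add: tassoc_def tlift_pure cbilinear_tassoc1 cbilinear_tassoc2)

lemma clinear_tassoc: "clinear tassoc"
  unfolding tassoc_def by (rule clinear_tlift[OF cbilinear_tassoc2])

lemma tensor_zero: "(0::'a::complex_vector) \<otimes> b = 0" "a \<otimes> (0::'b::complex_vector) = 0"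
  using tensor_add_left[of 0 0 b] tensor_add_right[of a 0 0] by simp_all


section \<open>Evaluation of a tensor in an algebra along two maps\<close>

definition lift2 :: "('a::complex_vector \<Rightarrow> 'm) \<Rightarrow> ('b::complex_vector \<Rightarrow> 'm) \<Rightarrow> 'a \<otimes> 'b \<Rightarrow> 'm::complex_algebra_1"
  where "lift2 p q = tlift (\<lambda>a b. p a * q b)"

context
  fixes p :: "'a::complex_vector \<Rightarrow> 'm::complex_algebra_1" and q :: "'b::complex_vector \<Rightarrow> 'm"
  assumes pq: "clinear p" "clinear q"
begin

lemma cbilinear_lift2: "cbilinear (\<lambda>a b. p a * q b)"
  by (intro cbilinearI lin pq)

lemma lift2_pure: "lift2 p q (a \<otimes> b) = p a * q b"
  by (simp add: lift2_def tlift_pure cbilinear_lift2)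

lemma clinear_lift2: "clinear (lift2 p q)"
  unfolding lift2_def by (rule clinear_tlift[OF cbilinear_lift2])

lemma additive_lift2: "additive (lift2 p q)"
  by (rule additive_clinear[OF clinear_lift2])

end

lemma lift2_tmap:
  assumes "clinear p" "clinear q" "clinear f" "clinear g"
  shows "lift2 p q (tmap f g t) = lift2 (\<lambda>x. p (f x)) (\<lambda>x. q (g x)) t"
  by (rule tensor_ext[of "\<lambda>t. lift2 p q (tmap f g t)"])
    (simp_all add: assms additive_clinear clinear_compose clinear_lift2 clinear_tmap
      clinear_tmap_pure lift2_pure)

lemma lift2_tassoc:
  assumes p: "clinear p" and q: "clinear q" and r: "clinear r"
  shows "lift2 p (lift2 q r) (tassoc t) = lift2 (lift2 p q) r t"
proof (rule tensor_ext[of "\<lambda>t. lift2 p (lift2 q r) (tassoc t)"])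
  fix u c
  show "lift2 p (lift2 q r) (tassoc (u \<otimes> c)) = lift2 (lift2 p q) r (u \<otimes> c)"
    by (rule tensor_ext[of "\<lambda>u. lift2 p (lift2 q r) (tassoc (u \<otimes> c))"
          "\<lambda>u. lift2 (lift2 p q) r (u \<otimes> c)"])
      (simp_all add: p q r additive_clinear clinear_lift2 clinear_compose[OF clinear_lift2]
        clinear_compose[OF clinear_tassoc] clinear_tassoc lin lift2_pure tassoc_pure mult.assoc)
qed (simp_all add: p q r additive_clinear clinear_lift2 clinear_compose clinear_tassoc)

text \<open>Generation as an additive monoid, phrased as an induction principle so that it passes to
  nested tensor powers one factor at a time.\<close>

definition spanning :: "'a::monoid_add set \<Rightarrow> bool"
  where "spanning A \<longleftrightarrow> (\<forall>Q. Q 0 \<longrightarrow> (\<forall>x\<in>A. \<forall>t. Q t \<longrightarrow> Q (x + t)) \<longrightarrow> (\<forall>t. Q t))"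

lemma spanning_ext:
  assumes "spanning A" "additive F" "additive G" "\<And>x. x \<in> A \<Longrightarrow> F x = G x"
  shows "F t = G t"
  by (rule assms(1)[unfolded spanning_def, rule_format, of "\<lambda>t. F t = G t"])
    (simp_all add: additive.zero additive.add assms(2-4))

lemma spanning_UNIV: "spanning UNIV"
  unfolding spanning_def by (metis UNIV_I add.right_neutral)

text \<open>For fixed a in \<open>A\<close>, adding a \<otimes> b preserves \<open>Q\<close> when b
  is 0 or is enlarged by an element of \<open>B\<close>, hence for every b. The same argument then
  frees the first factor.\<close>

lemma spanning_tensor:
  assumes A: "spanning A" and B: "spanning B"
  shows "spanning {a \<otimes> b | a b. a \<in> A \<and> b \<in> B}"
  unfolding spanning_def
proof (intro allI impI)
  fix Q t
  assume 0: "Q 0" and step: "\<forall>x\<in>{a \<otimes> b |a b. a \<in> A \<and> b \<in> B}. \<forall>t. Q t \<longrightarrow> Q (x + t)"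
  have 1: "\<forall>t. Q t \<longrightarrow> Q (a \<otimes> b + t)" if "a \<in> A" for a b
    by (rule B[unfolded spanning_def, rule_format, of "\<lambda>b. \<forall>t. Q t \<longrightarrow> Q (a \<otimes> b + t)"])
      (use step that in \<open>auto simp: tensor_zero tensor_add_right add.assoc\<close>)
  have 2: "\<forall>t. Q t \<longrightarrow> Q (a \<otimes> b + t)" for a b
    by (rule A[unfolded spanning_def, rule_format, of "\<lambda>a. \<forall>t. Q t \<longrightarrow> Q (a \<otimes> b + t)"])
      (use 1 in \<open>auto simp: tensor_zero tensor_add_left add.assoc\<close>)
  show "Q t" by (induction t rule: tensor_induct) (use 0 2 in auto)
qed

lemma spanning_pure3: "spanning {x \<otimes> y \<otimes> z | x y z. True}"
  by (rule back_subst[of spanning, OF spanning_tensor[OF spanning_UNIV spanning_tensor[OF spanning_UNIV spanning_UNIV]]])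
    blast

lemma spanning_pure4: "spanning {x \<otimes> y \<otimes> z \<otimes> w | x y z w. True}"
  by (rule back_subst[of spanning, OF spanning_tensor[OF spanning_UNIV spanning_pure3]]) blast

context
  fixes F :: "'a::complex_vector \<Rightarrow> 'b::complex_vector \<Rightarrow> 'c::complex_vector \<Rightarrow> 'v::complex_vector"
  assumes F: "\<And>y z. clinear (\<lambda>x. F x y z)" "\<And>x z. clinear (\<lambda>y. F x y z)" "\<And>x y. clinear (\<lambda>z. F x y z)"
begin

lemma cbilinear_tlift3: "cbilinear (F x)" "cbilinear (\<lambda>x. tlift (F x))"
  by (intro cbilinearI F clinear_tlift_fun clinear_tlift)+

lemma clinear_tlift3: "clinear (tlift3 F)"
  unfolding tlift3_def by (rule clinear_tlift[OF cbilinear_tlift3(2)])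

lemma tlift3_pure: "tlift3 F (x \<otimes> y \<otimes> z) = F x y z"
  by (simp add: tlift3_def tlift_pure cbilinear_tlift3)

end

context
  fixes F :: "'a::complex_vector \<Rightarrow> 'b::complex_vector \<Rightarrow> 'c::complex_vector \<Rightarrow> 'd::complex_vector
    \<Rightarrow> 'v::complex_vector"
  assumes F: "\<And>y z w. clinear (\<lambda>x. F x y z w)" "\<And>x z w. clinear (\<lambda>y. F x y z w)"
    "\<And>x y w. clinear (\<lambda>z. F x y z w)" "\<And>x y z. clinear (\<lambda>w. F x y z w)"
begin

lemma cbilinear_tlift4: "cbilinear (\<lambda>x. tlift3 (F x))"
  by (intro cbilinearI) (unfold tlift3_def[abs_def], (intro clinear_tlift_fun cbilinearI clinear_tlift F)+)

lemma clinear_tlift4: "clinear (tlift4 F)"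
  unfolding tlift4_def by (rule clinear_tlift[OF cbilinear_tlift4])

lemma tlift4_pure: "tlift4 F (x \<otimes> y \<otimes> z \<otimes> w) = F x y z w"
  by (simp add: tlift4_def tlift_pure tlift3_pure cbilinear_tlift4 F)

end

section \<open>Legs\<close>

definition commuting :: "('a \<Rightarrow> 'm::times) \<Rightarrow> ('b \<Rightarrow> 'm) \<Rightarrow> bool"
  where "commuting p q \<longleftrightarrow> (\<forall>a b. p a * q b = q b * p a)"

lemma commutingD: "commuting p q \<Longrightarrow> p a * q b = q b * p a"
  by (simp add: commuting_def)

lemma commuting_sym: "commuting p q \<Longrightarrow> commuting q p"
  by (simp add: commuting_def)

lemma alg_hom_clinear: "alg_hom p \<Longrightarrow> clinear p"
  and alg_hom_one: "alg_hom p \<Longrightarrow> p 1 = 1"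
  and alg_hom_mult: "alg_hom p \<Longrightarrow> p (a * b) = p a * p b"
  by (auto simp: alg_hom_def)

lemma alg_hom_additive: "alg_hom p \<Longrightarrow> additive p"
  by (simp add: additive_clinear alg_hom_clinear)

lemma alg_hom_compose: "alg_hom p \<Longrightarrow> alg_hom q \<Longrightarrow> alg_hom (\<lambda>x. p (q x))"
  by (simp add: alg_hom_def clinear_compose)

lemma alg_hom_minvertible:
  assumes "alg_hom p" "minvertible x"
  shows "p (minv x) * p x = 1" "p x * p (minv x) = 1"
  using assms by (simp_all add: minvertible_minv alg_hom_one flip: alg_hom_mult)

lemma lift2_mult_left: "c * lift2 p q t = tlift (\<lambda>a b. c * (p a * q b)) t"
  by (simp add: lift2_def additive_tlift[OF additive_mult_left])

lemma lift2_mult_right: "lift2 p q t * c = tlift (\<lambda>a b. p a * q b * c) t"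
  by (simp add: lift2_def additive_tlift[OF additive_mult_right])

lemma lift2_intertwine:
  assumes "\<And>a. p a * c = c * p' a" "\<And>b. q b * c = c * q' b"
  shows "lift2 p q t * c = c * lift2 p' q' t"
proof -
  have "p a * q b * c = c * (p' a * q' b)" for a b
    by (metis assms mult.assoc)
  then show ?thesis by (simp add: lift2_mult_left lift2_mult_right)
qed

lemma commuting_lift2: "commuting p r \<Longrightarrow> commuting q r \<Longrightarrow> commuting (lift2 p q) r"
  unfolding commuting_def by (blast intro: lift2_intertwine)

text \<open>The universal property of the tensor product of algebras. Commutation is what allows
  p(c) to cross q(b) when the two products are interleaved.\<close>

lemma alg_hom_lift2:
  assumes p: "alg_hom p" and q: "alg_hom q" and pq: "commuting p q"
  shows "alg_hom (lift2 p q)"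
proof -
  note lin = clinear_lift2[OF alg_hom_clinear[OF p] alg_hom_clinear[OF q]]
  note pure = lift2_pure[OF alg_hom_clinear[OF p] alg_hom_clinear[OF q]]
  have pp: "lift2 p q ((a \<otimes> b) * (c \<otimes> d)) = lift2 p q (a \<otimes> b) * lift2 p q (c \<otimes> d)" for a b c d
  proof -
    have "p a * p c * (q b * q d) = p a * (p c * q b) * q d" by (simp add: mult.assoc)
    also have "\<dots> = p a * q b * (p c * q d)"
      unfolding commutingD[OF pq, of c b] by (simp only: mult.assoc)
    finally show ?thesis by (simp add: tensor_mult_tensor pure alg_hom_mult p q)
  qed
  have pt: "lift2 p q ((a \<otimes> b) * u) = lift2 p q (a \<otimes> b) * lift2 p q u" for a b u
    by (rule tensor_ext[of "\<lambda>u. lift2 p q ((a \<otimes> b) * u)"])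
      (intro additive_clinear clinear_compose[OF lin] clinear_mult_left lin clinear_id pp)+
  have "lift2 p q (t * u) = lift2 p q t * lift2 p q u" for t u
    by (rule tensor_ext[of "\<lambda>t. lift2 p q (t * u)"])
      (intro additive_clinear clinear_compose[OF lin] clinear_mult_right lin clinear_id pt)+
  moreover have "lift2 p q 1 = 1"
    by (simp add: one_tensor_def pure alg_hom_one p q)
  ultimately show ?thesis using lin by (simp add: alg_hom_def)
qed

lemma alg_hom_lift2_comp: "alg_hom \<phi> \<Longrightarrow> \<phi> (lift2 p q t) = lift2 (\<lambda>x. \<phi> (p x)) (\<lambda>x. \<phi> (q x)) t"
  by (simp add: lift2_def additive_tlift alg_hom_additive alg_hom_mult)

definition inl :: "'a::complex_vector \<Rightarrow> 'a \<otimes> 'b::complex_algebra_1" where "inl a = a \<otimes> 1"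
definition inr :: "'b::complex_vector \<Rightarrow> 'a::complex_algebra_1 \<otimes> 'b" where "inr b = 1 \<otimes> b"

lemma alg_hom_inl: "alg_hom inl"
  unfolding alg_hom_def inl_def
  by (auto simp: one_tensor_def tensor_mult_tensor intro!: lin)

lemma alg_hom_inr: "alg_hom inr"
  unfolding alg_hom_def inr_def
  by (auto simp: one_tensor_def tensor_mult_tensor intro!: lin)

lemma commuting_compose:
  "alg_hom \<phi> \<Longrightarrow> commuting p q \<Longrightarrow> commuting (\<lambda>x. \<phi> (p x)) (\<lambda>x. \<phi> (q x))"
  by (simp add: commuting_def flip: alg_hom_mult)

lemma lift2_inl_inr: "lift2 inl inr t = t"
proof (rule tensor_ext[of "lift2 inl inr" "\<lambda>t. t"])
  show "additive (lift2 inl inr)"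
    by (intro additive_clinear clinear_lift2 alg_hom_clinear alg_hom_inl alg_hom_inr)
  show "lift2 inl inr (a \<otimes> b) = a \<otimes> b" for a b
    by (simp add: lift2_pure alg_hom_clinear alg_hom_inl alg_hom_inr)
      (simp add: inl_def inr_def tensor_mult_tensor)
qed (simp add: additive_def)

subsection \<open>Exchanging legs under a functional\<close>

text \<open>A functional such as S(x) \<alpha> y \<beta> S(z) is not multiplicative, so an antipode
  axiom gives no identity inside the tensor power. It only permits exchanges at an outer end of a
  product under the functional: on the left for \<alpha>, on the right for \<beta>.\<close>

definition lcong :: "('m::times \<Rightarrow> 'v) \<Rightarrow> ('a \<Rightarrow> 'm) \<Rightarrow> ('a \<Rightarrow> 'm) \<Rightarrow> bool"
  where "lcong \<Theta> p p' \<longleftrightarrow> (\<forall>h t. \<Theta> (p h * t) = \<Theta> (p' h * t))"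

definition rcong :: "('m::times \<Rightarrow> 'v) \<Rightarrow> ('a \<Rightarrow> 'm) \<Rightarrow> ('a \<Rightarrow> 'm) \<Rightarrow> bool"
  where "rcong \<Theta> p p' \<longleftrightarrow> (\<forall>h t. \<Theta> (t * p h) = \<Theta> (t * p' h))"

lemma lcongD: "lcong \<Theta> p p' \<Longrightarrow> \<Theta> (p h * t) = \<Theta> (p' h * t)"
  by (simp add: lcong_def)

lemma rcongD: "rcong \<Theta> p p' \<Longrightarrow> \<Theta> (t * p h) = \<Theta> (t * p' h)"
  by (simp add: rcong_def)

context
  fixes \<Theta> :: "'m::complex_algebra_1 \<Rightarrow> 'v::ab_group_add"
  assumes \<Theta>: "additive \<Theta>"
begin

lemma functional_lift2_left: "\<Theta> (lift2 p q t * x) = tlift (\<lambda>a b. \<Theta> (p a * q b * x)) t"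
  by (simp add: lift2_mult_right additive_tlift[OF \<Theta>])

lemma functional_lift2_right: "\<Theta> (x * lift2 p q t) = tlift (\<lambda>a b. \<Theta> (x * (p a * q b))) t"
  by (simp add: lift2_mult_left additive_tlift[OF \<Theta>])

lemma lcong_lift2_1: "lcong \<Theta> p p' \<Longrightarrow> lcong \<Theta> (lift2 p q) (lift2 p' q)"
  by (simp add: lcong_def functional_lift2_left mult.assoc)

lemma rcong_lift2_2: "rcong \<Theta> q q' \<Longrightarrow> rcong \<Theta> (lift2 p q) (lift2 p q')"
  by (simp add: rcong_def functional_lift2_right flip: mult.assoc)

text \<open>Commutation brings the second leg to the far left, where it can be exchanged, and then
  back.\<close>

lemma lcong_lift2_2:
  assumes "lcong \<Theta> q q'" "commuting p q" "commuting p q'"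
  shows "lcong \<Theta> (lift2 p q) (lift2 p q')"
proof -
  have "\<Theta> (p a * q b * x) = \<Theta> (p a * q' b * x)" for a b x
    using assms(1) by (simp add: lcong_def commutingD[OF assms(2)] commutingD[OF assms(3)] mult.assoc)
  then show ?thesis by (simp add: lcong_def functional_lift2_left)
qed

lemma rcong_lift2_1:
  assumes "rcong \<Theta> p p'" "commuting p q" "commuting p' q"
  shows "rcong \<Theta> (lift2 p q) (lift2 p' q)"
proof -
  have "\<Theta> (x * (p a * q b)) = \<Theta> (x * (p' a * q b))" for a b x
    using assms(1)
    by (simp add: rcong_def commutingD[OF assms(2)] commutingD[OF assms(3)] flip: mult.assoc)
  then show ?thesis by (simp add: rcong_def functional_lift2_right)
qed

end

lemma functional_lift3:
  assumes "additive \<Theta>"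
  shows "\<Theta> (lift2 p (lift2 q r) t) = tlift3 (\<lambda>x y z. \<Theta> (p x * (q y * r z))) t"
  using functional_lift2_left[OF assms, of p _ t 1]
  by (simp add: tlift3_def functional_lift2_right[OF assms])

text \<open>Each conclusion trades two factors for three. The first, third and fifth drive the
  reduction \<open>six_legs\<close>; the second, fourth and sixth are their inverses and drive the
  mirrored one.\<close>

lemma monoid_pentagon:
  fixes a b c d e :: "'m::monoid_mult"
  assumes eq: "a * b = c * d * e"
    and inv: "a * a' = 1" "a' * a = 1" "b * b' = 1" "b' * b = 1" "c * c' = 1" "c' * c = 1"
      "d * d' = 1" "d' * d = 1" "e * e' = 1" "e' * e = 1"
  shows "c' * a = d * e * b'" "a' * c = b * e' * d'" "b * e' = a' * c * d" "e * b' = d' * c' * a"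
    "d * e = c' * a * b" "e' * d' = b' * a' * c"
proof -
  have i: "a * (a' * x) = x" "a' * (a * x) = x" "b * (b' * x) = x" "b' * (b * x) = x"
    "c * (c' * x) = x" "c' * (c * x) = x" "d * (d' * x) = x" "d' * (d * x) = x"
    "e * (e' * x) = x" "e' * (e * x) = x" for x
    by (simp_all add: inv flip: mult.assoc)
  have eq': "a * (b * x) = c * (d * (e * x))" for x
    using eq by (metis mult.assoc)
  show 1: "c' * a = d * e * b'"
    using eq'[of b'] by (metis i(6) inv(3) mult.assoc mult_1_right)
  show 5: "d * e = c' * a * b" using eq by (simp add: mult.assoc i)
  have eq_inv: "b' * a' = e' * d' * c'"
  proof -
    have "b' * a' = b' * a' * (c * d * e * (e' * d' * c'))" by (simp add: mult.assoc i inv)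
    also have "\<dots> = e' * d' * c'" unfolding eq[symmetric] by (simp add: mult.assoc i)
    finally show ?thesis .
  qed
  show 6: "e' * d' = b' * a' * c" by (simp add: eq_inv mult.assoc inv)
  show "a' * c = b * e' * d'" by (simp add: 6 mult.assoc i)
  show "b * e' = a' * c * d" by (metis 6 i(3) inv(8) mult.assoc mult_1_right)
  show "e * b' = d' * c' * a" by (simp add: 1 mult.assoc i)
qed

fun leg_list :: "('h::complex_algebra_1 \<Rightarrow> 'm::complex_algebra_1) list \<Rightarrow> bool" where
  "leg_list [] \<longleftrightarrow> True"
| "leg_list (p # ps) \<longleftrightarrow> alg_hom p \<and>
     (\<forall>q\<in>set ps. commuting p q \<and> commuting q p) \<and> leg_list ps"

lemma commute_mult: "k * a = a * k \<Longrightarrow> k * b = b * k \<Longrightarrow> k * (a * b) = (a * b) * (k :: 'm::semigroup_mult)"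
  by (metis mult.assoc)

lemma rcong_trans: "rcong \<Theta> p q \<Longrightarrow> rcong \<Theta> q r \<Longrightarrow> rcong \<Theta> p r"
  by (simp add: rcong_def)

lemma lcong_trans: "lcong \<Theta> p q \<Longrightarrow> lcong \<Theta> q r \<Longrightarrow> lcong \<Theta> p r"
  by (simp add: lcong_def)

text \<open>A left factor that commutes with both legs can be absorbed into the functional, so that
  a leg behind it can still be exchanged.\<close>

lemma lcong_shift:
  assumes "lcong \<Theta> p p'" "\<And>h. c * p h = p h * c" "\<And>h. c * p' h = p' h * (c :: 'm::semigroup_mult)"
  shows "lcong (\<lambda>x. \<Theta> (c * x)) p p'"
  using assms(1) unfolding lcong_def mult.assoc[symmetric] assms(2,3) unfolding mult.assoc by blast

lemma rcong_shift:
  assumes "rcong \<Theta> p p'" "\<And>h. p h * c = c * p h" "\<And>h. p' h * c = c * (p' h :: 'm::semigroup_mult)"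
  shows "rcong (\<lambda>x. \<Theta> (x * c)) p p'"
  using assms(1) unfolding rcong_def mult.assoc assms(2,3) unfolding mult.assoc[symmetric] by blast

section \<open>The standard legs of the third and fourth tensor powers\<close>

definition "l31 h = inl h" definition "l32 h = inr (inl h)" definition "l33 h = inr (inr h)"
definition "l41 h = inl h" definition "l42 h = inr (inl h)"
definition "l43 h = inr (inr (inl h))" definition "l44 h = inr (inr (inr h))"

lemmas inr_compose = alg_hom_compose[OF alg_hom_inr] commuting_compose[OF alg_hom_inr]

lemma alg_hom_l3: "alg_hom l31" "alg_hom l32" "alg_hom l33"
  unfolding l31_def[abs_def] l32_def[abs_def] l33_def[abs_def]
  by (intro alg_hom_inl alg_hom_inr inr_compose)+

lemma commuting_l3:
  "commuting l31 l32" "commuting l31 l33" "commuting l32 l33"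
  "commuting l32 l31" "commuting l33 l31" "commuting l33 l32"
  by (auto simp: commuting_def l31_def l32_def l33_def inl_def inr_def tensor_mult_tensor one_tensor_def)

lemma alg_hom_l4: "alg_hom l41" "alg_hom l42" "alg_hom l43" "alg_hom l44"
  unfolding l41_def[abs_def] l42_def[abs_def] l43_def[abs_def] l44_def[abs_def]
  by (intro alg_hom_inl alg_hom_inr inr_compose)+

lemma commuting_l4:
  "commuting l41 l42" "commuting l41 l43" "commuting l41 l44" "commuting l42 l43" "commuting l42 l44"
  "commuting l43 l44" "commuting l42 l41" "commuting l43 l41" "commuting l44 l41" "commuting l43 l42"
  "commuting l44 l42" "commuting l44 l43"
  by (auto simp: commuting_def l41_def l42_def l43_def l44_def inl_def inr_def tensor_mult_tensor one_tensor_def)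

lemmas l3_apply = l31_def l32_def l33_def inl_def inr_def tensor_mult_tensor one_tensor_def
lemmas l4_apply = l41_def l42_def l43_def l44_def inl_def inr_def tensor_mult_tensor one_tensor_def

lemma lift2_inr: "lift2 (\<lambda>h. inr (p h)) (\<lambda>h. inr (q h)) = (\<lambda>t. inr (lift2 p q t))"
  by (simp add: alg_hom_lift2_comp[OF alg_hom_inr])

lemma lift2_l3: "lift2 l31 (lift2 l32 l33) t = t"
  by (simp add: l31_def[abs_def] l32_def[abs_def] l33_def[abs_def] lift2_inr lift2_inl_inr)

lemma lift2_l4: "lift2 l41 (lift2 l42 (lift2 l43 l44)) t = t"
  by (simp add: l41_def[abs_def] l42_def[abs_def] l43_def[abs_def] l44_def[abs_def] lift2_inr lift2_inl_inr)

lemma alg_antihom_clinear: "alg_antihom s \<Longrightarrow> clinear s"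
  and alg_antihom_one: "alg_antihom s \<Longrightarrow> s 1 = 1"
  and alg_antihom_mult: "alg_antihom s \<Longrightarrow> s (a * b) = s b * s a"
  by (auto simp: alg_antihom_def)

section \<open>Quasi-bialgebra identities in terms of legs\<close>

context quasi_hopf_algebra
begin

text \<open>\<open>phi p q r\<close> is \<open>\<Phi>\<close> with its three factors put into the legs \<open>p\<close>, \<open>q\<close>, \<open>r\<close>. For instance
  \<open>(1 \<otimes> \<Delta> \<otimes> 1) \<Phi>\<close> is \<open>phi p (conv q r) s\<close> for the four standard legs of \<open>H \<otimes> H \<otimes> H \<otimes> H\<close>.\<close>

definition conv :: "('h \<Rightarrow> 'm::complex_algebra_1) \<Rightarrow> ('h \<Rightarrow> 'm) \<Rightarrow> 'h \<Rightarrow> 'm"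
  where "conv p q h = lift2 p q (\<Delta> h)"

lemma conv_fun: "(\<lambda>h. lift2 p q (\<Delta> h)) = conv p q"
  by (auto simp: conv_def)

definition phi :: "('h \<Rightarrow> 'm::complex_algebra_1) \<Rightarrow> ('h \<Rightarrow> 'm) \<Rightarrow> ('h \<Rightarrow> 'm) \<Rightarrow> 'm"
  where "phi p q r = lift2 p (lift2 q r) \<Phi>"

definition phii :: "('h \<Rightarrow> 'm::complex_algebra_1) \<Rightarrow> ('h \<Rightarrow> 'm) \<Rightarrow> ('h \<Rightarrow> 'm) \<Rightarrow> 'm"
  where "phii p q r = lift2 p (lift2 q r) (minv \<Phi>)"

text \<open>The counit as a leg. It is central and neutral for \<open>conv\<close>, so once it has
  replaced part of an iterated coproduct only the remaining legs are left.\<close>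

definition eta :: "'h \<Rightarrow> 'm::complex_algebra_1"
  where "eta h = eps h *\<^sub>C 1"

lemma clinear_eps: "clinear eps" and eps_one: "eps 1 = 1" and eps_mult: "eps (a * b) = eps a * eps b"
  using counit_hom by (auto simp: alg_hom_def)

lemma clinear_S: "clinear S" and S_one: "S 1 = 1" and S_mult: "S (a * b) = S b * S a"
  using antipode_antihom by (auto simp: alg_antihom_def)

lemma eta_mult_left: "eta h * x = eps h *\<^sub>C x" and eta_mult_right: "x * eta h = eps h *\<^sub>C x"
  by (simp_all add: eta_def mult_scaleC_left mult_scaleC_right)

lemma alg_hom_eta: "alg_hom eta"
  unfolding alg_hom_def eta_def[abs_def]
  by (auto simp: eps_one eps_mult scaleC_one scaleC_scaleC mult_scaleC_left mult_scaleC_right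
      mult.commute intro!: lin clinear_eps)

lemma commuting_eta: "commuting eta p" "commuting p eta"
  by (simp_all add: commuting_def eta_mult_left eta_mult_right)

lemma commuting_conv: "commuting p r \<Longrightarrow> commuting q r \<Longrightarrow> commuting (conv p q) r"
  and commuting_conv': "commuting r p \<Longrightarrow> commuting r q \<Longrightarrow> commuting r (conv p q)"
  using commuting_lift2[of p r q] by (auto simp: commuting_def conv_def)

lemma commuting_lift2': "commuting r p \<Longrightarrow> commuting r q \<Longrightarrow> commuting r (lift2 p q)"
  by (metis commuting_lift2 commuting_sym)

lemma alg_hom_conv: "alg_hom p \<Longrightarrow> alg_hom q \<Longrightarrow> commuting p q \<Longrightarrow> alg_hom (conv p q)"
  unfolding conv_def by (rule alg_hom_compose[OF alg_hom_lift2 coproduct_hom])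

lemma clinear_conv: "clinear p \<Longrightarrow> clinear q \<Longrightarrow> clinear (conv p q)"
  unfolding conv_def
  by (rule clinear_compose[OF clinear_lift2 alg_hom_clinear[OF coproduct_hom]])

lemmas legs = alg_hom_conv alg_hom_eta alg_hom_lift2 commuting_conv commuting_conv' commuting_eta
  commuting_lift2 commuting_lift2' alg_hom_clinear clinear_conv clinear_lift2

lemma conv_eta:
  assumes "clinear p"
  shows "conv eta p = p" "conv p eta = p"
proof -
  have "p (counit_left eps (\<Delta> h)) = conv eta p h" for h
    unfolding counit_left_def conv_def lift2_def
    by (subst additive_tlift) (simp_all add: assms additive_clinear clinear_scaleC eta_mult_left)
  moreover have "p (counit_right eps (\<Delta> h)) = conv p eta h" for h
    unfolding counit_right_def conv_def lift2_def
    by (subst additive_tlift) (simp_all add: assms additive_clinear clinear_scaleC eta_mult_right)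
  ultimately show "conv eta p = p" "conv p eta = p"
    by (auto simp: counit_coproduct_left counit_coproduct_right)
qed

lemma phi_phii_inverse:
  assumes "alg_hom p" "alg_hom q" "alg_hom r" "commuting p q" "commuting p r" "commuting q r"
  shows "phi p q r * phii p q r = 1" "phii p q r * phi p q r = 1"
  unfolding phi_def phii_def
  by (rule alg_hom_minvertible; simp add: legs assms coassociator_invertible)+

lemma alg_hom_phi: "alg_hom \<phi> \<Longrightarrow> \<phi> (phi p q r) = phi (\<lambda>x. \<phi> (p x)) (\<lambda>x. \<phi> (q x)) (\<lambda>x. \<phi> (r x))"
  by (simp add: phi_def alg_hom_lift2_comp)

lemma alg_hom_phii: "alg_hom \<phi> \<Longrightarrow> \<phi> (phii p q r) = phii (\<lambda>x. \<phi> (p x)) (\<lambda>x. \<phi> (q x)) (\<lambda>x. \<phi> (r x))"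
  by (simp add: phii_def alg_hom_lift2_comp)

lemma alg_hom_conv_apply: "alg_hom \<phi> \<Longrightarrow> \<phi> (conv p q h) = conv (\<lambda>x. \<phi> (p x)) (\<lambda>x. \<phi> (q x)) h"
  by (simp add: conv_def alg_hom_lift2_comp)

lemma conv_coassoc:
  assumes [simp]: "alg_hom p" "alg_hom q" "alg_hom r" "commuting p q" "commuting p r" "commuting q r"
  shows "phi p q r * conv p (conv q r) h = conv (conv p q) r h * phi p q r"
proof -
  note [simp] = alg_hom_clinear
  have \<Delta>: "clinear \<Delta>" using coproduct_hom by simp
  define L where "L = lift2 p (lift2 q r)"
  have L: "alg_hom L" by (simp add: L_def legs)
  have "\<Phi> * tmap id \<Delta> (\<Delta> h) = tassoc (tmap \<Delta> id (\<Delta> h)) * \<Phi>"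
    unfolding quasi_coassoc by (simp add: minvertible_minv[OF coassociator_invertible] flip: mult.assoc)
  then have "L \<Phi> * L (tmap id \<Delta> (\<Delta> h)) = L (tassoc (tmap \<Delta> id (\<Delta> h))) * L \<Phi>"
    by (simp flip: alg_hom_mult[OF L])
  then show ?thesis
    by (simp add: L_def lift2_tmap lift2_tassoc legs \<Delta> lin id_def flip: phi_def conv_def)
qed

lemma conv_coassoc_inv:
  assumes "alg_hom p" "alg_hom q" "alg_hom r" "commuting p q" "commuting p r" "commuting q r"
  shows "conv p (conv q r) h * phii p q r = phii p q r * conv (conv p q) r h"
proof -
  note i = phi_phii_inverse[OF assms] and c = conv_coassoc[OF assms]
  have "conv p (conv q r) h * phii p q r = phii p q r * (phi p q r * conv p (conv q r) h) * phii p q r"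
    by (simp add: i flip: mult.assoc)
  also have "\<dots> = phii p q r * conv (conv p q) r h"
    by (simp add: c mult.assoc i)
  finally show ?thesis .
qed

lemma pentagon_legs:
  assumes [simp]: "alg_hom p" "alg_hom q" "alg_hom r" "alg_hom s" "commuting p q" "commuting p r"
    "commuting q r" "commuting p s" "commuting q s" "commuting r s"
  shows "phi (conv p q) r s * phi p q (conv r s) = phi p q r * phi p (conv q r) s * phi q r s"
proof -
  note [simp] = alg_hom_clinear
  have \<Delta>: "clinear \<Delta>" using coproduct_hom by simp
  define L where "L = lift2 p (lift2 q (lift2 r s))"
  have L: "alg_hom L" by (simp add: L_def legs)
  have ta: "clinear (tassoc :: ('h \<otimes> 'h) \<otimes> 'h \<Rightarrow> 'h \<otimes> 'h \<otimes> 'h)" by (rule clinear_tassoc)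
  have 1: "L (tassoc (tmap \<Delta> id \<Phi>)) = phi (conv p q) r s"
    by (simp add: L_def lift2_tmap lift2_tassoc legs \<Delta> lin id_def phi_def flip: conv_def)
  have 2: "L (tmap id (tmap id \<Delta>) \<Phi>) = phi p q (conv r s)"
    by (simp add: L_def lift2_tmap lift2_tassoc legs \<Delta> lin clinear_tmap id_def phi_def
        flip: conv_def)
  have 3: "L (tmap id tassoc (tassoc (\<Phi> \<otimes> 1))) = phi p q r"
    by (simp add: L_def lift2_tmap lift2_tassoc lift2_pure legs \<Delta> lin ta id_def phi_def alg_hom_one)
  have 4: "L (tmap id tassoc (tmap id (tmap \<Delta> id) \<Phi>)) = phi p (conv q r) s"
    by (simp add: L_def lift2_tmap lift2_tassoc lift2_pure legs \<Delta> lin ta clinear_tmap id_def phi_def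
        flip: conv_def)
  have 5: "L (1 \<otimes> \<Phi>) = phi q r s"
    by (simp add: L_def lift2_pure legs alg_hom_one phi_def)
  from arg_cong[OF pentagon, of L] show ?thesis
    unfolding alg_hom_mult[OF L] 1 2 3 4 5 .
qed

lemma phi_eta_mid:
  assumes [simp]: "alg_hom p" "alg_hom r" "commuting p r"
  shows "phi p eta r = 1"
proof -
  have cl: "cbilinear (\<lambda>a b. eps a *\<^sub>C b)" by (intro cbilinearI lin clinear_eps)
  have *: "r (counit_left eps x) = lift2 eta r x" for x
    unfolding counit_left_def lift2_def
    by (subst additive_tlift)
      (simp_all add: alg_hom_clinear additive_clinear clinear_scaleC eta_mult_left)
  have cll: "clinear (counit_left eps)"
    unfolding counit_left_def by (rule clinear_tlift[OF cl])
  have "lift2 p r (tmap id (counit_left eps) \<Phi>) = phi p eta r"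
    by (simp add: lift2_tmap alg_hom_clinear id_def lin cll phi_def *)
  then show ?thesis
    by (simp add: counit_coassociator alg_hom_one alg_hom_lift2)
qed

text \<open>With the counit in two adjacent outer legs, the pentagon and \<open>phi_eta_mid\<close>
  say that the element in question is idempotent. It is also invertible, hence equal to 1.\<close>

lemma phi_eta:
  assumes [simp]: "alg_hom p" "alg_hom r" "commuting p r"
  shows "phi eta p r = 1" "phi p r eta = 1"
proof -
  show "phi eta p r = 1"
    using pentagon_legs[of eta eta p r] phi_phii_inverse[of eta p r]
    by (simp add: legs conv_eta phi_eta_mid) (metis mult.assoc mult_1_left mult_1_right)
  show "phi p r eta = 1"
    using pentagon_legs[of p r eta eta] phi_phii_inverse[of p r eta]
    by (simp add: legs conv_eta phi_eta_mid) (metis mult.assoc mult_1_left mult_1_right)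
qed

lemma phii_eta:
  assumes [simp]: "alg_hom p" "alg_hom r" "commuting p r"
  shows "phii eta p r = 1" "phii p eta r = 1" "phii p r eta = 1"
  using phi_phii_inverse[of eta p r] phi_phii_inverse[of p eta r] phi_phii_inverse[of p r eta]
  by (simp_all add: phi_eta phi_eta_mid legs)

section \<open>Comparison of antipodes\<close>

lemmas l3 = alg_hom_l3 commuting_l3
lemmas l4 = alg_hom_l4 commuting_l4

text \<open>The antipode of \<open>H\<close> is the case \<open>f = id\<close>. The coproduct is a parameter because the conjugate
  antipode is one for the twisted coproduct.\<close>

definition left_data :: "('h \<Rightarrow> 'h \<otimes> 'h) \<Rightarrow> ('h \<Rightarrow> 'a::complex_algebra_1) \<Rightarrow> ('h \<Rightarrow> 'a) \<Rightarrow> 'a \<Rightarrow> bool"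
  where "left_data D f \<sigma> a \<longleftrightarrow> alg_hom f \<and> alg_antihom \<sigma> \<and>
    (\<forall>h. tlift (\<lambda>x y. \<sigma> x * a * f y) (D h) = eps h *\<^sub>C a)"

definition right_data :: "('h \<Rightarrow> 'h \<otimes> 'h) \<Rightarrow> ('h \<Rightarrow> 'a::complex_algebra_1) \<Rightarrow> ('h \<Rightarrow> 'a) \<Rightarrow> 'a \<Rightarrow> bool"
  where "right_data D f \<sigma> b \<longleftrightarrow> alg_hom f \<and> alg_antihom \<sigma> \<and>
    (\<forall>h. tlift (\<lambda>x y. f x * b * \<sigma> y) (D h) = eps h *\<^sub>C b)"

definition antipode_data :: "('h \<Rightarrow> 'a::complex_algebra_1) \<Rightarrow> ('h \<Rightarrow> 'a) \<Rightarrow> 'a \<Rightarrow> 'a \<Rightarrow> bool"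
  where "antipode_data f \<sigma> a b \<longleftrightarrow> left_data \<Delta> f \<sigma> a \<and> right_data \<Delta> f \<sigma> b \<and>
    tlift3 (\<lambda>x y z. \<sigma> x * a * f y * b * \<sigma> z) \<Phi> = 1 \<and>
    tlift3 (\<lambda>x y z. f x * b * \<sigma> y * a * f z) (minv \<Phi>) = 1"

lemma left_dataD:
  assumes "left_data D f \<sigma> a"
  shows "alg_hom f" "alg_antihom \<sigma>" "clinear f" "clinear \<sigma>" "f 1 = 1" "\<sigma> 1 = 1"
    "f (x * y) = f x * f y" "\<sigma> (x * y) = \<sigma> y * \<sigma> x"
  using assms by (simp_all add: left_data_def alg_hom_def alg_antihom_def)

lemma right_dataD:
  assumes "right_data D f \<sigma> b"
  shows "alg_hom f" "alg_antihom \<sigma>" "clinear f" "clinear \<sigma>" "f 1 = 1" "\<sigma> 1 = 1"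
    "f (x * y) = f x * f y" "\<sigma> (x * y) = \<sigma> y * \<sigma> x"
  using assms by (simp_all add: right_data_def alg_hom_def alg_antihom_def)

text \<open>On a generator t, the value \<Theta>(p x q y t) is a linear function of the single
  element \<sigma>(x) a f(y), which sums to eps(h) a over the coproduct. The choice x = y = 1
  recognises the result as the counit term.\<close>

lemma lcong_left_data:
  fixes \<Theta> :: "'m::complex_algebra_1 \<Rightarrow> 'v::complex_vector" and a :: "'a::complex_algebra_1"
  assumes d: "left_data D f \<sigma> a" and \<Theta>: "clinear \<Theta>" and A: "spanning A"
    and pq: "p 1 = 1" "q 1 = 1"
    and g: "\<And>t. t \<in> A \<Longrightarrow> \<exists>g. clinear g \<and> (\<forall>x y. \<Theta> (p x * (q y * t)) = g (\<sigma> x * a * f y))"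
  shows "lcong \<Theta> (\<lambda>h. lift2 p q (D h)) eta"
  unfolding lcong_def
proof (intro allI)
  fix h t
  show "\<Theta> (lift2 p q (D h) * t) = \<Theta> (eta h * t)"
  proof (rule spanning_ext[OF A, of "\<lambda>t. \<Theta> (lift2 p q (D h) * t)"])
    fix t assume "t \<in> A"
    from g[OF this] obtain g where g: "clinear g" "\<And>x y. \<Theta> (p x * (q y * t)) = g (\<sigma> x * a * f y)"
      by blast
    have "\<Theta> (lift2 p q (D h) * t) = tlift (\<lambda>x y. g (\<sigma> x * a * f y)) (D h)"
      by (simp add: functional_lift2_left additive_clinear \<Theta> mult.assoc g(2))
    also have "\<dots> = g (eps h *\<^sub>C a)"
      using d by (simp add: left_data_def flip: additive_tlift[OF additive_clinear[OF g(1)]])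
    also have "\<dots> = \<Theta> (eta h * t)"
      using g(2)[of 1 1] by (simp add: clinear_scaleC g \<Theta> pq left_dataD(5,6)[OF d] eta_mult_left)
    finally show "\<Theta> (lift2 p q (D h) * t) = \<Theta> (eta h * t)" .
  qed (intro additive_clinear clinear_compose[OF \<Theta>] lin)+
qed

lemma rcong_right_data:
  fixes \<Theta> :: "'m::complex_algebra_1 \<Rightarrow> 'v::complex_vector" and b :: "'a::complex_algebra_1"
  assumes d: "right_data D f \<sigma> b" and \<Theta>: "clinear \<Theta>" and A: "spanning A"
    and pq: "p 1 = 1" "q 1 = 1"
    and g: "\<And>t. t \<in> A \<Longrightarrow> \<exists>g. clinear g \<and> (\<forall>x y. \<Theta> (t * (p x * q y)) = g (f x * b * \<sigma> y))"
  shows "rcong \<Theta> (\<lambda>h. lift2 p q (D h)) eta"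
  unfolding rcong_def
proof (intro allI)
  fix h t
  show "\<Theta> (t * lift2 p q (D h)) = \<Theta> (t * eta h)"
  proof (rule spanning_ext[OF A, of "\<lambda>t. \<Theta> (t * lift2 p q (D h))"])
    fix t assume "t \<in> A"
    from g[OF this] obtain g where g: "clinear g" "\<And>x y. \<Theta> (t * (p x * q y)) = g (f x * b * \<sigma> y)"
      by blast
    have "\<Theta> (t * lift2 p q (D h)) = tlift (\<lambda>x y. g (f x * b * \<sigma> y)) (D h)"
      by (simp add: functional_lift2_right additive_clinear \<Theta> mult.assoc g(2))
    also have "\<dots> = g (eps h *\<^sub>C b)"
      using d by (simp add: right_data_def flip: additive_tlift[OF additive_clinear[OF g(1)]])
    also have "\<dots> = \<Theta> (t * eta h)"
      using g(2)[of 1 1] by (simp add: clinear_scaleC g \<Theta> pq right_dataD(5,6)[OF d] eta_mult_right)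
    finally show "\<Theta> (t * lift2 p q (D h)) = \<Theta> (t * eta h)" .
  qed (intro additive_clinear clinear_compose[OF \<Theta>] lin)+
qed

lemma lcong_left_data3:
  assumes "left_data D f \<sigma> a" "clinear \<Theta>" "p 1 = 1" "q 1 = 1"
    and "\<And>x1 x2 x3. clinear (g x1 x2 x3)"
    and "\<And>x1 x2 x3 x y. \<Theta> (p x * (q y * (x1 \<otimes> x2 \<otimes> x3))) = g x1 x2 x3 (\<sigma> x * a * f y)"
  shows "lcong \<Theta> (\<lambda>h. lift2 p q (D h)) eta"
  by (rule lcong_left_data[OF assms(1,2) spanning_pure3, where p = p and q = q]) (use assms(3-6) in blast)+

lemma rcong_right_data3:
  assumes "right_data D f \<sigma> b" "clinear \<Theta>" "p 1 = 1" "q 1 = 1"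
    and "\<And>x1 x2 x3. clinear (g x1 x2 x3)"
    and "\<And>x1 x2 x3 x y. \<Theta> ((x1 \<otimes> x2 \<otimes> x3) * (p x * q y)) = g x1 x2 x3 (f x * b * \<sigma> y)"
  shows "rcong \<Theta> (\<lambda>h. lift2 p q (D h)) eta"
  by (rule rcong_right_data[OF assms(1,2) spanning_pure3, where p = p and q = q]) (use assms(3-6) in blast)+

lemma lcong_left_data4:
  assumes "left_data \<Delta> f \<sigma> a" "clinear \<Theta>" "p 1 = 1" "q 1 = 1"
    and "\<And>x1 x2 x3 x4. clinear (g x1 x2 x3 x4)"
    and "\<And>x1 x2 x3 x4 x y. \<Theta> (p x * (q y * (x1 \<otimes> x2 \<otimes> x3 \<otimes> x4))) = g x1 x2 x3 x4 (\<sigma> x * a * f y)"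
  shows "lcong \<Theta> (conv p q) eta"
  unfolding conv_def[abs_def]
  by (rule lcong_left_data[OF assms(1,2) spanning_pure4, where p = p and q = q]) (use assms(3-6) in blast)+

lemma rcong_right_data4:
  assumes "right_data \<Delta> f \<sigma> b" "clinear \<Theta>" "p 1 = 1" "q 1 = 1"
    and "\<And>x1 x2 x3 x4. clinear (g x1 x2 x3 x4)"
    and "\<And>x1 x2 x3 x4 x y. \<Theta> ((x1 \<otimes> x2 \<otimes> x3 \<otimes> x4) * (p x * q y)) = g x1 x2 x3 x4 (f x * b * \<sigma> y)"
  shows "rcong \<Theta> (conv p q) eta"
  unfolding conv_def[abs_def]
  by (rule rcong_right_data[OF assms(1,2) spanning_pure4, where p = p and q = q]) (use assms(3-6) in blast)+

text \<open>The formula is forced: if v intertwines \<sigma> with \<sigma>' and v a = a',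
  multiplying the axiom that the sum of \<sigma>(X) a f(Y) b \<sigma>(Z) over \<Phi> is 1 by v on
  the left gives exactly this sum.\<close>

definition comparison :: "('h \<Rightarrow> 'a::complex_algebra_1) \<Rightarrow> ('h \<Rightarrow> 'a) \<Rightarrow> 'a \<Rightarrow> 'a \<Rightarrow> ('h \<Rightarrow> 'a) \<Rightarrow> 'a"
  where "comparison f \<sigma>' a' b \<sigma> = tlift3 (\<lambda>x y z. \<sigma>' x * a' * f y * b * \<sigma> z) \<Phi>"

lemma phi_l3: "phi l31 l32 l33 = \<Phi>" "phii l31 l32 l33 = minv \<Phi>"
  by (simp_all add: phi_def phii_def lift2_l3)

lemma left_right_functional:
  assumes l: "left_data D f \<sigma>' a'" and r: "right_data D f \<sigma> b"
    and \<Theta>_def: "\<Theta> = tlift3 (\<lambda>x y z. \<sigma>' x * a' * f y * b * \<sigma> z)"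
  shows "clinear \<Theta>" "\<Theta> (x \<otimes> y \<otimes> z) = \<sigma>' x * a' * f y * b * \<sigma> z"
    "lcong \<Theta> (\<lambda>h. lift2 l31 l32 (D h)) eta" "rcong \<Theta> (\<lambda>h. lift2 l32 l33 (D h)) eta"
proof -
  note D = left_dataD[OF l] right_dataD[OF r]
  note [simp] = l3 left_dataD(7,8)[OF l] right_dataD(8)[OF r]
  have tri: "clinear (\<lambda>x. \<sigma>' x * a' * f y * b * \<sigma> z)" "clinear (\<lambda>y. \<sigma>' x * a' * f y * b * \<sigma> z)"
    "clinear (\<lambda>z. \<sigma>' x * a' * f y * b * \<sigma> z)" for x y z
    by (intro lin clinear_compose[OF D(3)] clinear_compose[OF D(4)] clinear_compose[OF D(12)])+
  show \<Theta>: "clinear \<Theta>" and "\<Theta> (x \<otimes> y \<otimes> z) = \<sigma>' x * a' * f y * b * \<sigma> z"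
    unfolding \<Theta>_def by (rule clinear_tlift3[OF tri], rule tlift3_pure[OF tri])
  have pure: "\<Theta> (x \<otimes> y \<otimes> z) = \<sigma>' x * a' * f y * b * \<sigma> z" for x y z
    unfolding \<Theta>_def by (rule tlift3_pure[OF tri])
  show "lcong \<Theta> (\<lambda>h. lift2 l31 l32 (D h)) eta"
    by (rule lcong_left_data3[OF l \<Theta>, where g = "\<lambda>x y z v. \<sigma>' x * v * (f y * (b * \<sigma> z))"])
      (simp_all add: alg_hom_one lin, simp add: l3_apply pure mult.assoc)
  show "rcong \<Theta> (\<lambda>h. lift2 l32 l33 (D h)) eta"
    by (rule rcong_right_data3[OF r \<Theta>, where g = "\<lambda>x y z v. \<sigma>' x * (a' * f y) * v * \<sigma> z"])
      (simp_all add: alg_hom_one lin, simp add: l3_apply pure mult.assoc)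
qed

lemma right_left_functional:
  assumes r: "right_data D f \<sigma> b" and l: "left_data D f \<sigma> a"
    and \<Theta>_def: "\<Theta> = tlift3 (\<lambda>x y z. f x * b * \<sigma> y * a * f z)"
  shows "clinear \<Theta>" "\<Theta> (x \<otimes> y \<otimes> z) = f x * b * \<sigma> y * a * f z"
    "rcong \<Theta> (\<lambda>h. lift2 l31 l32 (D h)) eta" "lcong \<Theta> (\<lambda>h. lift2 l32 l33 (D h)) eta"
proof -
  note D = left_dataD[OF l] right_dataD[OF r]
  note [simp] = l3 left_dataD(7,8)[OF l]
  have tri: "clinear (\<lambda>x. f x * b * \<sigma> y * a * f z)" "clinear (\<lambda>y. f x * b * \<sigma> y * a * f z)"
    "clinear (\<lambda>z. f x * b * \<sigma> y * a * f z)" for x y z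
    by (intro lin clinear_compose[OF D(3)] clinear_compose[OF D(4)])+
  show \<Theta>: "clinear \<Theta>" and "\<Theta> (x \<otimes> y \<otimes> z) = f x * b * \<sigma> y * a * f z"
    unfolding \<Theta>_def by (rule clinear_tlift3[OF tri], rule tlift3_pure[OF tri])
  have pure: "\<Theta> (x \<otimes> y \<otimes> z) = f x * b * \<sigma> y * a * f z" for x y z
    unfolding \<Theta>_def by (rule tlift3_pure[OF tri])
  show "rcong \<Theta> (\<lambda>h. lift2 l31 l32 (D h)) eta"
    by (rule rcong_right_data3[OF r \<Theta>, where g = "\<lambda>x y z v. f x * v * (\<sigma> y * a * f z)"])
      (simp_all add: alg_hom_one lin, simp add: l3_apply pure mult.assoc)
  show "lcong \<Theta> (\<lambda>h. lift2 l32 l33 (D h)) eta"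
    by (rule lcong_left_data3[OF l \<Theta>, where g = "\<lambda>x y z v. f x * b * \<sigma> y * v * f z"])
      (simp_all add: alg_hom_one lin, simp add: l3_apply pure mult.assoc)
qed

text \<open>Apply \<Theta> to quasi-coassociativity. On one side the coproduct in legs 2 and 3 dies
  at the right end, leaving h in leg 1, which comes out as \<sigma>'(h) on the left; on the other
  side legs 1 and 2 die, and h in leg 3 comes out as \<sigma>(h) on the right.\<close>

lemma comparison_intertwines:
  assumes l: "left_data \<Delta> f \<sigma>' a'" and r: "right_data \<Delta> f \<sigma> b"
  shows "\<sigma>' h * comparison f \<sigma>' a' b \<sigma> = comparison f \<sigma>' a' b \<sigma> * \<sigma> h"
proof -
  define \<Theta> where "\<Theta> = tlift3 (\<lambda>x y z. \<sigma>' x * a' * f y * b * \<sigma> z)"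
  note \<Theta> = left_right_functional(1)[OF l r \<Theta>_def] and pure = left_right_functional(2)[OF l r \<Theta>_def]
    and kl = left_right_functional(3)[OF l r \<Theta>_def, unfolded conv_fun]
    and kr = left_right_functional(4)[OF l r \<Theta>_def, unfolded conv_fun]
  note [simp] = l3 legs left_dataD(8)[OF l] right_dataD(8)[OF r]
  have 1: "\<Theta> (t * l31 h) = \<sigma>' h * \<Theta> t" for t
    by (rule spanning_ext[OF spanning_pure3, of "\<lambda>t. \<Theta> (t * l31 h)"])
      (auto intro!: additive_clinear clinear_compose[OF \<Theta>] lin \<Theta> simp: l3_apply pure mult.assoc)
  have 3: "\<Theta> (l33 h * t) = \<Theta> t * \<sigma> h" for t
    by (rule spanning_ext[OF spanning_pure3, of "\<lambda>t. \<Theta> (l33 h * t)"])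
      (auto intro!: additive_clinear clinear_compose[OF \<Theta>] lin \<Theta> simp: l3_apply pure mult.assoc)
  have "rcong \<Theta> (conv l31 (conv l32 l33)) (conv l31 eta)"
    using rcong_lift2_2[OF additive_clinear[OF \<Theta>] kr, of l31] by (simp add: rcong_def conv_def)
  then have "\<Theta> (\<Phi> * conv l31 (conv l32 l33) h) = \<sigma>' h * \<Theta> \<Phi>"
    by (simp add: rcong_def conv_eta 1)
  moreover have "lcong \<Theta> (conv (conv l31 l32) l33) (conv eta l33)"
    using lcong_lift2_1[OF additive_clinear[OF \<Theta>] kl, of l33] by (simp add: lcong_def conv_def)
  then have "\<Theta> (conv (conv l31 l32) l33 h * \<Phi>) = \<Theta> \<Phi> * \<sigma> h"
    by (simp add: lcong_def conv_eta 3)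
  moreover have "\<Phi> * conv l31 (conv l32 l33) h = conv (conv l31 l32) l33 h * \<Phi>"
    using conv_coassoc[of l31 l32 l33 h] by (simp add: phi_l3)
  ultimately show ?thesis by (simp add: comparison_def \<Theta>_def)
qed

section \<open>Exchanging one leg of \<Phi> under a functional\<close>

context
  fixes \<Theta> :: "'m::complex_algebra_1 \<Rightarrow> 'v::complex_vector"
  assumes \<Theta>: "clinear \<Theta>"
begin

lemmas add\<Theta> = additive_clinear[OF \<Theta>]

lemma functional_phi: "\<Theta> (phi p q r) = tlift3 (\<lambda>x y z. \<Theta> (p x * (q y * r z))) \<Phi>"
  and functional_phii: "\<Theta> (phii p q r) = tlift3 (\<lambda>x y z. \<Theta> (p x * (q y * r z))) (minv \<Phi>)"
  by (simp_all add: phi_def phii_def functional_lift3[OF add\<Theta>])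

lemma lcong_conv1: "lcong \<Theta> p p' \<Longrightarrow> lcong \<Theta> (conv p q) (conv p' q)"
  using lcong_lift2_1[OF add\<Theta>, of p p' q] by (simp add: lcong_def conv_def)

lemma lcong_conv2:
  "lcong \<Theta> q q' \<Longrightarrow> commuting p q \<Longrightarrow> commuting p q' \<Longrightarrow> lcong \<Theta> (conv p q) (conv p q')"
  using lcong_lift2_2[OF add\<Theta>, of q q' p] by (simp add: lcong_def conv_def)

lemma rcong_conv2: "rcong \<Theta> q q' \<Longrightarrow> rcong \<Theta> (conv p q) (conv p q')"
  using rcong_lift2_2[OF add\<Theta>, of q q' p] by (simp add: rcong_def conv_def)

lemma rcong_conv1:
  "rcong \<Theta> p p' \<Longrightarrow> commuting p q \<Longrightarrow> commuting p' q \<Longrightarrow> rcong \<Theta> (conv p q) (conv p' q)"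
  using rcong_lift2_1[OF add\<Theta>, of p p' q] by (simp add: rcong_def conv_def)

lemma lcong_phi1:
  assumes "lcong \<Theta> p p'"
  shows "\<Theta> (phi p q r * t) = \<Theta> (phi p' q r * t)" "\<Theta> (phii p q r * t) = \<Theta> (phii p' q r * t)"
  unfolding phi_def phii_def by (rule lcongD[OF lcong_lift2_1[OF add\<Theta> assms]])+

lemma lcong_phi2:
  assumes "lcong \<Theta> q q'" "commuting p q" "commuting p q'" "commuting p r"
  shows "\<Theta> (phi p q r * t) = \<Theta> (phi p q' r * t)" "\<Theta> (phii p q r * t) = \<Theta> (phii p q' r * t)"
  unfolding phi_def phii_def
  by (rule lcongD[OF lcong_lift2_2[OF add\<Theta> lcong_lift2_1[OF add\<Theta> assms(1)]]];
      simp add: legs assms)+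

lemma lcong_phi3:
  assumes "lcong \<Theta> r r'" "commuting p q" "commuting p r" "commuting p r'" "commuting q r" "commuting q r'"
  shows "\<Theta> (phi p q r * t) = \<Theta> (phi p q r' * t)" "\<Theta> (phii p q r * t) = \<Theta> (phii p q r' * t)"
  unfolding phi_def phii_def
  by (rule lcongD[OF lcong_lift2_2[OF add\<Theta> lcong_lift2_2[OF add\<Theta> assms(1)]]];
      simp add: legs assms)+

lemma rcong_phi3:
  assumes "rcong \<Theta> r r'"
  shows "\<Theta> (t * phi p q r) = \<Theta> (t * phi p q r')" "\<Theta> (t * phii p q r) = \<Theta> (t * phii p q r')"
  unfolding phi_def phii_def
  by (rule rcongD[OF rcong_lift2_2[OF add\<Theta> rcong_lift2_2[OF add\<Theta> assms]]])+

lemma rcong_phi2: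
  assumes "rcong \<Theta> q q'" "commuting q r" "commuting q' r"
  shows "\<Theta> (t * phi p q r) = \<Theta> (t * phi p q' r)" "\<Theta> (t * phii p q r) = \<Theta> (t * phii p q' r)"
  unfolding phi_def phii_def
  by (rule rcongD[OF rcong_lift2_2[OF add\<Theta> rcong_lift2_1[OF add\<Theta> assms]]])+

lemma rcong_phi1:
  assumes "rcong \<Theta> p p'" "commuting p q" "commuting p' q" "commuting p r" "commuting p' r"
  shows "\<Theta> (t * phi p q r) = \<Theta> (t * phi p' q r)" "\<Theta> (t * phii p q r) = \<Theta> (t * phii p' q r)"
  unfolding phi_def phii_def
  by (rule rcongD[OF rcong_lift2_1[OF add\<Theta> assms(1)]]; simp add: legs assms)+

text \<open>An outermost \<Phi> disappears as soon as one of its legs is removable, because \<Phi>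
  with a counit in any slot is 1.\<close>

lemma lcong_phi_eta:
  assumes "lcong \<Theta> l eta" "alg_hom p" "alg_hom q" "commuting p q"
  shows "\<Theta> (phi l p q * t) = \<Theta> t" "\<Theta> (phii l p q * t) = \<Theta> t"
    "commuting p l \<Longrightarrow> \<Theta> (phi p l q * t) = \<Theta> t" "commuting p l \<Longrightarrow> \<Theta> (phii p l q * t) = \<Theta> t"
    "commuting p l \<Longrightarrow> commuting q l \<Longrightarrow> \<Theta> (phi p q l * t) = \<Theta> t"
    "commuting p l \<Longrightarrow> commuting q l \<Longrightarrow> \<Theta> (phii p q l * t) = \<Theta> t"
  by (simp_all add: lcong_phi1[OF assms(1)] lcong_phi2[OF assms(1)] lcong_phi3[OF assms(1)]
      phi_eta phi_eta_mid phii_eta legs assms)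

lemma rcong_phi_eta:
  assumes "rcong \<Theta> l eta" "alg_hom p" "alg_hom q" "commuting p q"
  shows "\<Theta> (t * phi p q l) = \<Theta> t" "\<Theta> (t * phii p q l) = \<Theta> t"
    "commuting l q \<Longrightarrow> \<Theta> (t * phi p l q) = \<Theta> t" "commuting l q \<Longrightarrow> \<Theta> (t * phii p l q) = \<Theta> t"
    "commuting l p \<Longrightarrow> commuting l q \<Longrightarrow> \<Theta> (t * phi l p q) = \<Theta> t"
    "commuting l p \<Longrightarrow> commuting l q \<Longrightarrow> \<Theta> (t * phii l p q) = \<Theta> t"
  by (simp_all add: rcong_phi1[OF assms(1)] rcong_phi2[OF assms(1)] rcong_phi3[OF assms(1)]
      phi_eta phi_eta_mid phii_eta legs assms)

end

text \<open>Evaluate \<Phi> in legs 123 times \<Phi> in legs 1,23,4. The second factor dies at the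
  right end, leaving the comparison times a. By the pentagon the product also equals two factors
  that die at the left end, with coproducts in 12 and in 34, times the inverse of \<Phi> in legs
  234, which gives a' times 1.\<close>

lemma comparison_left:
  assumes l: "left_data \<Delta> f \<sigma>' a'" and d: "antipode_data f \<sigma> a b"
  shows "comparison f \<sigma>' a' b \<sigma> * a = a'"
proof -
  have l2: "left_data \<Delta> f \<sigma> a" and r2: "right_data \<Delta> f \<sigma> b"
    and d4: "tlift3 (\<lambda>x y z. f x * b * \<sigma> y * a * f z) (minv \<Phi>) = 1"
    using d by (auto simp: antipode_data_def)
  note D = left_dataD(3,4)[OF l] left_dataD(4)[OF l2]
  note [simp] = l4 legs left_dataD(5-8)[OF l] left_dataD(6,8)[OF l2]
  define \<Theta> where "\<Theta> = tlift4 (\<lambda>x y z w. \<sigma>' x * a' * f y * b * \<sigma> z * a * f w)"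
  have tri: "clinear (\<lambda>x. \<sigma>' x * a' * f y * b * \<sigma> z * a * f w)"
    "clinear (\<lambda>y. \<sigma>' x * a' * f y * b * \<sigma> z * a * f w)"
    "clinear (\<lambda>z. \<sigma>' x * a' * f y * b * \<sigma> z * a * f w)"
    "clinear (\<lambda>w. \<sigma>' x * a' * f y * b * \<sigma> z * a * f w)" for x y z w
    by (intro lin D[THEN clinear_compose])+
  have \<Theta>: "clinear \<Theta>"
    and pure: "\<Theta> (x \<otimes> y \<otimes> z \<otimes> w) = \<sigma>' x * a' * f y * b * \<sigma> z * a * f w" for x y z w
    unfolding \<Theta>_def by (rule clinear_tlift4[OF tri], rule tlift4_pure[OF tri])
  have k12: "lcong \<Theta> (conv l41 l42) eta"
    by (rule lcong_left_data4[OF l \<Theta>, where g = "\<lambda>x y z w v. \<sigma>' x * v * (f y * b * \<sigma> z * a * f w)"])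
      (simp_all add: alg_hom_one lin, simp add: l4_apply pure mult.assoc)
  have k34: "lcong \<Theta> (conv l43 l44) eta"
    by (rule lcong_left_data4[OF l2 \<Theta>, where g = "\<lambda>x y z w v. \<sigma>' x * a' * f y * b * \<sigma> z * v * f w"])
      (simp_all add: alg_hom_one lin, simp add: l4_apply pure mult.assoc)
  have k23: "rcong \<Theta> (conv l42 l43) eta"
    by (rule rcong_right_data4[OF r2 \<Theta>, where g = "\<lambda>x y z w v. \<sigma>' x * a' * f y * v * (\<sigma> z * a * f w)"])
      (simp_all add: alg_hom_one lin, simp add: l4_apply pure mult.assoc)
  have "phi l41 l42 l43 * phi l41 (conv l42 l43) l44
      = (phi l41 l42 l43 * phi l41 (conv l42 l43) l44 * phi l42 l43 l44) * phii l42 l43 l44"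
    by (simp add: mult.assoc phi_phii_inverse)
  also have "\<dots> = phi (conv l41 l42) l43 l44 * phi l41 l42 (conv l43 l44) * phii l42 l43 l44"
    by (simp flip: pentagon_legs)
  finally have pent: "phi l41 l42 l43 * phi l41 (conv l42 l43) l44
      = phi (conv l41 l42) l43 l44 * (phi l41 l42 (conv l43 l44) * phii l42 l43 l44)"
    by (simp add: mult.assoc)
  have "comparison f \<sigma>' a' b \<sigma> * a = \<Theta> (phi l41 l42 l43)"
    unfolding functional_phi[OF \<Theta>] comparison_def additive_tlift3[OF additive_mult_right]
    by (simp add: l4_apply pure)
  also have "\<dots> = \<Theta> (phi l41 l42 l43 * phi l41 (conv l42 l43) l44)"
    by (simp add: rcong_phi_eta[OF \<Theta> k23])
  also have "\<dots> = \<Theta> (phii l42 l43 l44)"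
    unfolding pent by (simp add: lcong_phi_eta[OF \<Theta> k12] lcong_phi_eta[OF \<Theta> k34])
  also have "\<dots> = tlift3 (\<lambda>x y z. a' * (f x * b * \<sigma> y * a * f z)) (minv \<Phi>)"
    unfolding functional_phii[OF \<Theta>] by (simp add: l4_apply pure mult.assoc)
  also have "\<dots> = a'"
    by (simp add: d4 flip: additive_tlift3[OF additive_mult_left])
  finally show ?thesis .
qed

text \<open>The mirror of the preceding argument: here \<Phi> in legs 1,23,4 dies at the left end
  and the factors with coproducts in 12 and 34 at the right end.\<close>

lemma comparison_right:
  assumes r: "right_data \<Delta> f \<sigma> b" and d: "antipode_data f \<sigma>' a' b'"
  shows "b' * comparison f \<sigma>' a' b \<sigma> = b"
proof -
  have l2: "left_data \<Delta> f \<sigma>' a'" and r2: "right_data \<Delta> f \<sigma>' b'"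
    and d4: "tlift3 (\<lambda>x y z. f x * b' * \<sigma>' y * a' * f z) (minv \<Phi>) = 1"
    using d by (auto simp: antipode_data_def)
  note D = right_dataD(3,4)[OF r] right_dataD(4)[OF r2]
  note [simp] = l4 legs right_dataD(5-8)[OF r] right_dataD(6,8)[OF r2]
  define \<Theta> where "\<Theta> = tlift4 (\<lambda>x y z w. f x * b' * \<sigma>' y * a' * f z * b * \<sigma> w)"
  have tri: "clinear (\<lambda>x. f x * b' * \<sigma>' y * a' * f z * b * \<sigma> w)"
    "clinear (\<lambda>y. f x * b' * \<sigma>' y * a' * f z * b * \<sigma> w)"
    "clinear (\<lambda>z. f x * b' * \<sigma>' y * a' * f z * b * \<sigma> w)"
    "clinear (\<lambda>w. f x * b' * \<sigma>' y * a' * f z * b * \<sigma> w)" for x y z w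
    by (intro lin D[THEN clinear_compose])+
  have \<Theta>: "clinear \<Theta>"
    and pure: "\<Theta> (x \<otimes> y \<otimes> z \<otimes> w) = f x * b' * \<sigma>' y * a' * f z * b * \<sigma> w" for x y z w
    unfolding \<Theta>_def by (rule clinear_tlift4[OF tri], rule tlift4_pure[OF tri])
  have k12: "rcong \<Theta> (conv l41 l42) eta"
    by (rule rcong_right_data4[OF r2 \<Theta>, where g = "\<lambda>x y z w v. f x * v * (\<sigma>' y * a' * f z * b * \<sigma> w)"])
      (simp_all add: alg_hom_one lin, simp add: l4_apply pure mult.assoc)
  have k34: "rcong \<Theta> (conv l43 l44) eta"
    by (rule rcong_right_data4[OF r \<Theta>, where g = "\<lambda>x y z w v. f x * b' * \<sigma>' y * a' * f z * v * \<sigma> w"])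
      (simp_all add: alg_hom_one lin, simp add: l4_apply pure mult.assoc)
  have k23: "lcong \<Theta> (conv l42 l43) eta"
    by (rule lcong_left_data4[OF l2 \<Theta>, where g = "\<lambda>x y z w v. f x * b' * \<sigma>' y * v * (f z * b * \<sigma> w)"])
      (simp_all add: alg_hom_one lin, simp add: l4_apply pure mult.assoc)
  have "phi l41 (conv l42 l43) l44 * phi l42 l43 l44
      = phii l41 l42 l43 * (phi l41 l42 l43 * phi l41 (conv l42 l43) l44 * phi l42 l43 l44)"
    by (simp add: phi_phii_inverse flip: mult.assoc)
  also have "\<dots> = phii l41 l42 l43 * (phi (conv l41 l42) l43 l44 * phi l41 l42 (conv l43 l44))"
    by (simp flip: pentagon_legs)
  finally have pent: "phi l41 (conv l42 l43) l44 * phi l42 l43 l44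
      = phii l41 l42 l43 * phi (conv l41 l42) l43 l44 * phi l41 l42 (conv l43 l44)"
    by (simp add: mult.assoc)
  have "b' * comparison f \<sigma>' a' b \<sigma> = \<Theta> (phi l42 l43 l44)"
    unfolding functional_phi[OF \<Theta>] comparison_def additive_tlift3[OF additive_mult_left]
    by (simp add: l4_apply pure mult.assoc)
  also have "\<dots> = \<Theta> (phi l41 (conv l42 l43) l44 * phi l42 l43 l44)"
    by (simp add: lcong_phi_eta[OF \<Theta> k23])
  also have "\<dots> = \<Theta> (phii l41 l42 l43)"
    unfolding pent by (simp add: rcong_phi_eta[OF \<Theta> k12] rcong_phi_eta[OF \<Theta> k34])
  also have "\<dots> = tlift3 (\<lambda>x y z. (f x * b' * \<sigma>' y * a' * f z) * b) (minv \<Phi>)"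
    unfolding functional_phii[OF \<Theta>] by (simp add: l4_apply pure mult.assoc)
  also have "\<dots> = b"
    by (simp add: d4 flip: additive_tlift3[OF additive_mult_right])
  finally show ?thesis .
qed

lemma comparison_unique:
  assumes d: "antipode_data f \<sigma> a b" and v: "\<And>h. v * \<sigma> h = \<sigma>' h * v" "v * a = a'"
  shows "v = comparison f \<sigma>' a' b \<sigma>"
proof -
  have "v = v * tlift3 (\<lambda>x y z. \<sigma> x * a * f y * b * \<sigma> z) \<Phi>"
    using d by (simp add: antipode_data_def)
  also have "\<dots> = tlift3 (\<lambda>x y z. (v * \<sigma> x) * a * f y * b * \<sigma> z) \<Phi>"
    by (simp add: additive_tlift3[OF additive_mult_left] mult.assoc)
  also have "\<dots> = tlift3 (\<lambda>x y z. \<sigma>' x * (v * a) * f y * b * \<sigma> z) \<Phi>"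
    by (simp only: v(1) mult.assoc)
  finally show ?thesis by (simp add: v comparison_def)
qed

text \<open>The product commutes with \<sigma>' and fixes a', as 1 does; both are therefore the
  comparison of the primed data with themselves.\<close>

lemma comparison_inverse:
  assumes d: "antipode_data f \<sigma> a b" and d': "antipode_data f \<sigma>' a' b'"
  shows "comparison f \<sigma>' a' b \<sigma> * comparison f \<sigma> a b' \<sigma>' = 1"
proof -
  have ld: "left_data \<Delta> f \<sigma> a" "left_data \<Delta> f \<sigma>' a'" "right_data \<Delta> f \<sigma> b" "right_data \<Delta> f \<sigma>' b'"
    using d d' by (auto simp: antipode_data_def)
  let ?u = "comparison f \<sigma>' a' b \<sigma>" and ?v = "comparison f \<sigma> a b' \<sigma>'"
  have "?u * ?v = comparison f \<sigma>' a' b' \<sigma>'"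
  proof (rule comparison_unique[OF d'])
    show "?u * ?v * \<sigma>' h = \<sigma>' h * (?u * ?v)" for h
      using comparison_intertwines[OF ld(2,3)] comparison_intertwines[OF ld(1,4)]
      by (metis mult.assoc)
    show "?u * ?v * a' = a'"
      using comparison_left[OF ld(1) d'] comparison_left[OF ld(2) d] by (simp add: mult.assoc)
  qed
  also have "\<dots> = 1" using comparison_unique[OF d', of 1 \<sigma>' a'] by simp
  finally show ?thesis .
qed

section \<open>The pentagon calculation on six legs\<close>

lemma pentagon_rearranged:
  assumes "alg_hom p" "alg_hom q" "alg_hom r" "alg_hom s" "commuting p q" "commuting p r"
    "commuting q r" "commuting p s" "commuting q s" "commuting r s"
  shows "phii p q r * phi (conv p q) r s = phi p (conv q r) s * phi q r s * phii p q (conv r s)"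
    and "phii (conv p q) r s * phi p q r = phi p q (conv r s) * phii q r s * phii p (conv q r) s"
    and "phi p q (conv r s) * phii q r s = phii (conv p q) r s * phi p q r * phi p (conv q r) s"
    and "phi q r s * phii p q (conv r s) = phii p (conv q r) s * phii p q r * phi (conv p q) r s"
    and "phi p (conv q r) s * phi q r s = phii p q r * phi (conv p q) r s * phi p q (conv r s)"
    and "phii q r s * phii p (conv q r) s = phii p q (conv r s) * phii (conv p q) r s * phi p q r"
  using monoid_pentagon[OF pentagon_legs[OF assms] phi_phii_inverse[of "conv p q" r s]
      phi_phii_inverse[of p q "conv r s"] phi_phii_inverse[of p q r]
      phi_phii_inverse[of p "conv q r" s] phi_phii_inverse[of q r s]]
  by (simp_all add: legs assms)

text \<open>An element that can be moved past every leg can be moved past \<Phi>. With another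
  \<Phi> as \<open>c\<close> and quasi-coassociativity for one of the legs, this rebrackets an
  iterated coproduct sitting in that leg.\<close>

lemma phi_intertwine:
  assumes "\<And>h. p h * c = c * p' h" "\<And>h. q h * c = c * q' h" "\<And>h. r h * c = c * r' h"
  shows "phi p q r * c = c * phi p' q' r'" "phii p q r * c = c * phii p' q' r'"
  unfolding phi_def phii_def by (intro lift2_intertwine assms)+

lemma conv_intertwine:
  assumes "\<And>h. p h * c = c * p' h" "\<And>h. q h * c = c * q' h"
  shows "conv p q h * c = c * conv p' q' h"
  unfolding conv_def by (intro lift2_intertwine assms)

lemma phi_commute:
  assumes "commuting p s" "commuting q s" "commuting r s"
  shows "s h * phi p q r = phi p q r * s h" "s h * phii p q r = phii p q r * s h"
  using phi_intertwine[of p "s h" p q q r r] assms by (simp_all add: commuting_def)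

lemma cancel_phi:
  assumes "alg_hom p" "alg_hom q" "alg_hom r" "commuting p q" "commuting p r" "commuting q r"
  shows "phi p q r * (phii p q r * x) = x" "phii p q r * (phi p q r * x) = x"
  by (simp_all add: phi_phii_inverse[OF assms] flip: mult.assoc)

text \<open>Write \<open>T\<close> for the argument on the left, and \<open>\<Phi>\<^sub>2\<^sub>,\<^sub>3\<^sub>4\<^sub>,\<^sub>5\<close> for \<open>phi p2 (conv p3 p4) p5\<close> etc. The pentagon
  creates factors that contain \<open>conv p2 p3\<close> or \<open>conv p1 p4\<close> at the far left, or \<open>conv p4 p5\<close> or
  \<open>conv p3 p6\<close> at the far right; under \<open>\<Theta>\<close> these legs may be replaced by the counit. In this way
  \<open>T\<close> reduces to \<open>\<Phi>\<^sub>1\<^sub>,\<^sub>4\<^sub>,\<^sub>5\<^sub>6 \<Phi>\<^sub>2\<^sub>3\<^sub>4 \<Phi>\<^sub>2\<^sub>,\<^sub>3\<^sub>4\<^sub>,\<^sub>5\<^sub>6 \<Phi>\<^sub>3\<^sub>4\<^sub>,\<^sub>5\<^sub>,\<^sub>6\<^sup>-\<^sup>1 \<Phi>\<^sub>3\<^sub>4\<^sub>5\<close>, then to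
  \<open>\<Phi>\<^sub>1\<^sub>,\<^sub>4\<^sub>,\<^sub>5\<^sub>6 \<Phi>\<^sub>4\<^sub>5\<^sub>6\<^sup>-\<^sup>1 \<Phi>\<^sub>2\<^sub>3\<^sub>6\<close> and finally to \<open>\<Phi>\<^sub>1\<^sub>4\<^sub>5 \<Phi>\<^sub>2\<^sub>3\<^sub>6\<close>.\<close>

lemma six_legs:
  fixes \<Theta> :: "'m::complex_algebra_1 \<Rightarrow> 'v::complex_vector"
  assumes \<Theta>: "clinear \<Theta>" and p: "leg_list [p1, p2, p3, p4, p5, p6]"
    and l23: "lcong \<Theta> (conv p2 p3) eta" and l14: "lcong \<Theta> (conv p1 p4) eta"
    and r45: "rcong \<Theta> (conv p4 p5) eta" and r36: "rcong \<Theta> (conv p3 p6) eta"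
  shows "\<Theta> (phii p1 p2 p3 * phi (conv p1 p2) p3 p4 * phi (conv p1 p2) (conv p3 p4) (conv p5 p6)
      * (phii (conv p3 p4) p5 p6 * phi p3 p4 p5)) = \<Theta> (phi p1 p4 p5 * phi p2 p3 p6)" (is "\<Theta> ?T = _")
proof -
  note [simp] = p[simplified] legs conv_eta
  let ?Y = "phii (conv p3 p4) p5 p6 * phi p3 p4 p5"
  have l234: "lcong \<Theta> (conv (conv p2 p3) p4) p4" using lcong_conv1[OF \<Theta> l23, of p4] by simp
  have r345: "rcong \<Theta> (conv p3 (conv p4 p5)) p3" using rcong_conv2[OF \<Theta> r45, of p3] by simp
  have r3456: "rcong \<Theta> (conv (conv p3 (conv p4 p5)) p6) eta"
    using rcong_trans[OF rcong_conv1[OF \<Theta> r345, of p6] r36] by simp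
  \<comment> \<open>Crossing \<open>?Y\<close> rebrackets the last four legs as (3(45))6, in which
    form \<open>r3456\<close> removes the whole factor from the right end.\<close>
  have Y: "phii p1 p2 (conv (conv p3 p4) (conv p5 p6)) * ?Y
      = ?Y * phii p1 p2 (conv (conv p3 (conv p4 p5)) p6)"
  proof (rule phi_intertwine)
    show "p1 h * ?Y = ?Y * p1 h" "p2 h * ?Y = ?Y * p2 h" for h
      by (intro commute_mult phi_commute; simp)+
    show "conv (conv p3 p4) (conv p5 p6) h * ?Y = ?Y * conv (conv p3 (conv p4 p5)) p6 h" for h
    proof -
      have "conv (conv p3 p4) (conv p5 p6) h * ?Y
        = phii (conv p3 p4) p5 p6 * (conv (conv (conv p3 p4) p5) p6 h * phi p3 p4 p5)"
        by (simp add: conv_coassoc_inv flip: mult.assoc)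
      also have "conv (conv (conv p3 p4) p5) p6 h * phi p3 p4 p5
        = phi p3 p4 p5 * conv (conv p3 (conv p4 p5)) p6 h"
        by (rule conv_intertwine) (simp_all add: conv_coassoc phi_commute)
      finally show ?thesis by (simp add: mult.assoc)
    qed
  qed
  have c1: "phi p2 p3 p4 * phi p1 (conv p2 (conv p3 p4)) (conv p5 p6)
      = phi p1 (conv (conv p2 p3) p4) (conv p5 p6) * phi p2 p3 p4"
    by (rule phi_intertwine(1)[symmetric]) (simp_all add: conv_coassoc phi_commute)
  have c2: "phi p2 p3 p4 * phii (conv p2 (conv p3 p4)) p5 p6
      = phii (conv (conv p2 p3) p4) p5 p6 * phi p2 p3 p4"
    by (rule phi_intertwine(2)[symmetric]) (simp_all add: conv_coassoc phi_commute)
  have c3: "phi p2 (conv (conv p3 p4) p5) p6 * phi p3 p4 p5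
      = phi p3 p4 p5 * phi p2 (conv p3 (conv p4 p5)) p6"
    by (rule phi_intertwine(1)) (simp_all add: conv_coassoc phi_commute)

  have "\<Theta> ?T = \<Theta> (phi p1 (conv p2 p3) p4 * (phi p2 p3 p4 * (phii p1 p2 (conv p3 p4)
      * phi (conv p1 p2) (conv p3 p4) (conv p5 p6)) * ?Y))"
    by (subst pentagon_rearranged(1)) (simp_all add: mult.assoc)
  also have "\<dots> = \<Theta> (phi p2 p3 p4 * (phii p1 p2 (conv p3 p4)
      * phi (conv p1 p2) (conv p3 p4) (conv p5 p6)) * ?Y)"
    by (simp add: lcong_phi_eta[OF \<Theta> l23])
  also have "\<dots> = \<Theta> ((phi p2 p3 p4 * phi p1 (conv p2 (conv p3 p4)) (conv p5 p6))
      * phi p2 (conv p3 p4) (conv p5 p6) * (phii p1 p2 (conv (conv p3 p4) (conv p5 p6)) * ?Y))"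
    by (subst pentagon_rearranged(1)) (simp_all add: mult.assoc)
  also have "\<dots> = \<Theta> ((phi p1 (conv (conv p2 p3) p4) (conv p5 p6) * (phi p2 p3 p4
      * phi p2 (conv p3 p4) (conv p5 p6) * ?Y)) * phii p1 p2 (conv (conv p3 (conv p4 p5)) p6))"
    unfolding Y c1 by (simp add: mult.assoc)
  also have "\<dots> = \<Theta> (phi p1 (conv (conv p2 p3) p4) (conv p5 p6) * (phi p2 p3 p4
      * phi p2 (conv p3 p4) (conv p5 p6) * ?Y))"
    by (simp add: rcong_phi_eta[OF \<Theta> r3456])
  also have "\<dots> = \<Theta> (phi p1 p4 (conv p5 p6) * (phi p2 p3 p4
      * (phi p2 (conv p3 p4) (conv p5 p6) * phii (conv p3 p4) p5 p6) * phi p3 p4 p5))"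
    by (simp add: lcong_phi2[OF \<Theta> l234] mult.assoc)
  also have "phi p2 (conv p3 p4) (conv p5 p6) * phii (conv p3 p4) p5 p6
      = phii (conv p2 (conv p3 p4)) p5 p6 * phi p2 (conv p3 p4) p5 * phi p2 (conv (conv p3 p4) p5) p6"
    by (simp add: pentagon_rearranged(3))
  also have "phi p1 p4 (conv p5 p6) * (phi p2 p3 p4 * \<dots> * phi p3 p4 p5)
      = phi p1 p4 (conv p5 p6) * ((phi p2 p3 p4 * phii (conv p2 (conv p3 p4)) p5 p6)
        * (phi p2 (conv p3 p4) p5 * (phi p2 (conv (conv p3 p4) p5) p6 * phi p3 p4 p5)))"
    by (simp only: mult.assoc)
  also have "\<dots> = phi p1 p4 (conv p5 p6) * (phii (conv (conv p2 p3) p4) p5 p6 * phi p2 p3 p4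
        * ((phi p2 (conv p3 p4) p5 * phi p3 p4 p5))) * phi p2 (conv p3 (conv p4 p5)) p6"
    unfolding c2 c3 by (simp only: mult.assoc)
  also have "phi p2 (conv p3 p4) p5 * phi p3 p4 p5
      = phii p2 p3 p4 * phi (conv p2 p3) p4 p5 * phi p2 p3 (conv p4 p5)"
    by (simp add: pentagon_rearranged(5))
  also have "\<Theta> (phi p1 p4 (conv p5 p6) * (phii (conv (conv p2 p3) p4) p5 p6 * phi p2 p3 p4
        * \<dots>) * phi p2 (conv p3 (conv p4 p5)) p6)
      = \<Theta> (phi p1 p4 (conv p5 p6) * (phii (conv (conv p2 p3) p4) p5 p6
        * (phi (conv p2 p3) p4 p5 * phi p2 p3 (conv p4 p5) * phi p2 p3 p6)))"
    by (subst rcong_phi2(1)[OF \<Theta> r345]) (simp_all add: mult.assoc cancel_phi)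
  also have "\<dots> = \<Theta> (phi p1 p4 (conv p5 p6) * (phii p4 p5 p6
        * (phi (conv p2 p3) p4 p5 * phi p2 p3 (conv p4 p5) * phi p2 p3 p6)))"
  proof (rule lcong_phi1(2))
    show *: "clinear (\<lambda>x. \<Theta> (phi p1 p4 (conv p5 p6) * x))" by (intro clinear_compose[OF \<Theta>] lin)
    \<comment> \<open>The factor in front lives in legs 1, 4, 5, 6, so legs 2 and 3 remain removable
      behind it.\<close>
    have "lcong (\<lambda>x. \<Theta> (phi p1 p4 (conv p5 p6) * x)) (conv p2 p3) eta"
      by (rule lcong_shift[OF l23]) (simp_all add: phi_commute)
    from lcong_conv1[OF * this, of p4]
    show "lcong (\<lambda>x. \<Theta> (phi p1 p4 (conv p5 p6) * x)) (conv (conv p2 p3) p4) p4" by simp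
  qed
  also have "\<dots> = \<Theta> (phi p1 p4 (conv p5 p6) * phii p4 p5 p6 * (phi p2 p3 (conv p4 p5) * phi p2 p3 p6))"
  proof -
    let ?c = "phi p1 p4 (conv p5 p6) * phii p4 p5 p6"
    have c: "?c * conv p2 p3 h = conv p2 p3 h * ?c" for h
      by (rule commute_mult[symmetric]) (simp_all add: phi_commute)
    have "lcong (\<lambda>x. \<Theta> (?c * x)) (conv p2 p3) eta"
      by (rule lcong_shift[OF l23]) (simp_all add: c eta_mult_left eta_mult_right)
    from lcong_phi_eta(1)[OF _ this, of p4 p5]
    show ?thesis by (simp add: clinear_compose[OF \<Theta>] lin mult.assoc)
  qed
  also have "\<dots> = \<Theta> (phi p1 p4 (conv p5 p6) * phii p4 p5 p6 * phi p2 p3 p6)"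
  proof -
    have "rcong (\<lambda>x. \<Theta> (x * phi p2 p3 p6)) (conv p4 p5) eta"
      by (rule rcong_shift[OF r45]) (simp_all add: phi_commute)
    from rcong_phi_eta(1)[OF _ this, of p2 p3]
    show ?thesis by (simp add: clinear_compose[OF \<Theta>] lin flip: mult.assoc)
  qed
  also have "phi p1 p4 (conv p5 p6) * phii p4 p5 p6
      = phii (conv p1 p4) p5 p6 * phi p1 p4 p5 * phi p1 (conv p4 p5) p6"
    by (simp add: pentagon_rearranged(3))
  also have "\<Theta> (\<dots> * phi p2 p3 p6) = \<Theta> (phi p1 p4 p5 * phi p1 (conv p4 p5) p6 * phi p2 p3 p6)"
    by (simp add: lcong_phi_eta[OF \<Theta> l14] mult.assoc)
  also have "\<dots> = \<Theta> (phi p1 p4 p5 * phi p2 p3 p6)"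
  proof -
    have "rcong (\<lambda>x. \<Theta> (x * phi p2 p3 p6)) (conv p4 p5) eta"
      by (rule rcong_shift[OF r45]) (simp_all add: phi_commute)
    from rcong_phi_eta(3)[OF _ this, of p1 p6]
    show ?thesis by (simp add: clinear_compose[OF \<Theta>] lin)
  qed
  finally show ?thesis .
qed

text \<open>The same reduction for the inverse of that argument, read from right to left.\<close>

lemma six_legs_mirror:
  fixes \<Theta> :: "'m::complex_algebra_1 \<Rightarrow> 'v::complex_vector"
  assumes \<Theta>: "clinear \<Theta>" and p: "leg_list [p1, p2, p3, p4, p5, p6]"
    and r23: "rcong \<Theta> (conv p2 p3) eta" and r14: "rcong \<Theta> (conv p1 p4) eta"
    and l45: "lcong \<Theta> (conv p4 p5) eta" and l36: "lcong \<Theta> (conv p3 p6) eta"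
  shows "\<Theta> (phii p3 p4 p5 * phi (conv p3 p4) p5 p6 * phii (conv p1 p2) (conv p3 p4) (conv p5 p6)
      * (phii (conv p1 p2) p3 p4 * phi p1 p2 p3)) = \<Theta> (phii p2 p3 p6 * phii p1 p4 p5)" (is "\<Theta> ?T = _")
proof -
  note [simp] = p[simplified] legs conv_eta
  let ?Y = "phii p3 p4 p5 * phi (conv p3 p4) p5 p6"
  have r234: "rcong \<Theta> (conv (conv p2 p3) p4) p4" using rcong_conv1[OF \<Theta> r23, of p4] by simp
  have l345: "lcong \<Theta> (conv p3 (conv p4 p5)) p3" using lcong_conv2[OF \<Theta> l45, of p3] by simp
  have l3456: "lcong \<Theta> (conv (conv p3 (conv p4 p5)) p6) eta"
    using lcong_trans[OF lcong_conv1[OF \<Theta> l345, of p6] l36] by simp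
  have Y: "?Y * phi p1 p2 (conv (conv p3 p4) (conv p5 p6))
      = phi p1 p2 (conv (conv p3 (conv p4 p5)) p6) * ?Y"
  proof (rule phi_intertwine(1)[symmetric])
    show "p1 h * ?Y = ?Y * p1 h" "p2 h * ?Y = ?Y * p2 h" for h
      by (intro commute_mult phi_commute; simp)+
    show "conv (conv p3 (conv p4 p5)) p6 h * ?Y = ?Y * conv (conv p3 p4) (conv p5 p6) h" for h
    proof -
      have "conv (conv p3 (conv p4 p5)) p6 h * phii p3 p4 p5
        = phii p3 p4 p5 * conv (conv (conv p3 p4) p5) p6 h"
        by (rule conv_intertwine) (simp_all add: conv_coassoc_inv phi_commute)
      then have "conv (conv p3 (conv p4 p5)) p6 h * ?Y
        = phii p3 p4 p5 * (conv (conv (conv p3 p4) p5) p6 h * phi (conv p3 p4) p5 p6)"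
        by (simp flip: mult.assoc)
      then show ?thesis by (simp add: mult.assoc flip: conv_coassoc)
    qed
  qed
  have c1: "phii p1 (conv p2 (conv p3 p4)) (conv p5 p6) * phii p2 p3 p4
      = phii p2 p3 p4 * phii p1 (conv (conv p2 p3) p4) (conv p5 p6)"
    by (rule phi_intertwine(2)) (simp_all add: conv_coassoc_inv phi_commute)
  have c2: "phi (conv p2 (conv p3 p4)) p5 p6 * phii p2 p3 p4
      = phii p2 p3 p4 * phi (conv (conv p2 p3) p4) p5 p6"
    by (rule phi_intertwine(1)) (simp_all add: conv_coassoc_inv phi_commute)
  have c3: "phii p3 p4 p5 * phii p2 (conv (conv p3 p4) p5) p6
      = phii p2 (conv p3 (conv p4 p5)) p6 * phii p3 p4 p5"
    by (rule phi_intertwine(2)[symmetric]) (simp_all add: conv_coassoc_inv phi_commute)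

  have "\<Theta> ?T = \<Theta> (?Y * phii (conv p1 p2) (conv p3 p4) (conv p5 p6)
      * (phi p1 p2 (conv p3 p4) * phii p2 p3 p4) * phii p1 (conv p2 p3) p4)"
    by (subst pentagon_rearranged(2)) (simp_all add: mult.assoc)
  also have "\<dots> = \<Theta> (?Y * phii (conv p1 p2) (conv p3 p4) (conv p5 p6)
      * (phi p1 p2 (conv p3 p4) * phii p2 p3 p4))"
    by (simp add: rcong_phi_eta[OF \<Theta> r23])
  also have "\<dots> = \<Theta> (?Y * (phii (conv p1 p2) (conv p3 p4) (conv p5 p6)
      * phi p1 p2 (conv p3 p4)) * phii p2 p3 p4)"
    by (simp only: mult.assoc)
  also have "phii (conv p1 p2) (conv p3 p4) (conv p5 p6) * phi p1 p2 (conv p3 p4)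
      = phi p1 p2 (conv (conv p3 p4) (conv p5 p6)) * phii p2 (conv p3 p4) (conv p5 p6)
        * phii p1 (conv p2 (conv p3 p4)) (conv p5 p6)"
    by (simp add: pentagon_rearranged(2))
  also have "?Y * \<dots> * phii p2 p3 p4 = ?Y * phi p1 p2 (conv (conv p3 p4) (conv p5 p6))
      * phii p2 (conv p3 p4) (conv p5 p6)
        * (phii p1 (conv p2 (conv p3 p4)) (conv p5 p6) * phii p2 p3 p4)"
    by (simp only: mult.assoc)
  also have "\<dots> = phi p1 p2 (conv (conv p3 (conv p4 p5)) p6) * (?Y * phii p2 (conv p3 p4) (conv p5 p6)
        * phii p2 p3 p4 * phii p1 (conv (conv p2 p3) p4) (conv p5 p6))"
    unfolding Y c1 by (simp only: mult.assoc)
  also have "\<Theta> \<dots> = \<Theta> (?Y * phii p2 (conv p3 p4) (conv p5 p6)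
        * phii p2 p3 p4 * phii p1 (conv (conv p2 p3) p4) (conv p5 p6))"
    by (simp add: lcong_phi_eta[OF \<Theta> l3456])
  also have "\<dots> = \<Theta> (phii p3 p4 p5 * (phi (conv p3 p4) p5 p6 * phii p2 (conv p3 p4) (conv p5 p6))
        * phii p2 p3 p4 * phii p1 p4 (conv p5 p6))"
    by (subst rcong_phi2(2)[OF \<Theta> r234]) (simp_all add: mult.assoc)
  also have "phi (conv p3 p4) p5 p6 * phii p2 (conv p3 p4) (conv p5 p6)
      = phii p2 (conv (conv p3 p4) p5) p6 * phii p2 (conv p3 p4) p5 * phi (conv p2 (conv p3 p4)) p5 p6"
    by (simp add: pentagon_rearranged(4))
  also have "phii p3 p4 p5 * \<dots> * phii p2 p3 p4
      = (phii p3 p4 p5 * phii p2 (conv (conv p3 p4) p5) p6) * phii p2 (conv p3 p4) p5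
        * (phi (conv p2 (conv p3 p4)) p5 p6 * phii p2 p3 p4)"
    by (simp only: mult.assoc)
  also have "\<dots> = phii p2 (conv p3 (conv p4 p5)) p6 * (phii p3 p4 p5 * phii p2 (conv p3 p4) p5)
        * (phii p2 p3 p4 * phi (conv (conv p2 p3) p4) p5 p6)"
    unfolding c2 c3 by (simp only: mult.assoc)
  also have "phii p3 p4 p5 * phii p2 (conv p3 p4) p5
      = phii p2 p3 (conv p4 p5) * phii (conv p2 p3) p4 p5 * phi p2 p3 p4"
    by (simp add: pentagon_rearranged(6))
  also have "\<Theta> (phii p2 (conv p3 (conv p4 p5)) p6 * \<dots>
        * (phii p2 p3 p4 * phi (conv (conv p2 p3) p4) p5 p6) * phii p1 p4 (conv p5 p6))
      = \<Theta> (phii p2 p3 p6 * phii p2 p3 (conv p4 p5) * phii (conv p2 p3) p4 p5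
        * phi (conv (conv p2 p3) p4) p5 p6 * phii p1 p4 (conv p5 p6))"
    by (simp add: lcong_phi2[OF \<Theta> l345] mult.assoc cancel_phi)
  also have "\<dots> = \<Theta> (phii p2 p3 p6 * phii p2 p3 (conv p4 p5) * phii (conv p2 p3) p4 p5
        * phi p4 p5 p6 * phii p1 p4 (conv p5 p6))"
  proof (rule rcong_phi1(1))
    show *: "clinear (\<lambda>x. \<Theta> (x * phii p1 p4 (conv p5 p6)))" by (intro clinear_compose[OF \<Theta>] lin)
    have "rcong (\<lambda>x. \<Theta> (x * phii p1 p4 (conv p5 p6))) (conv p2 p3) eta"
      by (rule rcong_shift[OF r23]) (simp_all add: phi_commute)
    from rcong_conv1[OF * this, of p4]
    show "rcong (\<lambda>x. \<Theta> (x * phii p1 p4 (conv p5 p6))) (conv (conv p2 p3) p4) p4" by simp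
  qed simp_all
  also have "\<dots> = \<Theta> (phii p2 p3 p6 * phii p2 p3 (conv p4 p5) * (phi p4 p5 p6 * phii p1 p4 (conv p5 p6)))"
  proof -
    let ?c = "phi p4 p5 p6 * phii p1 p4 (conv p5 p6)"
    have c: "conv p2 p3 h * ?c = ?c * conv p2 p3 h" for h
      by (rule commute_mult) (simp_all add: phi_commute)
    have "rcong (\<lambda>x. \<Theta> (x * ?c)) (conv p2 p3) eta"
      by (rule rcong_shift[OF r23]) (simp_all add: c eta_mult_left eta_mult_right)
    from rcong_phi_eta(6)[OF _ this, of p4 p5]
    show ?thesis by (simp add: clinear_compose[OF \<Theta>] lin flip: mult.assoc)
  qed
  also have "\<dots> = \<Theta> (phii p2 p3 p6 * (phi p4 p5 p6 * phii p1 p4 (conv p5 p6)))"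
  proof -
    have "lcong (\<lambda>x. \<Theta> (phii p2 p3 p6 * x)) (conv p4 p5) eta"
      by (rule lcong_shift[OF l45]) (simp_all add: phi_commute)
    from lcong_phi_eta(6)[OF _ this, of p2 p3]
    show ?thesis by (simp add: clinear_compose[OF \<Theta>] lin mult.assoc)
  qed
  also have "phi p4 p5 p6 * phii p1 p4 (conv p5 p6)
      = phii p1 (conv p4 p5) p6 * phii p1 p4 p5 * phi (conv p1 p4) p5 p6"
    by (simp add: pentagon_rearranged(4))
  also have "\<Theta> (phii p2 p3 p6 * \<dots>) = \<Theta> (phii p2 p3 p6 * (phii p1 (conv p4 p5) p6 * phii p1 p4 p5))"
    by (simp add: rcong_phi_eta[OF \<Theta> r14] flip: mult.assoc)
  also have "\<dots> = \<Theta> (phii p2 p3 p6 * phii p1 p4 p5)"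
  proof -
    have "lcong (\<lambda>x. \<Theta> (phii p2 p3 p6 * x)) (conv p4 p5) eta"
      by (rule lcong_shift[OF l45]) (simp_all add: phi_commute)
    from lcong_phi_eta(4)[OF _ this, of p1 p6]
    show ?thesis by (simp add: clinear_compose[OF \<Theta>] lin)
  qed
  finally show ?thesis .
qed

end

section \<open>The Drinfeld twist\<close>

text \<open>With s = S this yields the side \<open>(S \<otimes> S) \<Delta>\<^sup>T\<close> of the
  Drinfeld relation; with s = S^-1 it yields the second Drinfeld twist and the factor of the theorem
  that contains the flipped \<Omega>. These two maps are inverse to each other.\<close>

definition reflect :: "('a::complex_vector \<Rightarrow> 'b::complex_vector) \<Rightarrow> 'a \<otimes> 'a \<Rightarrow> 'b \<otimes> 'b"
  where "reflect s t = tmap s s (tswap t)"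

lemma clinear_reflect: "clinear s \<Longrightarrow> clinear (reflect s)"
  unfolding reflect_def[abs_def] by (rule clinear_compose[OF clinear_tmap clinear_tswap])

lemma reflect_pure: "clinear s \<Longrightarrow> reflect s (a \<otimes> b) = s b \<otimes> s a"
  by (simp add: reflect_def tswap_pure clinear_tmap_pure)

lemma alg_antihom_reflect:
  assumes s: "alg_antihom s"
  shows "alg_antihom (reflect s)"
proof -
  note cs = alg_antihom_clinear[OF s]
  note cr = clinear_reflect[OF cs]
  have 1: "reflect s ((a \<otimes> b) * (c \<otimes> d)) = reflect s (c \<otimes> d) * reflect s (a \<otimes> b)" for a b c d
    by (simp add: tensor_mult_tensor reflect_pure cs alg_antihom_mult s)
  have 2: "reflect s ((a \<otimes> b) * u) = reflect s u * reflect s (a \<otimes> b)" for a b u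
    by (rule tensor_ext[of "\<lambda>u. reflect s ((a \<otimes> b) * u)"])
      (intro additive_clinear clinear_compose[OF cr] cr lin 1)+
  have "reflect s (t * u) = reflect s u * reflect s t" for t u
    by (rule tensor_ext[of "\<lambda>t. reflect s (t * u)"])
      (intro additive_clinear clinear_compose[OF cr] cr lin 2)+
  moreover have "reflect s 1 = 1"
    by (simp add: one_tensor_def reflect_pure cs alg_antihom_one s)
  ultimately show ?thesis by (simp add: alg_antihom_def cr)
qed

lemma lift2_l4_apply:
  assumes "clinear p" "clinear q" "clinear r" "clinear s"
    and one: "p 1 = 1" "q 1 = 1" "r 1 = 1" "s 1 = 1"
  shows "lift2 p (lift2 q (lift2 r s)) (l41 h) = p h" "lift2 p (lift2 q (lift2 r s)) (l42 h) = q h"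
    "lift2 p (lift2 q (lift2 r s)) (l43 h) = r h" "lift2 p (lift2 q (lift2 r s)) (l44 h) = s h"
  by (simp_all add: l4_apply lift2_pure clinear_lift2 assms)

text \<open>The six legs of the third and fourth antipode axioms for \<open>((S \<otimes> S) \<Delta>\<^sup>T, \<gamma>, \<delta>)\<close>, grouped by
  the factor of \<open>H \<otimes> H\<close> to which they contribute, so that the functional in question is a \<open>tmap\<close>.\<close>

definition c1 :: "'h::complex_algebra_1 \<Rightarrow> ('h \<otimes> 'h \<otimes> 'h) \<otimes> 'h \<otimes> 'h \<otimes> 'h" where "c1 h = inl (l31 h)"
definition c2 :: "'h::complex_algebra_1 \<Rightarrow> ('h \<otimes> 'h \<otimes> 'h) \<otimes> 'h \<otimes> 'h \<otimes> 'h" where "c2 h = inl (l32 h)"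
definition c3 :: "'h::complex_algebra_1 \<Rightarrow> ('h \<otimes> 'h \<otimes> 'h) \<otimes> 'h \<otimes> 'h \<otimes> 'h" where "c3 h = inl (l33 h)"
definition d1 :: "'h::complex_algebra_1 \<Rightarrow> ('h \<otimes> 'h \<otimes> 'h) \<otimes> 'h \<otimes> 'h \<otimes> 'h" where "d1 h = inr (l31 h)"
definition d2 :: "'h::complex_algebra_1 \<Rightarrow> ('h \<otimes> 'h \<otimes> 'h) \<otimes> 'h \<otimes> 'h \<otimes> 'h" where "d2 h = inr (l32 h)"
definition d3 :: "'h::complex_algebra_1 \<Rightarrow> ('h \<otimes> 'h \<otimes> 'h) \<otimes> 'h \<otimes> 'h \<otimes> 'h" where "d3 h = inr (l33 h)"

lemma alg_hom_cd: "alg_hom c1" "alg_hom c2" "alg_hom c3" "alg_hom d1" "alg_hom d2" "alg_hom d3"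
  unfolding c1_def[abs_def] c2_def[abs_def] c3_def[abs_def] d1_def[abs_def] d2_def[abs_def] d3_def[abs_def]
  by (intro alg_hom_compose[OF alg_hom_inl] alg_hom_compose[OF alg_hom_inr] alg_hom_l3)+

lemma commuting_cd:
  "commuting c1 c2" "commuting c1 c3" "commuting c1 d1" "commuting c1 d2" "commuting c1 d3"
  "commuting c2 c1" "commuting c2 c3" "commuting c2 d1" "commuting c2 d2" "commuting c2 d3"
  "commuting c3 c1" "commuting c3 c2" "commuting c3 d1" "commuting c3 d2" "commuting c3 d3"
  "commuting d1 c1" "commuting d1 c2" "commuting d1 c3" "commuting d1 d2" "commuting d1 d3"
  "commuting d2 c1" "commuting d2 c2" "commuting d2 c3" "commuting d2 d1" "commuting d2 d3"
  "commuting d3 c1" "commuting d3 c2" "commuting d3 c3" "commuting d3 d1" "commuting d3 d2"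
  by (auto simp: commuting_def c1_def c2_def c3_def d1_def d2_def d3_def l3_apply)

lemmas cd_apply = c1_def c2_def c3_def d1_def d2_def d3_def l3_apply

context quasi_hopf_algebra
begin

lemma self_data: "antipode_data (\<lambda>x. x) S \<alpha> \<beta>"
  unfolding antipode_data_def left_data_def right_data_def
  using antipode_antihom antipode_coassociator antipode_coassociator_inv antipode_left antipode_right
  by (auto simp: alg_hom_def lin)

lemma antipode_data_compose:
  assumes d: "antipode_data f \<sigma> a b" and g: "alg_hom g"
  shows "antipode_data (\<lambda>x. g (f x)) (\<lambda>x. g (\<sigma> x)) (g a) (g b)"
proof -
  note ga = additive_tlift[OF alg_hom_additive[OF g], symmetric]
    additive_tlift3[OF alg_hom_additive[OF g], symmetric]
  have "alg_antihom (\<lambda>x. g (\<sigma> x))"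
    using d g by (auto simp: antipode_data_def left_data_def alg_antihom_def alg_hom_def
        intro: clinear_compose)
  moreover have "alg_hom (\<lambda>x. g (f x))"
    using d g by (auto simp: antipode_data_def left_data_def intro: alg_hom_compose)
  ultimately show ?thesis
    using d by (simp add: antipode_data_def left_data_def right_data_def ga alg_hom_one[OF g]
        clinear_scaleC[OF alg_hom_clinear[OF g]] flip: alg_hom_mult[OF g])
qed

section \<open>The elements \<gamma> and \<delta> as values of functionals on the fourth tensor
  power\<close>

definition gamma_of :: "'h \<Rightarrow> 'h \<otimes> 'h \<otimes> 'h \<otimes> 'h \<Rightarrow> 'h \<otimes> 'h"
  where "gamma_of a = tlift4 (\<lambda>x y z w. (S y * a * z) \<otimes> (S x * a * w))"

text \<open>The parameter allows for the twisted \<beta>, which takes the place of \<beta> when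
  \<gamma> is conjugated.\<close>

definition delta_of :: "'h \<Rightarrow> 'h \<otimes> 'h \<otimes> 'h \<otimes> 'h \<Rightarrow> 'h \<otimes> 'h"
  where "delta_of b = tlift4 (\<lambda>x y z w. (x * b * S w) \<otimes> (y * b * S z))"

lemma gamma_of: "clinear (gamma_of a)" "gamma_of a (x \<otimes> y \<otimes> z \<otimes> w) = (S y * a * z) \<otimes> (S x * a * w)"
  unfolding gamma_of_def
  by (rule clinear_tlift4 tlift4_pure; intro lin clinear_compose[OF clinear_S])+

lemma delta_of: "clinear (delta_of b)" "delta_of b (x \<otimes> y \<otimes> z \<otimes> w) = (x * b * S w) \<otimes> (y * b * S z)"
  unfolding delta_of_def
  by (rule clinear_tlift4 tlift4_pure; intro lin clinear_compose[OF clinear_S])+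

lemma clinear_l4: "clinear (lift2 l41 l42)" "clinear (lift2 l43 l44)"
  by (simp_all add: clinear_lift2 alg_hom_clinear alg_hom_l4)

lemma reflect_S: "clinear (reflect S)" "reflect S (a \<otimes> b) = S b \<otimes> S a"
  "alg_antihom (reflect S)"
  by (simp_all add: clinear_reflect clinear_S reflect_pure alg_antihom_reflect antipode_antihom)

text \<open>S reverses products, so a right factor in legs 1 and 2 emerges on the left, flipped.
  This lemma and its three companions carry the coproducts around \<gamma> and \<delta> into the
  fourfold tensor, where quasi-coassociativity applies.\<close>

lemma gamma_of_mult1: "gamma_of a (t * lift2 l41 l42 u) = reflect S u * gamma_of a t"
proof (rule spanning_ext[OF spanning_pure4, of "\<lambda>t. gamma_of a (t * lift2 l41 l42 u)"])
  fix t :: "'h \<otimes> 'h \<otimes> 'h \<otimes> 'h" assume "t \<in> {x \<otimes> y \<otimes> z \<otimes> w |x y z w. True}"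
  then obtain x y z w where t: "t = x \<otimes> y \<otimes> z \<otimes> w" by blast
  show "gamma_of a (t * lift2 l41 l42 u) = reflect S u * gamma_of a t"
    unfolding t
    by (rule tensor_ext[of "\<lambda>u. gamma_of a ((x \<otimes> y \<otimes> z \<otimes> w) * lift2 l41 l42 u)"])
      (intro additive_clinear lin clinear_compose[OF gamma_of(1)] clinear_l4 reflect_S,
       intro additive_clinear lin clinear_compose[OF reflect_S(1)],
       simp add: lift2_pure alg_hom_clinear alg_hom_l4 l4_apply gamma_of reflect_S S_mult tensor_mult_tensor
         mult.assoc)
qed (intro additive_clinear lin clinear_compose[OF gamma_of(1)] gamma_of)+

lemma gamma_of_mult2: "gamma_of a (t * lift2 l43 l44 u) = gamma_of a t * u"
proof (rule spanning_ext[OF spanning_pure4, of "\<lambda>t. gamma_of a (t * lift2 l43 l44 u)"])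
  fix t :: "'h \<otimes> 'h \<otimes> 'h \<otimes> 'h" assume "t \<in> {x \<otimes> y \<otimes> z \<otimes> w |x y z w. True}"
  then obtain x y z w where t: "t = x \<otimes> y \<otimes> z \<otimes> w" by blast
  show "gamma_of a (t * lift2 l43 l44 u) = gamma_of a t * u"
    unfolding t
    by (rule tensor_ext[of "\<lambda>u. gamma_of a ((x \<otimes> y \<otimes> z \<otimes> w) * lift2 l43 l44 u)"])
      (intro additive_clinear lin clinear_compose[OF gamma_of(1)] clinear_l4 reflect_S,
       intro additive_clinear lin,
       simp add: lift2_pure alg_hom_clinear alg_hom_l4 l4_apply gamma_of tensor_mult_tensor mult.assoc)
qed (intro additive_clinear lin clinear_compose[OF gamma_of(1)] gamma_of)+

lemma delta_of_mult1: "delta_of b (lift2 l41 l42 u * t) = u * delta_of b t"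
proof (rule spanning_ext[OF spanning_pure4, of "\<lambda>t. delta_of b (lift2 l41 l42 u * t)"])
  fix t :: "'h \<otimes> 'h \<otimes> 'h \<otimes> 'h" assume "t \<in> {x \<otimes> y \<otimes> z \<otimes> w |x y z w. True}"
  then obtain x y z w where t: "t = x \<otimes> y \<otimes> z \<otimes> w" by blast
  show "delta_of b (lift2 l41 l42 u * t) = u * delta_of b t"
    unfolding t
    by (rule tensor_ext[of "\<lambda>u. delta_of b (lift2 l41 l42 u * (x \<otimes> y \<otimes> z \<otimes> w))"])
      (intro additive_clinear lin clinear_compose[OF delta_of(1)] clinear_l4 reflect_S,
       intro additive_clinear lin,
       simp add: lift2_pure alg_hom_clinear alg_hom_l4 l4_apply delta_of tensor_mult_tensor mult.assoc)
qed (intro additive_clinear lin clinear_compose[OF delta_of(1)] delta_of)+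

lemma delta_of_mult2: "delta_of b (lift2 l43 l44 u * t) = delta_of b t * reflect S u"
proof (rule spanning_ext[OF spanning_pure4, of "\<lambda>t. delta_of b (lift2 l43 l44 u * t)"])
  fix t :: "'h \<otimes> 'h \<otimes> 'h \<otimes> 'h" assume "t \<in> {x \<otimes> y \<otimes> z \<otimes> w |x y z w. True}"
  then obtain x y z w where t: "t = x \<otimes> y \<otimes> z \<otimes> w" by blast
  show "delta_of b (lift2 l43 l44 u * t) = delta_of b t * reflect S u"
    unfolding t
    by (rule tensor_ext[of "\<lambda>u. delta_of b (lift2 l43 l44 u * (x \<otimes> y \<otimes> z \<otimes> w))"])
      (intro additive_clinear lin clinear_compose[OF delta_of(1)] clinear_l4 reflect_S,
       intro additive_clinear lin clinear_compose[OF reflect_S(1)],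
       simp add: lift2_pure alg_hom_clinear alg_hom_l4 l4_apply delta_of reflect_S S_mult tensor_mult_tensor
         mult.assoc)
qed (intro additive_clinear lin clinear_compose[OF delta_of(1)] delta_of)+

definition gamma_tensor :: "'h \<otimes> 'h \<otimes> 'h \<otimes> 'h"
  where "gamma_tensor = phii l41 l42 l43 * phi (conv l41 l42) l43 l44"

definition gamma_tensor_inv :: "'h \<otimes> 'h \<otimes> 'h \<otimes> 'h"
  where "gamma_tensor_inv = phii (conv l41 l42) l43 l44 * phi l41 l42 l43"

definition "\<gamma> = gamma_of \<alpha> gamma_tensor"
definition "\<delta> = delta_of \<beta> gamma_tensor_inv"

text \<open>The two copies of \<alpha> stand between legs 2, 3 and between legs 1, 4; these are the
  pairs that an antipode axiom can remove.\<close>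

lemma gamma_of_kills: "lcong (gamma_of \<alpha>) (conv l42 l43) eta" "lcong (gamma_of \<alpha>) (conv l41 l44) eta"
proof -
  have l: "left_data \<Delta> (\<lambda>x. x) S \<alpha>" using self_data by (simp add: antipode_data_def)
  show "lcong (gamma_of \<alpha>) (conv l42 l43) eta"
    by (rule lcong_left_data4[OF l gamma_of(1), where g = "\<lambda>x y z w v. (S y * v * z) \<otimes> (S x * \<alpha> * w)"])
      (simp_all add: alg_hom_one alg_hom_l4 lin, simp add: l4_apply gamma_of S_mult mult.assoc)
  show "lcong (gamma_of \<alpha>) (conv l41 l44) eta"
    by (rule lcong_left_data4[OF l gamma_of(1), where g = "\<lambda>x y z w v. (S y * \<alpha> * z) \<otimes> (S x * v * w)"])
      (simp_all add: alg_hom_one alg_hom_l4 lin, simp add: l4_apply gamma_of S_mult mult.assoc)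
qed

lemma delta_of_kills: "rcong (delta_of \<beta>) (conv l42 l43) eta" "rcong (delta_of \<beta>) (conv l41 l44) eta"
proof -
  have r: "right_data \<Delta> (\<lambda>x. x) S \<beta>" using self_data by (simp add: antipode_data_def)
  show "rcong (delta_of \<beta>) (conv l42 l43) eta"
    by (rule rcong_right_data4[OF r delta_of(1), where g = "\<lambda>x y z w v. (x * \<beta> * S w) \<otimes> (y * v * S z)"])
      (simp_all add: alg_hom_one alg_hom_l4 lin, simp add: l4_apply delta_of S_mult mult.assoc)
  show "rcong (delta_of \<beta>) (conv l41 l44) eta"
    by (rule rcong_right_data4[OF r delta_of(1), where g = "\<lambda>x y z w v. (x * v * S w) \<otimes> (y * \<beta> * S z)"])
      (simp_all add: alg_hom_one alg_hom_l4 lin, simp add: l4_apply delta_of S_mult mult.assoc)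
qed

lemma reflect_coproduct:
  "alg_hom \<Delta>" "alg_antihom (\<lambda>h. reflect S (\<Delta> h))"
  using coproduct_hom reflect_S(3)
  by (auto simp: alg_hom_def alg_antihom_def intro: clinear_compose)

text \<open>The reason for the tensor behind \<gamma>: it rebrackets (12)(34), the form in which the
  coproducts arrive, as (1(23))4, where the removable pair 23 is nested inside the removable pair
  14.\<close>

lemma conv_gamma_tensor:
  "gamma_tensor * conv (conv l41 l42) (conv l43 l44) h = conv (conv l41 (conv l42 l43)) l44 h * gamma_tensor"
proof -
  note [simp] = l4 legs
  have "gamma_tensor * conv (conv l41 l42) (conv l43 l44) h
      = (phii l41 l42 l43 * conv (conv (conv l41 l42) l43) l44 h) * phi (conv l41 l42) l43 l44"
    by (simp add: gamma_tensor_def mult.assoc conv_coassoc)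
  also have "phii l41 l42 l43 * conv (conv (conv l41 l42) l43) l44 h
      = conv (conv l41 (conv l42 l43)) l44 h * phii l41 l42 l43"
    by (rule conv_intertwine[symmetric]) (simp_all add: conv_coassoc_inv phi_commute)
  finally show ?thesis by (simp add: gamma_tensor_def mult.assoc)
qed

lemma conv_gamma_tensor_inv:
  "conv (conv l41 l42) (conv l43 l44) h * gamma_tensor_inv = gamma_tensor_inv * conv (conv l41 (conv l42 l43)) l44 h"
proof -
  note [simp] = l4 legs
  have "conv (conv l41 l42) (conv l43 l44) h * gamma_tensor_inv
      = phii (conv l41 l42) l43 l44 * (conv (conv (conv l41 l42) l43) l44 h * phi l41 l42 l43)"
    by (simp add: gamma_tensor_inv_def conv_coassoc_inv flip: mult.assoc)
  also have "conv (conv (conv l41 l42) l43) l44 h * phi l41 l42 l43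
      = phi l41 l42 l43 * conv (conv l41 (conv l42 l43)) l44 h"
    by (rule conv_intertwine) (simp_all add: conv_coassoc phi_commute)
  finally show ?thesis by (simp add: gamma_tensor_inv_def mult.assoc)
qed

lemma left_data_gamma: "left_data \<Delta> \<Delta> (\<lambda>h. reflect S (\<Delta> h)) \<gamma>"
  unfolding left_data_def
proof (intro conjI allI reflect_coproduct)
  note [simp] = l4 legs conv_eta
  fix h
  note G = additive_clinear[OF gamma_of(1)]
  have "tlift (\<lambda>x y. reflect S (\<Delta> x) * \<gamma> * \<Delta> y) (\<Delta> h)
      = tlift (\<lambda>x y. gamma_of \<alpha> (gamma_tensor * (conv l41 l42 x * conv l43 l44 y))) (\<Delta> h)"
    by (simp add: \<gamma>_def conv_def gamma_of_mult1 gamma_of_mult2 flip: mult.assoc)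
  also have "\<dots> = gamma_of \<alpha> (gamma_tensor * conv (conv l41 l42) (conv l43 l44) h)"
    unfolding conv_def[of "conv l41 l42"] functional_lift2_right[OF G] ..
  also have "\<dots> = gamma_of \<alpha> (conv (conv l41 (conv l42 l43)) l44 h * gamma_tensor)"
    by (simp only: conv_gamma_tensor)
  also have "\<dots> = gamma_of \<alpha> (conv (conv l41 eta) l44 h * gamma_tensor)"
    by (rule lcongD[OF lcong_conv1[OF gamma_of(1) lcong_conv2[OF gamma_of(1) gamma_of_kills(1)]]]) simp_all
  also have "\<dots> = eps h *\<^sub>C \<gamma>"
    by (simp add: lcongD[OF gamma_of_kills(2)] eta_mult_left clinear_scaleC gamma_of \<gamma>_def)
  finally show "tlift (\<lambda>x y. reflect S (\<Delta> x) * \<gamma> * \<Delta> y) (\<Delta> h) = eps h *\<^sub>C \<gamma>" .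
qed

lemma right_data_delta: "right_data \<Delta> \<Delta> (\<lambda>h. reflect S (\<Delta> h)) \<delta>"
  unfolding right_data_def
proof (intro conjI allI reflect_coproduct)
  note [simp] = l4 legs conv_eta
  fix h
  note D = additive_clinear[OF delta_of(1)]
  have "tlift (\<lambda>x y. \<Delta> x * \<delta> * reflect S (\<Delta> y)) (\<Delta> h)
      = tlift (\<lambda>x y. delta_of \<beta> (conv l41 l42 x * conv l43 l44 y * gamma_tensor_inv)) (\<Delta> h)"
    by (simp add: \<delta>_def conv_def delta_of_mult1 delta_of_mult2 mult.assoc)
  also have "\<dots> = delta_of \<beta> (conv (conv l41 l42) (conv l43 l44) h * gamma_tensor_inv)"
    unfolding conv_def[of "conv l41 l42"] functional_lift2_left[OF D] ..
  also have "\<dots> = delta_of \<beta> (gamma_tensor_inv * conv (conv l41 (conv l42 l43)) l44 h)"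
    by (simp only: conv_gamma_tensor_inv)
  also have "\<dots> = delta_of \<beta> (gamma_tensor_inv * conv (conv l41 eta) l44 h)"
    by (rule rcongD[OF rcong_conv1[OF delta_of(1) rcong_conv2[OF delta_of(1) delta_of_kills(1)]]]) simp_all
  also have "\<dots> = eps h *\<^sub>C \<delta>"
    by (simp add: rcongD[OF delta_of_kills(2)] eta_mult_right clinear_scaleC delta_of \<delta>_def)
  finally show "tlift (\<lambda>x y. \<Delta> x * \<delta> * reflect S (\<Delta> y)) (\<Delta> h) = eps h *\<^sub>C \<delta>" .
qed

lemma lift2_l4_gamma_tensor:
  assumes "leg_list [p, q, r, s]"
  shows "lift2 p (lift2 q (lift2 r s)) gamma_tensor = phii p q r * phi (conv p q) r s"
    and "lift2 p (lift2 q (lift2 r s)) gamma_tensor_inv = phii (conv p q) r s * phi p q r"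
proof -
  note [simp] = assms[simplified] legs
  let ?L = "lift2 p (lift2 q (lift2 r s))"
  have L: "alg_hom ?L" by simp
  have a: "(\<lambda>x. ?L (l41 x)) = p" "(\<lambda>x. ?L (l42 x)) = q" "(\<lambda>x. ?L (l43 x)) = r" "(\<lambda>x. ?L (l44 x)) = s"
    by (auto simp: lift2_l4_apply alg_hom_one)
  have c: "(\<lambda>x. ?L (conv l41 l42 x)) = conv p q"
    by (rule ext) (simp add: alg_hom_conv_apply[OF L] a)
  show "?L gamma_tensor = phii p q r * phi (conv p q) r s"
    by (simp add: gamma_tensor_def alg_hom_mult[OF L] alg_hom_phi[OF L] alg_hom_phii[OF L] a c)
  show "?L gamma_tensor_inv = phii (conv p q) r s * phi p q r"
    by (simp add: gamma_tensor_inv_def alg_hom_mult[OF L] alg_hom_phi[OF L] alg_hom_phii[OF L] a c)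
qed

lemma lift2_l4_lift2:
  assumes "leg_list [p, q, r, s]"
  shows "lift2 p (lift2 q (lift2 r s)) (lift2 l41 l42 u) = lift2 p q u"
    and "lift2 p (lift2 q (lift2 r s)) (lift2 l43 l44 u) = lift2 r s u"
proof -
  note [simp] = assms[simplified] legs
  let ?L = "lift2 p (lift2 q (lift2 r s))"
  have L: "alg_hom ?L" by simp
  have a: "(\<lambda>x. ?L (l41 x)) = p" "(\<lambda>x. ?L (l42 x)) = q" "(\<lambda>x. ?L (l43 x)) = r" "(\<lambda>x. ?L (l44 x)) = s"
    by (auto simp: lift2_l4_apply alg_hom_one)
  show "?L (lift2 l41 l42 u) = lift2 p q u" "?L (lift2 l43 l44 u) = lift2 r s u"
    by (simp_all add: alg_hom_lift2_comp[OF L] a)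
qed

text \<open>The legs concerned are 1 in the other tensor factor, so a removal available for one
  functional survives tensoring with a second one.\<close>

lemma lcong_tmap:
  assumes e: "clinear e" "clinear e'" "lcong e (conv p q) eta"
  shows "lcong (tmap e e') (conv (\<lambda>x. inl (p x)) (\<lambda>x. inl (q x))) eta"
    and "lcong (tmap e' e) (conv (\<lambda>x. inr (p x)) (\<lambda>x. inr (q x))) eta"
proof -
  note cl = clinear_compose[OF clinear_tmap[OF e(1,2)]] clinear_compose[OF clinear_tmap[OF e(2,1)]]
  show "lcong (tmap e e') (conv (\<lambda>x. inl (p x)) (\<lambda>x. inl (q x))) eta"
    unfolding lcong_def
  proof (intro allI)
    fix h t
    show "tmap e e' (conv (\<lambda>x. inl (p x)) (\<lambda>x. inl (q x)) h * t) = tmap e e' (eta h * t)"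
      by (rule tensor_ext[of "\<lambda>t. tmap e e' (conv (\<lambda>x. inl (p x)) (\<lambda>x. inl (q x)) h * t)"])
        ((intro additive_clinear cl lin)+, unfold alg_hom_conv_apply[OF alg_hom_inl, symmetric],
         simp add: inl_def tensor_mult_tensor clinear_tmap_pure e lcongD[OF e(3)] eta_mult_left
           clinear_scaleC[OF clinear_tmap[OF e(1,2)]] clinear_scaleC[OF e(1)] tensor_scaleC_left)
  qed
  show "lcong (tmap e' e) (conv (\<lambda>x. inr (p x)) (\<lambda>x. inr (q x))) eta"
    unfolding lcong_def
  proof (intro allI)
    fix h t
    show "tmap e' e (conv (\<lambda>x. inr (p x)) (\<lambda>x. inr (q x)) h * t) = tmap e' e (eta h * t)"
      by (rule tensor_ext[of "\<lambda>t. tmap e' e (conv (\<lambda>x. inr (p x)) (\<lambda>x. inr (q x)) h * t)"])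
        ((intro additive_clinear cl lin)+, unfold alg_hom_conv_apply[OF alg_hom_inr, symmetric],
         simp add: inr_def tensor_mult_tensor clinear_tmap_pure e lcongD[OF e(3)] eta_mult_left
           clinear_scaleC[OF clinear_tmap[OF e(2,1)]] clinear_scaleC[OF e(1)] tensor_scaleC_right)
  qed
qed

lemma rcong_tmap:
  assumes e: "clinear e" "clinear e'" "rcong e (conv p q) eta"
  shows "rcong (tmap e e') (conv (\<lambda>x. inl (p x)) (\<lambda>x. inl (q x))) eta"
    and "rcong (tmap e' e) (conv (\<lambda>x. inr (p x)) (\<lambda>x. inr (q x))) eta"
proof -
  note cl = clinear_compose[OF clinear_tmap[OF e(1,2)]] clinear_compose[OF clinear_tmap[OF e(2,1)]]
  show "rcong (tmap e e') (conv (\<lambda>x. inl (p x)) (\<lambda>x. inl (q x))) eta"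
    unfolding rcong_def
  proof (intro allI)
    fix h t
    show "tmap e e' (t * conv (\<lambda>x. inl (p x)) (\<lambda>x. inl (q x)) h) = tmap e e' (t * eta h)"
      by (rule tensor_ext[of "\<lambda>t. tmap e e' (t * conv (\<lambda>x. inl (p x)) (\<lambda>x. inl (q x)) h)"])
        ((intro additive_clinear cl lin)+, unfold alg_hom_conv_apply[OF alg_hom_inl, symmetric],
         simp add: inl_def tensor_mult_tensor clinear_tmap_pure e rcongD[OF e(3)] eta_mult_right
           clinear_scaleC[OF clinear_tmap[OF e(1,2)]] clinear_scaleC[OF e(1)] tensor_scaleC_left)
  qed
  show "rcong (tmap e' e) (conv (\<lambda>x. inr (p x)) (\<lambda>x. inr (q x))) eta"
    unfolding rcong_def
  proof (intro allI)
    fix h t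
    show "tmap e' e (t * conv (\<lambda>x. inr (p x)) (\<lambda>x. inr (q x)) h) = tmap e' e (t * eta h)"
      by (rule tensor_ext[of "\<lambda>t. tmap e' e (t * conv (\<lambda>x. inr (p x)) (\<lambda>x. inr (q x)) h)"])
        ((intro additive_clinear cl lin)+, unfold alg_hom_conv_apply[OF alg_hom_inr, symmetric],
         simp add: inr_def tensor_mult_tensor clinear_tmap_pure e rcongD[OF e(3)] eta_mult_right
           clinear_scaleC[OF clinear_tmap[OF e(2,1)]] clinear_scaleC[OF e(1)] tensor_scaleC_right)
  qed
qed

lemma phi_cd: "phi c1 c2 c3 = inl \<Phi>" "phi d1 d2 d3 = inr \<Phi>"
  "phii c1 c2 c3 = inl (minv \<Phi>)" "phii d1 d2 d3 = inr (minv \<Phi>)"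
  unfolding c1_def[abs_def] c2_def[abs_def] c3_def[abs_def] d1_def[abs_def] d2_def[abs_def] d3_def[abs_def]
  by (simp_all add: phi_l3 flip: alg_hom_phi[OF alg_hom_inl] alg_hom_phi[OF alg_hom_inr]
      alg_hom_phii[OF alg_hom_inl] alg_hom_phii[OF alg_hom_inr])

text \<open>In each factor of H \<otimes> H the expression has the shape S(x) \<alpha> y \<beta>
  S(z), so the sum is a value of \<open>e\<close> \<otimes> \<open>e\<close> on six legs. The
  reduction leaves one \<Phi> in the d legs and one in the c legs, and the antipode axiom of H
  evaluates each to 1.\<close>

lemma gamma_delta_1:
  "tlift3 (\<lambda>x y z. reflect S (\<Delta> x) * \<gamma> * \<Delta> y * \<delta> * reflect S (\<Delta> z)) \<Phi> = 1"
proof -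
  have l: "left_data \<Delta> (\<lambda>x. x) S \<alpha>" and r: "right_data \<Delta> (\<lambda>x. x) S \<beta>"
    using self_data by (auto simp: antipode_data_def)
  define e where "e = tlift3 (\<lambda>x y z. S x * \<alpha> * y * \<beta> * S z)"
  note e = left_right_functional[OF l r e_def, unfolded conv_fun]
  define E where "E = tmap e e"
  have E: "clinear E" and E_pure: "E (a \<otimes> b) = e a \<otimes> e b" for a b
    unfolding E_def by (simp_all add: clinear_tmap clinear_tmap_pure e)
  have kills: "lcong E (conv c1 c2) eta" "lcong E (conv d1 d2) eta"
    "rcong E (conv c2 c3) eta" "rcong E (conv d2 d3) eta"
    unfolding E_def c1_def[abs_def] c2_def[abs_def] c3_def[abs_def] d1_def[abs_def]
      d2_def[abs_def] d3_def[abs_def]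
    by (rule lcong_tmap rcong_tmap; fact e)+
  have ls: "leg_list [d1, c1, c2, d2, d3, c3]"
    by (simp add: alg_hom_cd commuting_cd)
  note [simp] = alg_hom_cd commuting_cd legs
  let ?A = "lift2 d1 (lift2 c1 (lift2 c2 d2))" and ?B = "lift2 c2 (lift2 d2 (lift2 d3 c3))"
  have A: "alg_hom ?A" and B: "alg_hom ?B" by simp_all
  \<comment> \<open>The legs \<open>c2\<close> and \<open>d2\<close> are shared by \<open>?A\<close>
    and \<open>?B\<close>: there the last two slots of the tensor for \<gamma> multiply the first
    two of the tensor for \<delta>.\<close>
  have split: "gamma_of \<alpha> t * delta_of \<beta> s = E (?A t * ?B s)" for t s
  proof (rule spanning_ext[OF spanning_pure4, of "\<lambda>t. gamma_of \<alpha> t * delta_of \<beta> s"])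
    fix t :: "'h \<otimes> 'h \<otimes> 'h \<otimes> 'h" assume "t \<in> {x \<otimes> y \<otimes> z \<otimes> w |x y z w. True}"
    then obtain x y z w where t: "t = x \<otimes> y \<otimes> z \<otimes> w" by blast
    show "gamma_of \<alpha> t * delta_of \<beta> s = E (?A t * ?B s)"
    proof (rule spanning_ext[OF spanning_pure4, of "\<lambda>s. gamma_of \<alpha> t * delta_of \<beta> s"])
      fix s :: "'h \<otimes> 'h \<otimes> 'h \<otimes> 'h" assume "s \<in> {x \<otimes> y \<otimes> z \<otimes> w |x y z w. True}"
      then obtain x' y' z' w' where s: "s = x' \<otimes> y' \<otimes> z' \<otimes> w'" by blast
      show "gamma_of \<alpha> t * delta_of \<beta> s = E (?A t * ?B s)"
        unfolding t s by (simp add: lift2_pure alg_hom_clinear)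
          (simp add: cd_apply E_pure e gamma_of delta_of mult.assoc)
    qed (intro additive_clinear lin clinear_compose[OF E] delta_of clinear_compose[OF alg_hom_clinear[OF B]])+
  qed (intro additive_clinear lin clinear_compose[OF E] gamma_of clinear_compose[OF alg_hom_clinear[OF A]])+
  have g: "?A gamma_tensor = phii d1 c1 c2 * phi (conv d1 c1) c2 d2"
    and d: "?B gamma_tensor_inv = phii (conv c2 d2) d3 c3 * phi c2 d2 d3"
    by (rule lift2_l4_gamma_tensor; simp)+
  have "reflect S (\<Delta> x) * \<gamma> * \<Delta> y * \<delta> * reflect S (\<Delta> z)
      = E (?A gamma_tensor * (conv d1 c1 x * (conv c2 d2 y * conv d3 c3 z)) * ?B gamma_tensor_inv)" for x y z
  proof -
    have "reflect S (\<Delta> x) * \<gamma> * \<Delta> y * \<delta> * reflect S (\<Delta> z)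
      = gamma_of \<alpha> (gamma_tensor * lift2 l41 l42 (\<Delta> x)) * delta_of \<beta> (lift2 l41 l42 (\<Delta> y) * (lift2 l43 l44 (\<Delta> z) * gamma_tensor_inv))"
      by (simp add: gamma_of_mult1 delta_of_mult1 delta_of_mult2 \<gamma>_def \<delta>_def mult.assoc)
    also have "\<dots> = E (?A gamma_tensor * (conv d1 c1 x * (conv c2 d2 y * conv d3 c3 z)) * ?B gamma_tensor_inv)"
      by (simp add: split alg_hom_mult[OF A] alg_hom_mult[OF B] lift2_l4_lift2 conv_def mult.assoc)
    finally show ?thesis .
  qed
  then have "tlift3 (\<lambda>x y z. reflect S (\<Delta> x) * \<gamma> * \<Delta> y * \<delta> * reflect S (\<Delta> z)) \<Phi>
      = E (?A gamma_tensor * phi (conv d1 c1) (conv c2 d2) (conv d3 c3) * ?B gamma_tensor_inv)"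
    using functional_phi[of "\<lambda>t. E (?A gamma_tensor * t * ?B gamma_tensor_inv)" "conv d1 c1" "conv c2 d2" "conv d3 c3"]
    by (simp add: clinear_compose[OF E] lin)
  also have "\<dots> = E (phi d1 d2 d3 * phi c1 c2 c3)"
    unfolding g d by (rule six_legs[OF E ls kills(1,2,4,3)])
  also have "\<dots> = 1"
    using antipode_coassociator
    by (simp add: phi_cd inl_def inr_def tensor_mult_tensor E_pure e_def) (simp add: one_tensor_def)
  finally show ?thesis .
qed

lemma gamma_delta_2:
  "tlift3 (\<lambda>x y z. \<Delta> x * \<delta> * reflect S (\<Delta> y) * \<gamma> * \<Delta> z) (minv \<Phi>) = 1"
proof -
  have l: "left_data \<Delta> (\<lambda>x. x) S \<alpha>" and r: "right_data \<Delta> (\<lambda>x. x) S \<beta>"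
    using self_data by (auto simp: antipode_data_def)
  define e where "e = tlift3 (\<lambda>x y z. x * \<beta> * S y * \<alpha> * z)"
  note e = right_left_functional[OF r l e_def, unfolded conv_fun]
  define E where "E = tmap e e"
  have E: "clinear E" and E_pure: "E (a \<otimes> b) = e a \<otimes> e b" for a b
    unfolding E_def by (simp_all add: clinear_tmap clinear_tmap_pure e)
  have kills: "rcong E (conv c1 c2) eta" "rcong E (conv d1 d2) eta"
    "lcong E (conv c2 c3) eta" "lcong E (conv d2 d3) eta"
    unfolding E_def c1_def[abs_def] c2_def[abs_def] c3_def[abs_def] d1_def[abs_def]
      d2_def[abs_def] d3_def[abs_def]
    by (rule lcong_tmap rcong_tmap; fact e)+
  have ls: "leg_list [c1, d1, d2, c2, c3, d3]"
    by (simp add: alg_hom_cd commuting_cd)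
  note [simp] = alg_hom_cd commuting_cd legs
  let ?A = "lift2 d2 (lift2 c2 (lift2 c3 d3))" and ?B = "lift2 c1 (lift2 d1 (lift2 d2 c2))"
  have A: "alg_hom ?A" and B: "alg_hom ?B" by simp_all
  \<comment> \<open>The shared slots now stand under S, which reverses their product; hence the
    tensor for \<gamma> is on the left although \<gamma> follows \<delta>.\<close>
  have split: "delta_of \<beta> s * gamma_of \<alpha> t = E (?A t * ?B s)" for t s
  proof (rule spanning_ext[OF spanning_pure4, of "\<lambda>t. delta_of \<beta> s * gamma_of \<alpha> t"])
    fix t :: "'h \<otimes> 'h \<otimes> 'h \<otimes> 'h" assume "t \<in> {x \<otimes> y \<otimes> z \<otimes> w |x y z w. True}"
    then obtain x y z w where t: "t = x \<otimes> y \<otimes> z \<otimes> w" by blast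
    show "delta_of \<beta> s * gamma_of \<alpha> t = E (?A t * ?B s)"
    proof (rule spanning_ext[OF spanning_pure4, of "\<lambda>s. delta_of \<beta> s * gamma_of \<alpha> t"])
      fix s :: "'h \<otimes> 'h \<otimes> 'h \<otimes> 'h" assume "s \<in> {x \<otimes> y \<otimes> z \<otimes> w |x y z w. True}"
      then obtain x' y' z' w' where s: "s = x' \<otimes> y' \<otimes> z' \<otimes> w'" by blast
      show "delta_of \<beta> s * gamma_of \<alpha> t = E (?A t * ?B s)"
        unfolding t s by (simp add: lift2_pure alg_hom_clinear)
          (simp add: cd_apply E_pure e gamma_of delta_of S_mult tensor_mult_tensor mult.assoc)
    qed (intro additive_clinear lin clinear_compose[OF E] delta_of clinear_compose[OF alg_hom_clinear[OF B]])+
  qed (intro additive_clinear lin clinear_compose[OF E] gamma_of clinear_compose[OF alg_hom_clinear[OF A]])+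
  have g: "?A gamma_tensor = phii d2 c2 c3 * phi (conv d2 c2) c3 d3"
    and d: "?B gamma_tensor_inv = phii (conv c1 d1) d2 c2 * phi c1 d1 d2"
    by (rule lift2_l4_gamma_tensor; simp)+
  have "\<Delta> x * \<delta> * reflect S (\<Delta> y) * \<gamma> * \<Delta> z
      = E (?A gamma_tensor * (conv c1 d1 x * (conv d2 c2 y * conv c3 d3 z)) * ?B gamma_tensor_inv)" for x y z
  proof -
    have "\<Delta> x * \<delta> * reflect S (\<Delta> y) * \<gamma> * \<Delta> z
      = delta_of \<beta> (lift2 l41 l42 (\<Delta> x) * gamma_tensor_inv) * gamma_of \<alpha> (gamma_tensor * lift2 l41 l42 (\<Delta> y) * lift2 l43 l44 (\<Delta> z))"
      by (simp add: gamma_of_mult1 gamma_of_mult2 delta_of_mult1 \<gamma>_def \<delta>_def flip: mult.assoc)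
    also have "\<dots> = E (?A gamma_tensor * (conv d2 c2 y * conv c3 d3 z * conv c1 d1 x) * ?B gamma_tensor_inv)"
      by (simp add: split alg_hom_mult[OF A] alg_hom_mult[OF B] lift2_l4_lift2 conv_def mult.assoc)
    also have "conv d2 c2 y * conv c3 d3 z * conv c1 d1 x = conv c1 d1 x * (conv d2 c2 y * conv c3 d3 z)"
      by (rule commute_mult[symmetric]; rule commutingD; simp)
    finally show ?thesis .
  qed
  then have "tlift3 (\<lambda>x y z. \<Delta> x * \<delta> * reflect S (\<Delta> y) * \<gamma> * \<Delta> z) (minv \<Phi>)
      = E (?A gamma_tensor * phii (conv c1 d1) (conv d2 c2) (conv c3 d3) * ?B gamma_tensor_inv)"
    using functional_phii[of "\<lambda>t. E (?A gamma_tensor * t * ?B gamma_tensor_inv)" "conv c1 d1" "conv d2 c2" "conv c3 d3"]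
    by (simp add: clinear_compose[OF E] lin)
  also have "\<dots> = E (phii d1 d2 d3 * phii c1 c2 c3)"
    unfolding g d by (rule six_legs_mirror[OF E ls kills(2,1,3,4)])
  also have "\<dots> = 1"
    using antipode_coassociator_inv
    by (simp add: phi_cd inl_def inr_def tensor_mult_tensor E_pure e_def) (simp add: one_tensor_def)
  finally show ?thesis .
qed

section \<open>The Drinfeld twist as a comparison element\<close>

lemma drinfeld_data: "antipode_data \<Delta> (\<lambda>h. reflect S (\<Delta> h)) \<gamma> \<delta>"
  by (simp add: antipode_data_def left_data_gamma right_data_delta gamma_delta_1 gamma_delta_2)

lemma coproduct_data: "antipode_data \<Delta> (\<lambda>h. \<Delta> (S h)) (\<Delta> \<alpha>) (\<Delta> \<beta>)"
  using antipode_data_compose[OF self_data coproduct_hom] .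

lemma drinfeld_gamma_eq: "drinfeld_gamma \<Delta> \<Phi> S \<alpha> = \<gamma>"
proof -
  note [simp] = l4 legs
  have \<Delta>: "clinear \<Delta>" using coproduct_hom by (simp add: alg_hom_clinear)
  let ?L = "lift2 l41 (lift2 l42 (lift2 l43 l44)) :: 'h \<otimes> 'h \<otimes> 'h \<otimes> 'h \<Rightarrow> _"
  have ta: "clinear (tassoc :: ('h \<otimes> 'h) \<otimes> 'h \<Rightarrow> 'h \<otimes> 'h \<otimes> 'h)" by (rule clinear_tassoc)
  have "?L (tassoc (tmap \<Delta> id \<Phi>)) = phi (conv l41 l42) l43 l44"
    by (simp add: lift2_tmap lift2_tassoc \<Delta> lin id_def phi_def flip: conv_def)
  moreover have "?L (tmap id tassoc (tassoc (minv \<Phi> \<otimes> 1))) = phii l41 l42 l43"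
    by (simp add: lift2_tmap lift2_tassoc lift2_pure lin ta id_def phii_def alg_hom_one)
  ultimately show ?thesis
    by (simp add: drinfeld_gamma_def \<gamma>_def gamma_of_def gamma_tensor_def lift2_l4)
qed

definition "F = drinfeld_twist \<Delta> \<Phi> S \<alpha> \<beta>"

lemma drinfeld_twist_eq_comparison:
  "F = comparison \<Delta> (\<lambda>h. reflect S (\<Delta> h)) \<gamma> (\<Delta> \<beta>) (\<lambda>h. \<Delta> (S h))"
  by (simp add: F_def drinfeld_twist_def comparison_def drinfeld_gamma_eq reflect_def
      alg_hom_mult[OF coproduct_hom] mult.assoc)

lemma F_unique:
  "(\<And>h. v * \<Delta> (S h) = reflect S (\<Delta> h) * v) \<Longrightarrow> v * \<Delta> \<alpha> = \<gamma> \<Longrightarrow> v = F"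
  unfolding drinfeld_twist_eq_comparison by (rule comparison_unique[OF coproduct_data])

lemma F_coproduct: "reflect S (\<Delta> h) * F = F * \<Delta> (S h)"
  unfolding drinfeld_twist_eq_comparison using coproduct_data drinfeld_data
  by (intro comparison_intertwines) (auto simp: antipode_data_def)

text \<open>This gives access to the inverse of the twist: \<delta> = \<Delta>(\<beta>) F^-1 is what
  turns the conjugate of \<gamma> into an expression in F^-1.\<close>

lemma F_delta: "\<delta> * F = \<Delta> \<beta>"
  unfolding drinfeld_twist_eq_comparison using coproduct_data drinfeld_data
  by (intro comparison_right) (auto simp: antipode_data_def)

lemma minvertible_F: "minvertible F"
  using comparison_inverse[OF coproduct_data drinfeld_data] comparison_inverse[OF drinfeld_data coproduct_data]
  unfolding minvertible_def drinfeld_twist_eq_comparison by blast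

end

section \<open>Conjugations\<close>

lemma additive_compose: "additive F \<Longrightarrow> additive G \<Longrightarrow> additive (\<lambda>x. F (G x))"
  by (simp add: additive_def)

lemma conjugationD:
  assumes "conjugation_operation c"
  shows "semilinear cnj c" "additive c" "c (c x) = x" "c (x * y) = c y * c x" "c 1 = 1"
proof -
  show "semilinear cnj c" "additive c" and inv: "c (c x) = x" and mult: "c (x * y) = c y * c x" for x y
    using assms by (simp_all add: conjugation_operation_def semilinear_def additive_def)
  show "c 1 = 1" using mult[of "c 1" 1] inv[of 1] by (simp add: inv)
qed

lemma conjugation_tmap:
  fixes c :: "'a::complex_algebra_1 \<Rightarrow> 'a" and e :: "'b::complex_algebra_1 \<Rightarrow> 'b"
  assumes c: "conjugation_operation c" and e: "conjugation_operation e"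
  shows "conjugation_operation (tmap c e)"
proof -
  note sl = semilinear_tmap[OF conjugationD(1)[OF c] conjugationD(1)[OF e]]
  note pure = tmap_pure[OF conjugationD(1)[OF c] conjugationD(1)[OF e]]
  have add: "additive (tmap c e)" using sl by (simp add: semilinear_def)
  have inv: "tmap c e (tmap c e t) = t" for t
    by (rule tensor_ext[of "\<lambda>t. tmap c e (tmap c e t)" "\<lambda>t. t"])
      (auto simp: pure conjugationD(3)[OF c] conjugationD(3)[OF e] additive_def additive.add[OF add])
  have 1: "tmap c e ((a \<otimes> b) * (a' \<otimes> b')) = tmap c e (a' \<otimes> b') * tmap c e (a \<otimes> b)" for a b a' b'
    by (simp add: tensor_mult_tensor pure conjugationD(4)[OF c] conjugationD(4)[OF e])
  have 2: "tmap c e ((a \<otimes> b) * u) = tmap c e u * tmap c e (a \<otimes> b)" for a b u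
    by (rule tensor_ext[of "\<lambda>u. tmap c e ((a \<otimes> b) * u)"])
      (simp_all add: 1 additive_compose[OF add additive_mult_left] additive_compose[OF additive_mult_right add])
  have "tmap c e (t * u) = tmap c e u * tmap c e t" for t u
    by (rule tensor_ext[of "\<lambda>t. tmap c e (t * u)"])
      (simp_all add: 2 additive_compose[OF add additive_mult_right] additive_compose[OF additive_mult_left add])
  with sl inv show ?thesis
    by (simp add: conjugation_operation_def semilinear_def additive_def)
qed

lemma conjugation_minv:
  assumes c: "conjugation_operation c" and x: "minvertible x"
  shows "c (minv x) * c x = 1" "c x * c (minv x) = 1" "minv (c x) = c (minv x)"
proof -
  show "c (minv x) * c x = 1" "c x * c (minv x) = 1"
    using x by (simp_all add: minvertible_minv conjugationD(5)[OF c] flip: conjugationD(4)[OF c])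
  then show "minv (c x) = c (minv x)" by (intro minv_eqI)
qed

text \<open>The conjugation reverses the two factors, and commutation of the target legs restores
  their order.\<close>

lemma conjugation_lift2:
  assumes c: "conjugation_operation c" and e: "semilinear cnj e" "semilinear cnj e'"
    and lin: "clinear p" "clinear q" "clinear p'" "clinear q'"
    and p: "\<And>a. c (p a) = p' (e a)" and q: "\<And>b. c (q b) = q' (e' b)" and pq: "commuting p' q'"
  shows "c (lift2 p q t) = lift2 p' q' (tmap e e' t)"
proof (rule tensor_ext[of "\<lambda>t. c (lift2 p q t)"])
  have "additive (tmap e e')" using semilinear_tmap[OF e] by (simp add: semilinear_def)
  then show "additive (\<lambda>t. lift2 p' q' (tmap e e' t))"
    by (rule additive_compose[OF additive_lift2[OF lin(3,4)]])
  show "additive (\<lambda>t. c (lift2 p q t))"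
    by (rule additive_compose[OF conjugationD(2)[OF c] additive_lift2[OF lin(1,2)]])
  show "c (lift2 p q (a \<otimes> b)) = lift2 p' q' (tmap e e' (a \<otimes> b))" for a b
    unfolding lift2_pure[OF lin(1,2)] conjugationD(4)[OF c] p q tmap_pure[OF e] lift2_pure[OF lin(3,4)]
    by (rule commutingD[OF pq, symmetric])
qed

lemma cbilinear_mult: "cbilinear ((*) :: 'a::complex_algebra_1 \<Rightarrow> _)"
  by (intro cbilinearI lin)

section \<open>The conjugate antipode and the canonical element\<close>

text \<open>The map m(1 \<otimes> a)(\<sigma> \<otimes> 1); the twisted \<alpha> is its value at the
  inverse of the twist. \<open>right_sum\<close> plays the same part for \<beta>, at the twist
  itself.\<close>

definition left_sum :: "('h::complex_algebra_1 \<Rightarrow> 'h) \<Rightarrow> 'h \<Rightarrow> 'h \<otimes> 'h \<Rightarrow> 'h"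
  where "left_sum \<sigma> a = tlift (\<lambda>x y. \<sigma> x * a * y)"

definition right_sum :: "('h::complex_algebra_1 \<Rightarrow> 'h) \<Rightarrow> 'h \<Rightarrow> 'h \<otimes> 'h \<Rightarrow> 'h"
  where "right_sum \<sigma> b = tlift (\<lambda>x y. x * b * \<sigma> y)"

context
  fixes \<sigma> :: "'h::complex_algebra_1 \<Rightarrow> 'h"
  assumes \<sigma>: "alg_antihom \<sigma>"
begin

lemma left_sum: "clinear (left_sum \<sigma> a)" "left_sum \<sigma> a (x \<otimes> y) = \<sigma> x * a * y" "left_sum \<sigma> a 1 = a"
proof -
  have "cbilinear (\<lambda>x y. \<sigma> x * a * y)"
    by (intro cbilinearI lin clinear_compose[OF alg_antihom_clinear[OF \<sigma>]])
  then show "clinear (left_sum \<sigma> a)" and 1: "left_sum \<sigma> a (x \<otimes> y) = \<sigma> x * a * y" for x y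
    unfolding left_sum_def by (rule clinear_tlift tlift_pure)+
  show "left_sum \<sigma> a 1 = a" by (simp add: one_tensor_def 1 alg_antihom_one[OF \<sigma>])
qed

lemma right_sum: "clinear (right_sum \<sigma> b)" "right_sum \<sigma> b (x \<otimes> y) = x * b * \<sigma> y" "right_sum \<sigma> b 1 = b"
proof -
  have "cbilinear (\<lambda>x y. x * b * \<sigma> y)"
    by (intro cbilinearI lin clinear_compose[OF alg_antihom_clinear[OF \<sigma>]])
  then show "clinear (right_sum \<sigma> b)" and 1: "right_sum \<sigma> b (x \<otimes> y) = x * b * \<sigma> y" for x y
    unfolding right_sum_def by (rule clinear_tlift tlift_pure)+
  show "right_sum \<sigma> b 1 = b" by (simp add: one_tensor_def 1 alg_antihom_one[OF \<sigma>])
qed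

text \<open>Since \<sigma> reverses products, H \<otimes> H acts on the candidates for \<alpha> from
  the right. In particular the effect of \<Omega> is undone by its inverse.\<close>

lemma left_sum_left_sum: "left_sum \<sigma> (left_sum \<sigma> a v) u = left_sum \<sigma> a (v * u)"
proof -
  have "left_sum \<sigma> (left_sum \<sigma> a v) (x \<otimes> y) = left_sum \<sigma> a (v * (x \<otimes> y))" for x y
    unfolding left_sum(2)
    by (rule tensor_ext[of "\<lambda>v. \<sigma> x * left_sum \<sigma> a v * y"])
      ((intro additive_clinear lin clinear_compose[OF left_sum(1)])+,
       simp add: left_sum tensor_mult_tensor alg_antihom_mult[OF \<sigma>] mult.assoc)
  then show ?thesis
    by (rule tensor_ext[of "left_sum \<sigma> (left_sum \<sigma> a v)", rotated 2])
      (intro additive_clinear left_sum(1) clinear_compose[OF left_sum(1)] lin)+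
qed

lemma right_sum_right_sum: "right_sum \<sigma> (right_sum \<sigma> b v) u = right_sum \<sigma> b (u * v)"
proof -
  have "right_sum \<sigma> (right_sum \<sigma> b v) (x \<otimes> y) = right_sum \<sigma> b ((x \<otimes> y) * v)" for x y
    unfolding right_sum(2)
    by (rule tensor_ext[of "\<lambda>v. x * right_sum \<sigma> b v * \<sigma> y"])
      ((intro additive_clinear lin clinear_compose[OF right_sum(1)])+,
       simp add: right_sum tensor_mult_tensor alg_antihom_mult[OF \<sigma>] mult.assoc)
  then show ?thesis
    by (rule tensor_ext[of "right_sum \<sigma> (right_sum \<sigma> b v)", rotated 2])
      (intro additive_clinear right_sum(1) clinear_compose[OF right_sum(1)] lin)+
qed

lemma twisted_alpha_left_sum: "twisted_alpha t \<sigma> a = left_sum \<sigma> a (minv t)"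
proof -
  note [simp] = alg_antihom_clinear[OF \<sigma>]
  have id: "clinear (id :: 'h \<Rightarrow> 'h)" by (simp add: id_def lin)
  have "tlift (*) ((1 \<otimes> a) * tmap \<sigma> id u) = left_sum \<sigma> a u" for u
    by (rule tensor_ext[of "\<lambda>u. tlift (*) ((1 \<otimes> a) * tmap \<sigma> id u)"])
      (auto intro!: additive_clinear clinear_compose[OF clinear_tlift[OF cbilinear_mult]] lin
        clinear_tmap id simp: left_sum clinear_tmap_pure id tensor_mult_tensor tlift_pure cbilinear_mult mult.assoc)
  then show ?thesis by (simp add: twisted_alpha_def)
qed

lemma twisted_beta_right_sum: "twisted_beta t \<sigma> b = right_sum \<sigma> b t"
proof -
  note [simp] = alg_antihom_clinear[OF \<sigma>]
  have id: "clinear (id :: 'h \<Rightarrow> 'h)" by (simp add: id_def lin)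
  have "tlift (*) ((1 \<otimes> b) * tmap id \<sigma> u) = right_sum \<sigma> b u" for u
    by (rule tensor_ext[of "\<lambda>u. tlift (*) ((1 \<otimes> b) * tmap id \<sigma> u)"])
      (auto intro!: additive_clinear clinear_compose[OF clinear_tlift[OF cbilinear_mult]] lin
        clinear_tmap id simp: right_sum clinear_tmap_pure id tensor_mult_tensor tlift_pure cbilinear_mult mult.assoc)
  then show ?thesis by (simp add: twisted_beta_def)
qed

end

context quasi_hopf_star_algebra
begin

abbreviation "dag2 \<equiv> tmap dag dag"
abbreviation "dag3 \<equiv> tmap dag dag2"
abbreviation "dag4 \<equiv> tmap dag dag3"
abbreviation "Si \<equiv> inv S"
abbreviation "St \<equiv> conj_antipode S dag"
abbreviation "\<Omega>i \<equiv> minv \<Omega>"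
abbreviation "\<alpha>t \<equiv> dag (Si \<beta>)"
abbreviation "\<beta>t \<equiv> dag (Si \<alpha>)"

lemma conj2: "conjugation_operation dag2" and conj3: "conjugation_operation dag3"
  and conj4: "conjugation_operation dag4"
  by (intro conjugation_tmap conjugation)+

lemma dag: "dag (dag x) = x" "dag (x * y) = dag y * dag x" "dag 1 = 1"
  using conjugationD[OF conjugation] by auto

lemma S_Si: "S (Si x) = x" "Si (S x) = x"
  using antipode_bij by (simp_all add: bij_is_surj surj_f_inv_f bij_is_inj)

lemma Si: "alg_antihom Si" "clinear Si" "Si 1 = 1" "Si (x * y) = Si y * Si x"
proof -
  have "Si (x + y) = Si x + Si y" "Si (c *\<^sub>C x) = c *\<^sub>C Si x" "Si (x * y) = Si y * Si x" for x y c
    using clinear_add[OF clinear_S] clinear_scaleC[OF clinear_S] S_mult by (metis S_Si)+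
  moreover have "Si 1 = 1" by (metis S_one S_Si(2))
  ultimately show "alg_antihom Si" by (auto simp: alg_antihom_def intro: clinearI)
  then show "clinear Si" "Si 1 = 1" "Si (x * y) = Si y * Si x"
    by (simp_all add: alg_antihom_def)
qed

lemma clinear_dag_dag: "clinear f \<Longrightarrow> clinear (\<lambda>x. dag (f (dag x)))"
  using conjugationD(1)[OF conjugation]
  by (intro clinearI) (simp_all add: semilinear_def additive.add clinear_add clinear_scaleC)

lemma alg_antihom_St: "alg_antihom St"
  using Si by (simp add: alg_antihom_def conj_antipode_def[abs_def] clinear_dag_dag dag)

lemmas St_clinear = alg_antihom_clinear[OF alg_antihom_St]

lemma \<Omega>_inv: "\<Omega> * \<Omega>i = 1" "\<Omega>i * \<Omega> = 1"
  using canonical_twist by (simp_all add: is_twist_def minvertible_minv)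

text \<open>The coproduct for which \<open>St\<close>, \<open>\<alpha>t\<close>,
  \<open>\<beta>t\<close> satisfy the antipode axioms, because these are the conjugates of the
  original axioms. The star axiom identifies it with the twist of \<Delta> by \<Omega>.\<close>

definition conj_coproduct :: "'h \<Rightarrow> 'h \<otimes> 'h"
  where "conj_coproduct h = dag2 (\<Delta> (dag h))"

lemma conj_coproduct: "conj_coproduct h = \<Omega> * \<Delta> h * \<Omega>i"
  by (simp add: conj_coproduct_def coproduct_dag twisted_coproduct_def dag)

lemma clinear_conj_coproduct: "clinear conj_coproduct"
  using alg_hom_clinear[OF coproduct_hom] unfolding conj_coproduct[abs_def] by (intro lin)

lemma dag_additive: "additive dag" "additive dag2" "additive dag3"
  using conjugationD(2) conjugation conj2 conj3 by blast+

lemmas semilinear_dag = conjugationD(1)[OF conjugation] conjugationD(1)[OF conj2] conjugationD(1)[OF conj3]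

lemma dag_pure: "dag2 (x \<otimes> y) = dag x \<otimes> dag y" "dag3 (x \<otimes> y \<otimes> z) = dag x \<otimes> dag y \<otimes> dag z"
  "dag4 (x \<otimes> y \<otimes> z \<otimes> w) = dag x \<otimes> dag y \<otimes> dag z \<otimes> dag w"
  by (simp_all add: tmap_pure[OF semilinear_dag(1) semilinear_dag(1)] tmap_pure[OF semilinear_dag(1) semilinear_dag(2)] tmap_pure[OF semilinear_dag(1) semilinear_dag(3)])

text \<open>\<open>dag\<close> after \<open>Si\<close> is multiplicative and sends S(y) to the
  conjugate of y, so x \<beta> S(y) acquires the shape of the \<alpha> axiom. This is why
  \<open>\<alpha>t\<close> comes from \<beta> and \<open>\<beta>t\<close> from \<alpha>.\<close>

lemma left_sum_dag: "left_sum St \<alpha>t (dag2 u) = dag (Si (right_sum S \<beta> u))"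
  by (rule tensor_ext[of "\<lambda>u. left_sum St \<alpha>t (dag2 u)"])
    ((intro additive_compose[OF additive_clinear[OF left_sum(1)[OF alg_antihom_St]] dag_additive(2)]
       additive_compose[OF dag_additive(1)] additive_clinear clinear_compose[OF Si(2)]
       right_sum(1)[OF antipode_antihom])+,
     simp add: dag_pure left_sum[OF alg_antihom_St] right_sum[OF antipode_antihom] Si dag S_Si conj_antipode_def
       mult.assoc)

lemma right_sum_dag: "right_sum St \<beta>t (dag2 u) = dag (Si (left_sum S \<alpha> u))"
  by (rule tensor_ext[of "\<lambda>u. right_sum St \<beta>t (dag2 u)"])
    ((intro additive_compose[OF additive_clinear[OF right_sum(1)[OF alg_antihom_St]] dag_additive(2)]
       additive_compose[OF dag_additive(1)] additive_clinear clinear_compose[OF Si(2)]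
       left_sum(1)[OF antipode_antihom])+,
     simp add: dag_pure right_sum[OF alg_antihom_St] left_sum[OF antipode_antihom] Si dag S_Si conj_antipode_def
       mult.assoc)

lemma dag_scaleC: "dag (c *\<^sub>C x) = cnj c *\<^sub>C dag x"
  using conjugation by (simp add: conjugation_operation_def)

lemma left_data_conj_coproduct: "left_data conj_coproduct (\<lambda>x. x) St \<alpha>t"
proof -
  have "left_sum St \<alpha>t (conj_coproduct h) = eps h *\<^sub>C \<alpha>t" for h
    using antipode_right[of "dag h"]
    by (simp add: conj_coproduct_def left_sum_dag) (simp add: right_sum_def clinear_scaleC[OF Si(2)] dag_scaleC counit_dag)
  then show ?thesis by (simp add: left_data_def alg_antihom_St left_sum_def alg_hom_def lin)
qed

lemma right_data_conj_coproduct: "right_data conj_coproduct (\<lambda>x. x) St \<beta>t"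
proof -
  have "right_sum St \<beta>t (conj_coproduct h) = eps h *\<^sub>C \<beta>t" for h
    using antipode_left[of "dag h"]
    by (simp add: conj_coproduct_def right_sum_dag) (simp add: left_sum_def clinear_scaleC[OF Si(2)] dag_scaleC counit_dag)
  then show ?thesis by (simp add: right_data_def alg_antihom_St right_sum_def alg_hom_def lin)
qed

definition "e3 = tlift3 (\<lambda>x y z. St x * \<alpha>t * y * \<beta>t * St z)"
definition "k3 = tlift3 (\<lambda>x y z. x * \<beta>t * St y * \<alpha>t * z)"

lemmas e3 = left_right_functional[OF left_data_conj_coproduct right_data_conj_coproduct e3_def]
lemmas k3 = right_left_functional[OF right_data_conj_coproduct left_data_conj_coproduct k3_def]

text \<open>By the same mechanism x \<beta> S(y) \<alpha> z becomes the alternating expression of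
  the other kind; the axiom for the inverse of \<Phi> turns into one for its conjugate.\<close>

lemma e3_dag: "e3 (dag3 (minv \<Phi>)) = 1"
proof -
  have l: "left_data \<Delta> (\<lambda>x. x) S \<alpha>" and r: "right_data \<Delta> (\<lambda>x. x) S \<beta>"
    using self_data by (auto simp: antipode_data_def)
  define G where "G = tlift3 (\<lambda>x y z. x * \<beta> * S y * \<alpha> * z)"
  note k = right_left_functional[OF r l G_def]
  have "e3 (dag3 v) = dag (Si (G v))" for v
  proof (rule spanning_ext[OF spanning_pure3, of "\<lambda>v. e3 (dag3 v)"])
    show "additive (\<lambda>v. e3 (dag3 v))"
      by (rule additive_compose[OF additive_clinear[OF e3(1)] dag_additive(3)])
    show "additive (\<lambda>v. dag (Si (G v)))"
      by (rule additive_compose[OF dag_additive(1) additive_clinear[OF clinear_compose[OF Si(2) k(1)]]])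
  qed (auto simp: dag_pure e3(2) k(2) Si dag S_Si conj_antipode_def mult.assoc)
  then show ?thesis by (simp add: G_def antipode_coassociator_inv Si dag)
qed

lemma k3_dag: "k3 (dag3 \<Phi>) = 1"
proof -
  have l: "left_data \<Delta> (\<lambda>x. x) S \<alpha>" and r: "right_data \<Delta> (\<lambda>x. x) S \<beta>"
    using self_data by (auto simp: antipode_data_def)
  define G where "G = tlift3 (\<lambda>x y z. S x * \<alpha> * y * \<beta> * S z)"
  note k = left_right_functional[OF l r G_def]
  have "k3 (dag3 v) = dag (Si (G v))" for v
  proof (rule spanning_ext[OF spanning_pure3, of "\<lambda>v. k3 (dag3 v)"])
    show "additive (\<lambda>v. k3 (dag3 v))"
      by (rule additive_compose[OF additive_clinear[OF k3(1)] dag_additive(3)])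
    show "additive (\<lambda>v. dag (Si (G v)))"
      by (rule additive_compose[OF dag_additive(1) additive_clinear[OF clinear_compose[OF Si(2) k(1)]]])
  qed (auto simp: dag_pure k3(2) k(2) Si dag S_Si conj_antipode_def mult.assoc)
  then show ?thesis by (simp add: G_def antipode_coassociator Si dag)
qed

section \<open>The canonical twist in legs\<close>

definition om :: "('h \<Rightarrow> 'm::complex_algebra_1) \<Rightarrow> ('h \<Rightarrow> 'm) \<Rightarrow> 'm"
  where "om p q = lift2 p q \<Omega>"

definition omi :: "('h \<Rightarrow> 'm::complex_algebra_1) \<Rightarrow> ('h \<Rightarrow> 'm) \<Rightarrow> 'm"
  where "omi p q = lift2 p q \<Omega>i"

lemma om_inv:
  assumes "alg_hom p" "alg_hom q" "commuting p q"
  shows "om p q * omi p q = 1" "omi p q * om p q = 1"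
  unfolding om_def omi_def using alg_hom_lift2[OF assms]
  by (simp_all add: \<Omega>_inv alg_hom_one flip: alg_hom_mult)

lemma cancel_om:
  assumes "alg_hom p" "alg_hom q" "commuting p q"
  shows "om p q * (omi p q * x) = x" "omi p q * (om p q * x) = x"
  by (simp_all add: om_inv[OF assms] flip: mult.assoc)

lemma om_intertwine:
  assumes "\<And>h. p h * c = c * p' h" "\<And>h. q h * c = c * q' h"
  shows "om p q * c = c * om p' q'" "omi p q * c = c * omi p' q'"
  unfolding om_def omi_def by (intro lift2_intertwine assms)+

lemma om_eta:
  assumes "alg_hom p"
  shows "om p eta = 1" "om eta p = 1" "omi p eta = 1" "omi eta p = 1"
proof -
  note add = additive_tlift[OF additive_clinear[OF alg_hom_clinear[OF assms]]]
  note sc = clinear_scaleC[OF alg_hom_clinear[OF assms]]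
  have "lift2 eta p \<Omega> = p (counit_left eps \<Omega>)" "lift2 p eta \<Omega> = p (counit_right eps \<Omega>)"
    by (simp_all add: lift2_def counit_left_def counit_right_def add sc eta_mult_left eta_mult_right)
  then show 1: "om eta p = 1" "om p eta = 1"
    using canonical_twist by (simp_all add: is_twist_def om_def alg_hom_one assms)
  show "omi p eta = 1" "omi eta p = 1"
    using om_inv(1)[of p eta] om_inv(1)[of eta p] by (simp_all add: 1 legs assms)
qed

lemma dag3_phii:
  assumes "alg_hom p" "alg_hom q" "alg_hom r" "commuting p q" "commuting p r" "commuting q r"
  shows "lift2 p (lift2 q r) (dag3 (minv \<Phi>))
    = om p q * om (conv p q) r * phi p q r * omi p (conv q r) * omi q r" (is "?L _ = _")
    and "lift2 p (lift2 q r) (dag3 \<Phi>)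
    = om q r * om p (conv q r) * phii p q r * omi (conv p q) r * omi p q"
proof -
  note [simp] = assms legs
  have L: "alg_hom (lift2 p (lift2 q r))" by simp
  have \<Delta>: "clinear \<Delta>" using coproduct_hom by simp
  have "dag3 (minv \<Phi>) = twisted_coassociator \<Omega> \<Delta> \<Phi>"
    using conjugation_minv(3)[OF conj3 coassociator_invertible] coassociator_dag by simp
  then show 1: "lift2 p (lift2 q r) (dag3 (minv \<Phi>))
    = om p q * om (conv p q) r * phi p q r * omi p (conv q r) * omi q r"
    by (simp add: twisted_coassociator_def alg_hom_mult[OF L] lift2_tassoc lift2_tmap lift2_pure
        \<Delta> lin id_def alg_hom_one om_def omi_def phi_def flip: conv_def)
  have inv: "lift2 p (lift2 q r) (dag3 \<Phi>) * lift2 p (lift2 q r) (dag3 (minv \<Phi>)) = 1"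
    by (simp add: conjugation_minv[OF conj3 coassociator_invertible] alg_hom_one[OF L]
        flip: alg_hom_mult[OF L])
  let ?y = "om q r * om p (conv q r) * phii p q r * omi (conv p q) r * omi p q"
  have "lift2 p (lift2 q r) (dag3 \<Phi>) = lift2 p (lift2 q r) (dag3 \<Phi>) *
      ((om p q * om (conv p q) r * phi p q r * omi p (conv q r) * omi q r) * ?y)"
    by (simp add: mult.assoc cancel_om cancel_phi om_inv)
  also have "\<dots> = ?y" unfolding 1[symmetric] using inv by (simp flip: mult.assoc)
  finally show "lift2 p (lift2 q r) (dag3 \<Phi>) = ?y" .
qed

text \<open>Twisting the conjugate antipode data back by \<open>\<Omega>\<^sup>-\<^sup>1\<close> allows them to be compared with \<open>(S, \<alpha>, \<beta>)\<close>
  over \<open>(\<Delta>, \<Phi>)\<close>, so that no pentagon identity for \<open>\<Phi>\<^sub>\<Omega>\<close> is needed.\<close>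

definition "untwisted_alpha = left_sum St \<alpha>t \<Omega>"
definition "untwisted_beta = right_sum St \<beta>t \<Omega>i"

lemma lift2_conj_coproduct:
  assumes "alg_hom p" "alg_hom q" "commuting p q"
  shows "lift2 p q (conj_coproduct h) = om p q * conv p q h * omi p q"
  by (simp add: conj_coproduct alg_hom_mult[OF alg_hom_lift2[OF assms]] conv_def om_def omi_def)

text \<open>\<Omega> in legs 1, 2 acts on the \<alpha> between them and its inverse in legs 2, 3 on
  the \<beta> between them, which produces the untwisted elements.\<close>

lemma e3_mult: "e3 (om l31 l32 * t * omi l32 l33)
    = tlift3 (\<lambda>x y z. St x * untwisted_alpha * y * untwisted_beta * St z) t"
proof -
  note [simp] = alg_hom_clinear l3
  have c: "clinear (lift2 l31 l32)" "clinear (lift2 l32 l33)" by (simp_all add: clinear_lift2)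
  note nc = left_sum(1)[OF alg_antihom_St] and mc = right_sum(1)[OF alg_antihom_St]
  have tri: "clinear (\<lambda>x. St x * a * y * b * St z)" "clinear (\<lambda>y. St x * a * y * b * St z)"
    "clinear (\<lambda>z. St x * a * y * b * St z)" for a b x y z
    by (intro lin clinear_compose[OF St_clinear])+
  have 1: "e3 (lift2 l31 l32 u * (x \<otimes> y \<otimes> z)) = St x * left_sum St \<alpha>t u * y * \<beta>t * St z" for u x y z
    by (rule tensor_ext[of "\<lambda>u. e3 (lift2 l31 l32 u * (x \<otimes> y \<otimes> z))"])
      ((intro additive_clinear clinear_compose[OF e3(1)] clinear_compose[OF nc] lin c)+,
       simp add: lift2_pure, simp add: l3_apply e3(2) left_sum[OF alg_antihom_St]
         alg_antihom_mult[OF alg_antihom_St] mult.assoc)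
  have 2: "e3 (lift2 l31 l32 u * ((x \<otimes> y \<otimes> z) * lift2 l32 l33 v))
      = St x * left_sum St \<alpha>t u * y * right_sum St \<beta>t v * St z" for u v x y z
    by (rule tensor_ext[of "\<lambda>v. e3 (lift2 l31 l32 u * ((x \<otimes> y \<otimes> z) * lift2 l32 l33 v))"])
      ((intro additive_clinear clinear_compose[OF e3(1)] clinear_compose[OF mc] lin c)+,
       simp add: lift2_pure, simp add: l3_apply 1 right_sum[OF alg_antihom_St]
         alg_antihom_mult[OF alg_antihom_St] mult.assoc)
  show ?thesis
    unfolding om_def omi_def
    by (rule spanning_ext[OF spanning_pure3, of "\<lambda>t. e3 (lift2 l31 l32 \<Omega> * t * lift2 l32 l33 \<Omega>i)"])
      ((intro additive_clinear clinear_compose[OF e3(1)] lin clinear_tlift3[OF tri])+,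
       auto simp: 2 mult.assoc untwisted_alpha_def untwisted_beta_def tlift3_pure[OF tri, unfolded mult.assoc])
qed

lemma k3_mult: "k3 (om l32 l33 * t * omi l31 l32)
    = tlift3 (\<lambda>x y z. x * untwisted_beta * St y * untwisted_alpha * z) t"
proof -
  note [simp] = alg_hom_clinear l3
  have c: "clinear (lift2 l31 l32)" "clinear (lift2 l32 l33)" by (simp_all add: clinear_lift2)
  note nc = left_sum(1)[OF alg_antihom_St] and mc = right_sum(1)[OF alg_antihom_St]
  have tri: "clinear (\<lambda>x. x * b * St y * a * z)" "clinear (\<lambda>y. x * b * St y * a * z)"
    "clinear (\<lambda>z. x * b * St y * a * z)" for a b x y z
    by (intro lin clinear_compose[OF St_clinear])+
  have 1: "k3 (lift2 l32 l33 u * (x \<otimes> y \<otimes> z)) = x * \<beta>t * St y * left_sum St \<alpha>t u * z" for u x y z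
    by (rule tensor_ext[of "\<lambda>u. k3 (lift2 l32 l33 u * (x \<otimes> y \<otimes> z))"])
      ((intro additive_clinear clinear_compose[OF k3(1)] clinear_compose[OF nc] lin c)+,
       simp add: lift2_pure, simp add: l3_apply k3(2) left_sum[OF alg_antihom_St]
         alg_antihom_mult[OF alg_antihom_St] mult.assoc)
  have 2: "k3 (lift2 l32 l33 u * ((x \<otimes> y \<otimes> z) * lift2 l31 l32 v))
      = x * right_sum St \<beta>t v * St y * left_sum St \<alpha>t u * z" for u v x y z
    by (rule tensor_ext[of "\<lambda>v. k3 (lift2 l32 l33 u * ((x \<otimes> y \<otimes> z) * lift2 l31 l32 v))"])
      ((intro additive_clinear clinear_compose[OF k3(1)] clinear_compose[OF mc] lin c)+,
       simp add: lift2_pure, simp add: l3_apply 1 right_sum[OF alg_antihom_St]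
         alg_antihom_mult[OF alg_antihom_St] mult.assoc)
  show ?thesis
    unfolding om_def omi_def
    by (rule spanning_ext[OF spanning_pure3, of "\<lambda>t. k3 (lift2 l32 l33 \<Omega> * t * lift2 l31 l32 \<Omega>i)"])
      ((intro additive_clinear clinear_compose[OF k3(1)] lin clinear_tlift3[OF tri])+,
       auto simp: 2 mult.assoc untwisted_alpha_def untwisted_beta_def tlift3_pure[OF tri, unfolded mult.assoc])
qed

lemma om_conj_coproduct:
  assumes [simp]: "alg_hom p" "alg_hom q" "alg_hom r" "commuting p q" "commuting p r" "commuting q r"
  shows "lift2 (\<lambda>h. lift2 p q (conj_coproduct h)) r t * om p q = om p q * lift2 (conv p q) r t"
    and "omi q r * lift2 p (\<lambda>h. lift2 q r (conj_coproduct h)) t = lift2 p (conv q r) t * omi q r"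
proof -
  note [simp] = legs
  have c: "commuting r (lift2 p q)" "commuting p (lift2 q r)"
    by (simp_all add: commuting_sym[of p] commuting_sym[of q] commuting_lift2')
  show "lift2 (\<lambda>h. lift2 p q (conj_coproduct h)) r t * om p q = om p q * lift2 (conv p q) r t"
    by (rule lift2_intertwine)
      (simp add: lift2_conj_coproduct mult.assoc om_inv, simp add: om_def commutingD[OF c(1)])
  show "omi q r * lift2 p (\<lambda>h. lift2 q r (conj_coproduct h)) t = lift2 p (conv q r) t * omi q r"
    by (rule lift2_intertwine[symmetric])
      (simp add: omi_def commutingD[OF c(2)], simp add: lift2_conj_coproduct om_inv flip: mult.assoc)
qed

lemma conj_antipode_data: "antipode_data (\<lambda>x. x) St untwisted_alpha untwisted_beta"
proof -
  note A = alg_antihom_St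
  note [simp] = l3 legs
  have id: "alg_hom (\<lambda>x::'h. x)" by (simp add: alg_hom_def lin)
  have "left_sum St untwisted_alpha (\<Delta> h) = eps h *\<^sub>C untwisted_alpha" for h
  proof -
    have "left_sum St untwisted_alpha (\<Delta> h) = left_sum St \<alpha>t (conj_coproduct h * \<Omega>)"
      by (simp add: untwisted_alpha_def left_sum_left_sum[OF A] conj_coproduct mult.assoc \<Omega>_inv)
    also have "\<dots> = left_sum St (eps h *\<^sub>C \<alpha>t) \<Omega>"
      using left_data_conj_coproduct by (simp add: left_data_def flip: left_sum_left_sum[OF A] left_sum_def)
    finally show ?thesis
      by (simp add: untwisted_alpha_def left_sum_def mult_scaleC_left mult_scaleC_right additive_tlift[OF additive_scaleC])
  qed
  then have l: "left_data \<Delta> (\<lambda>x. x) St untwisted_alpha"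
    by (simp add: left_data_def A id left_sum_def)
  have "right_sum St untwisted_beta (\<Delta> h) = eps h *\<^sub>C untwisted_beta" for h
  proof -
    have "right_sum St untwisted_beta (\<Delta> h) = right_sum St \<beta>t (\<Omega>i * conj_coproduct h)"
      by (simp add: untwisted_beta_def right_sum_right_sum[OF A] conj_coproduct \<Omega>_inv flip: mult.assoc)
    also have "\<dots> = right_sum St (eps h *\<^sub>C \<beta>t) \<Omega>i"
      using right_data_conj_coproduct by (simp add: right_data_def flip: right_sum_right_sum[OF A] right_sum_def)
    finally show ?thesis
      by (simp add: untwisted_beta_def right_sum_def mult_scaleC_left mult_scaleC_right additive_tlift[OF additive_scaleC])
  qed
  then have r: "right_data \<Delta> (\<lambda>x. x) St untwisted_beta"
    by (simp add: right_data_def A id right_sum_def)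
  let ?c12 = "\<lambda>h. lift2 l31 l32 (conj_coproduct h)" and ?c23 = "\<lambda>h. lift2 l32 l33 (conj_coproduct h)"
  \<comment> \<open>The formula for the twisted \<Phi> is solved for \<Phi>. Besides the conjugate
    there remain only outer factors in which \<open>?c12\<close> or \<open>?c23\<close> is a leg of
    \<Omega> or its inverse; under \<open>e3\<close> and \<open>k3\<close> that leg becomes the
    counit and the factor becomes 1.\<close>
  have 1: "om l31 l32 * \<Phi> * omi l32 l33 = omi ?c12 l33 * (dag3 (minv \<Phi>) * om l31 ?c23)"
    and 2: "om l32 l33 * minv \<Phi> * omi l31 l32 = omi l31 ?c23 * (dag3 \<Phi> * om ?c12 l33)"
  proof -
    have d: "dag3 (minv \<Phi>) = om l31 l32 * om (conv l31 l32) l33 * \<Phi> * omi l31 (conv l32 l33) * omi l32 l33"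
      "dag3 \<Phi> = om l32 l33 * om l31 (conv l32 l33) * minv \<Phi> * omi (conv l31 l32) l33 * omi l31 l32"
      using dag3_phii[of l31 l32 l33] by (simp_all add: lift2_l3 phi_l3)
    have k: "omi ?c12 l33 * om l31 l32 = om l31 l32 * omi (conv l31 l32) l33"
      "omi l32 l33 * om l31 ?c23 = om l31 (conv l32 l33) * omi l32 l33"
      using om_conj_coproduct[of l31 l32 l33] by (simp_all add: om_def omi_def)
    have k': "om ?c12 l33 * om l31 l32 = om l31 l32 * om (conv l31 l32) l33"
      "omi l32 l33 * omi l31 ?c23 = omi l31 (conv l32 l33) * omi l32 l33"
      using om_conj_coproduct[of l31 l32 l33] by (simp_all add: om_def omi_def)
    have k'': "omi l31 l32 * om ?c12 l33 = om (conv l31 l32) l33 * omi l31 l32"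
    proof -
      have "omi l31 l32 * om ?c12 l33 = omi l31 l32 * (om ?c12 l33 * om l31 l32) * omi l31 l32"
        by (simp add: mult.assoc om_inv)
      then show ?thesis by (simp add: k' mult.assoc cancel_om)
    qed
    have k''': "omi l31 ?c23 * om l32 l33 = om l32 l33 * omi l31 (conv l32 l33)"
    proof -
      have "omi l31 ?c23 * om l32 l33 = om l32 l33 * (omi l32 l33 * omi l31 ?c23) * om l32 l33"
        by (simp add: cancel_om mult.assoc)
      then show ?thesis by (simp add: k' mult.assoc om_inv)
    qed
    have "omi ?c12 l33 * (dag3 (minv \<Phi>) * om l31 ?c23)
      = (omi ?c12 l33 * om l31 l32) * om (conv l31 l32) l33 * \<Phi> * omi l31 (conv l32 l33)
        * (omi l32 l33 * om l31 ?c23)"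
      by (simp add: d mult.assoc)
    then show "om l31 l32 * \<Phi> * omi l32 l33 = omi ?c12 l33 * (dag3 (minv \<Phi>) * om l31 ?c23)"
      by (simp add: k mult.assoc cancel_om)
    have "omi l31 ?c23 * (dag3 \<Phi> * om ?c12 l33)
      = (omi l31 ?c23 * om l32 l33) * om l31 (conv l32 l33) * minv \<Phi> * omi (conv l31 l32) l33
        * (omi l31 l32 * om ?c12 l33)"
      by (simp add: d mult.assoc)
    then show "om l32 l33 * minv \<Phi> * omi l31 l32 = omi l31 ?c23 * (dag3 \<Phi> * om ?c12 l33)"
      by (simp add: k'' k''' mult.assoc cancel_om)
  qed
  have "tlift3 (\<lambda>x y z. St x * untwisted_alpha * y * untwisted_beta * St z) \<Phi> = e3 (omi ?c12 l33 * (dag3 (minv \<Phi>) * om l31 ?c23))"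
    by (simp flip: e3_mult 1)
  also have "\<dots> = e3 (omi eta l33 * (dag3 (minv \<Phi>) * om l31 ?c23))"
    unfolding omi_def by (rule lcongD[OF lcong_lift2_1[OF additive_clinear[OF e3(1)] e3(3)]])
  also have "\<dots> = e3 (dag3 (minv \<Phi>) * om l31 ?c23)" by (simp add: om_eta)
  also have "\<dots> = e3 (dag3 (minv \<Phi>) * om l31 eta)"
    unfolding om_def by (rule rcongD[OF rcong_lift2_2[OF additive_clinear[OF e3(1)] e3(4)]])
  also have "\<dots> = 1" by (simp add: om_eta e3_dag)
  finally have 3: "tlift3 (\<lambda>x y z. St x * untwisted_alpha * y * untwisted_beta * St z) \<Phi> = 1" .
  have c23: "commuting l31 ?c23" and c12: "commuting ?c12 l33"
    using commuting_lift2'[OF commuting_l3(1,2)] commuting_lift2[OF commuting_l3(2,3)]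
    unfolding commuting_def by blast+
  have "tlift3 (\<lambda>x y z. x * untwisted_beta * St y * untwisted_alpha * z) (minv \<Phi>) = k3 (omi l31 ?c23 * (dag3 \<Phi> * om ?c12 l33))"
    by (simp flip: k3_mult 2)
  also have "\<dots> = k3 (omi l31 eta * (dag3 \<Phi> * om ?c12 l33))"
    unfolding omi_def
    by (rule lcongD[OF lcong_lift2_2[OF additive_clinear[OF k3(1)] k3(4)]]) (simp_all add: c23)
  also have "\<dots> = k3 (dag3 \<Phi> * om ?c12 l33)" by (simp add: om_eta)
  also have "\<dots> = k3 (dag3 \<Phi> * om eta l33)"
    unfolding om_def
    by (rule rcongD[OF rcong_lift2_1[OF additive_clinear[OF k3(1)] k3(3)]]) (simp_all add: c12)
  also have "\<dots> = 1" by (simp add: om_eta k3_dag)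
  finally have 4: "tlift3 (\<lambda>x y z. x * untwisted_beta * St y * untwisted_alpha * z) (minv \<Phi>) = 1" .
  show ?thesis unfolding antipode_data_def using l r 3 4 by simp
qed

section \<open>The canonical element\<close>

definition "w = canonical_w S \<alpha> \<beta> dag \<Omega>"
abbreviation "\<beta>\<Omega> \<equiv> twisted_beta \<Omega> S \<beta>"

text \<open>The comparison u of (S, \<alpha>, \<beta>) with the untwisted conjugate data satisfies
  the equations for \<alpha> and \<beta> before twisting; letting \<Omega>^-1 and \<Omega> act on
  them gives the defining equations of w. Conversely, the \<alpha> equation for any candidate can be
  untwisted, so \<open>comparison_unique\<close> identifies it with u.\<close>

lemma canonical_w:
  "minvertible w" "w * \<alpha>t = twisted_alpha \<Omega> S \<alpha>" "\<beta>\<Omega> * w = \<beta>t" "S a = w * St a * minv w"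
proof -
  define u where "u = comparison (\<lambda>x. x) S \<alpha> untwisted_beta St"
  note d = self_data conj_antipode_data
  have l: "left_data \<Delta> (\<lambda>x. x) S \<alpha>" and r: "right_data \<Delta> (\<lambda>x. x) St untwisted_beta"
    using d by (auto simp: antipode_data_def)
  have int: "S h * u = u * St h" for h unfolding u_def by (rule comparison_intertwines[OF l r])
  have ua: "u * untwisted_alpha = \<alpha>" unfolding u_def by (rule comparison_left[OF l d(2)])
  have ub: "\<beta> * u = untwisted_beta" unfolding u_def by (rule comparison_right[OF r d(1)])
  have inv: "minvertible u"
    unfolding minvertible_def u_def using comparison_inverse[OF d(2,1)] comparison_inverse[OF d] by blast
  note N = left_sum_left_sum[OF alg_antihom_St] and M = right_sum_right_sum[OF alg_antihom_St]
  have "left_sum S \<alpha> t = u * left_sum St untwisted_alpha t" for t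
    by (simp add: left_sum_def additive_tlift[OF additive_mult_left]) (simp add: int ua[symmetric] flip: mult.assoc)
  then have alpha: "u * \<alpha>t = twisted_alpha \<Omega> S \<alpha>"
    by (simp add: twisted_alpha_left_sum[OF antipode_antihom] untwisted_alpha_def N \<Omega>_inv left_sum[OF alg_antihom_St])
  have "right_sum S \<beta> t * u = right_sum St untwisted_beta t" for t
    by (simp add: right_sum_def additive_tlift[OF additive_mult_right]) (simp add: int ub[symmetric] mult.assoc)
  then have beta: "\<beta>\<Omega> * u = \<beta>t"
    by (simp add: twisted_beta_right_sum[OF antipode_antihom] untwisted_beta_def M \<Omega>_inv right_sum[OF alg_antihom_St])
  have S: "S a = u * St a * minv u" for a
    by (simp add: int[symmetric] mult.assoc minvertible_minv[OF inv])
  have "w = u"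
    unfolding w_def canonical_w_def
  proof (rule the_equality)
    fix v
    assume v: "minvertible v \<and> v * \<alpha>t = twisted_alpha \<Omega> S \<alpha> \<and> \<beta>\<Omega> * v = \<beta>t \<and>
      (\<forall>a. S a = v * St a * minv v)"
    then have vS: "v * St h = S h * v" for h
      by (metis minvertible_minv(2) mult.assoc mult_1_right)
    have "v * left_sum St \<alpha>t t = left_sum S (v * \<alpha>t) t" for t
      by (simp add: left_sum_def additive_tlift[OF additive_mult_left]) (simp add: vS flip: mult.assoc)
    then have "v * untwisted_alpha = \<alpha>"
      using v by (simp add: untwisted_alpha_def twisted_alpha_left_sum[OF antipode_antihom] left_sum_left_sum[OF antipode_antihom]
          \<Omega>_inv left_sum[OF antipode_antihom])
    then show "v = u" unfolding u_def by (intro comparison_unique[OF d(2)] vS)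
  qed (use inv alpha beta S in blast)
  with inv alpha beta S show "minvertible w" "w * \<alpha>t = twisted_alpha \<Omega> S \<alpha>" "\<beta>\<Omega> * w = \<beta>t"
    "S a = w * St a * minv w" by simp_all
qed

section \<open>The conjugate of the Drinfeld twist\<close>

abbreviation "R \<equiv> reflect Si"

lemma R: "clinear R" "R (a \<otimes> b) = Si b \<otimes> Si a" "R (t * u) = R u * R t" "R 1 = 1"
  using alg_antihom_reflect[OF Si(1)]
  by (simp_all add: clinear_reflect Si reflect_pure alg_antihom_def)

lemma R_reflect: "R (reflect S t) = t"
  by (rule tensor_ext[of "\<lambda>t. R (reflect S t)" "\<lambda>t. t"])
    ((intro additive_clinear clinear_compose[OF R(1)] reflect_S lin)+, simp add: R reflect_S S_Si)

lemma w_inv: "w * minv w = 1" "minv w * w = 1" "Si w * Si (minv w) = 1" "Si (minv w) * Si w = 1"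
  using minvertible_minv[OF canonical_w(1)] by (simp_all add: Si(3) flip: Si(4))

text \<open>The relation between S and \<open>St\<close> is read at the conjugate of S(h), where
  \<open>St\<close> returns the conjugate of h.\<close>

lemma dag_S: "dag (S h) = Si (minv w) * Si (dag h) * Si w"
proof -
  have "S (dag (S h)) = w * dag h * minv w"
    using canonical_w(4)[of "dag (S h)"] by (simp add: conj_antipode_def dag S_Si)
  then have "Si (S (dag (S h))) = Si (w * dag h * minv w)" by simp
  then show ?thesis by (simp add: S_Si Si mult.assoc)
qed

text \<open>Read at the conjugate of \<alpha>, the same relation yields \<open>\<beta>t\<close>, and
  the defining equation of w replaces this by the twisted \<beta>.\<close>

lemma dag_alpha: "dag \<alpha> = Si \<beta>\<Omega> * Si w"
proof -
  have "S (dag \<alpha>) = w * (\<beta>\<Omega> * w) * minv w"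
    using canonical_w(4)[of "dag \<alpha>"] by (simp add: conj_antipode_def dag canonical_w(3))
  then have "Si (S (dag \<alpha>)) = Si (w * \<beta>\<Omega>)" by (simp add: mult.assoc w_inv)
  then show ?thesis by (simp add: S_Si Si)
qed

abbreviation "W \<equiv> Si w \<otimes> Si w"

lemma dag_reflect: "W * dag2 (reflect S u) = R (dag2 u) * W"
  by (rule tensor_ext[of "\<lambda>u. W * dag2 (reflect S u)"])
    (intro additive_compose[OF additive_mult_left additive_compose[OF dag_additive(2) additive_clinear[OF reflect_S(1)]]],
     intro additive_compose[OF additive_mult_right additive_compose[OF additive_clinear[OF R(1)] dag_additive(2)]],
     simp add: dag_pure R reflect_S dag_S tensor_mult_tensor w_inv flip: mult.assoc)

text \<open>The copies of w from \<open>dag_alpha\<close> and \<open>dag_S\<close> cancel, except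
  for one at the right end of each tensor factor; the two survivors form \<open>W\<close>.\<close>

lemma dag_gamma_of: "dag2 (gamma_of \<alpha> t) = R (delta_of \<beta>\<Omega> (dag4 t)) * W"
proof (rule spanning_ext[OF spanning_pure4, of "\<lambda>t. dag2 (gamma_of \<alpha> t)"])
  show "additive (\<lambda>t. dag2 (gamma_of \<alpha> t))"
    by (rule additive_compose[OF dag_additive(2) additive_clinear[OF gamma_of(1)]])
  show "additive (\<lambda>t. R (delta_of \<beta>\<Omega> (dag4 t)) * W)"
    by (rule additive_compose[OF additive_mult_right additive_compose[OF
          additive_clinear[OF clinear_compose[OF R(1) delta_of(1)]] conjugationD(2)[OF conj4]]])
  have c: "Si w * (Si (minv w) * x) = x" for x
    by (simp add: w_inv flip: mult.assoc)
  fix t :: "'h \<otimes> 'h \<otimes> 'h \<otimes> 'h" assume "t \<in> {x \<otimes> y \<otimes> z \<otimes> w |x y z w. True}"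
  then show "dag2 (gamma_of \<alpha> t) = R (delta_of \<beta>\<Omega> (dag4 t)) * W"
    by (auto simp: gamma_of delta_of dag_pure R Si S_Si dag dag_S dag_alpha tensor_mult_tensor mult.assoc c)
qed

text \<open>Conjugation reverses the two factors and, up to twisting, inverts \<Phi>, so the inverse
  tensor appears surrounded by \<Omega>. The twists in legs 12,3 contributed by the two factors
  cancel.\<close>

lemma dag4_gamma_tensor:
  "dag4 gamma_tensor = om l41 l42 * (om l43 l44 * (om (conv l41 l42) (conv l43 l44) * gamma_tensor_inv))
    * (omi (conv l41 (conv l42 l43)) l44 * omi l41 (conv l42 l43)) * omi l42 l43"
proof -
  note [simp] = l4 legs
  define c12 :: "'h \<Rightarrow> 'h \<otimes> 'h \<otimes> 'h \<otimes> 'h" where "c12 h = lift2 l41 l42 (conj_coproduct h)" for h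
  have c12: "c12 h = om l41 l42 * conv l41 l42 h * omi l41 l42" for h
    by (simp add: c12_def lift2_conj_coproduct)
  have lc12: "clinear c12"
    unfolding c12_def[abs_def] by (intro clinear_compose[OF clinear_lift2] clinear_conj_coproduct) simp_all
  have cc: "commuting c12 l43" "commuting c12 l44"
    using commuting_lift2[OF commuting_l4(2,4)] commuting_lift2[OF commuting_l4(3,5)]
    unfolding commuting_def c12_def by blast+
  have d1: "dag4 (l41 a) = l41 (dag a)" "dag4 (l42 a) = l42 (dag a)" "dag4 (l43 a) = l43 (dag a)"
    "dag4 (l44 a) = l44 (dag a)" for a
    by (simp_all add: l4_apply dag_pure dag)
  have d2: "dag4 (lift2 l41 l42 t) = lift2 l41 l42 (dag2 t)"
    "dag4 (lift2 l43 l44 t) = lift2 l43 l44 (dag2 t)" "dag4 (lift2 l42 l43 t) = lift2 l42 l43 (dag2 t)" for t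
    by (rule conjugation_lift2[OF conj4 semilinear_dag(1) semilinear_dag(1)]; simp add: d1)+
  have d3: "dag4 (conv l41 l42 a) = c12 (dag a)" for a
    by (simp add: conv_def d2 c12_def conj_coproduct_def dag)
  have "dag4 (phi (conv l41 l42) l43 l44) = lift2 c12 (lift2 l43 l44) (dag3 \<Phi>)"
    unfolding phi_def
    by (rule conjugation_lift2[OF conj4 semilinear_dag(1) semilinear_dag(2)]) (simp_all add: lc12 d2 d3 cc commuting_lift2')
  moreover have "dag4 (phii l41 l42 l43) = lift2 l41 (lift2 l42 l43) (dag3 (minv \<Phi>))"
    unfolding phii_def
    by (rule conjugation_lift2[OF conj4 semilinear_dag(1) semilinear_dag(2)]) (simp_all add: d1 d2)
  ultimately have "dag4 gamma_tensor = lift2 c12 (lift2 l43 l44) (dag3 \<Phi>) * lift2 l41 (lift2 l42 l43) (dag3 (minv \<Phi>))"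
    by (simp add: gamma_tensor_def conjugationD(4)[OF conj4])
  also have "lift2 l41 (lift2 l42 l43) (dag3 (minv \<Phi>))
      = om l41 l42 * (om (conv l41 l42) l43 * phi l41 l42 l43 * omi l41 (conv l42 l43) * omi l42 l43)"
    using dag3_phii(1)[of l41 l42 l43] by (simp add: mult.assoc)
  also have "lift2 c12 (lift2 l43 l44) (dag3 \<Phi>) * \<dots>
      = (lift2 c12 (lift2 l43 l44) (dag3 \<Phi>) * om l41 l42)
        * (om (conv l41 l42) l43 * phi l41 l42 l43 * omi l41 (conv l42 l43) * omi l42 l43)"
    by (simp only: mult.assoc)
  \<comment> \<open>Carrying \<Omega> in legs 1, 2 to the left turns the conjugated coproduct
    \<open>c12\<close> back into \<Delta>.\<close>
  also have "lift2 c12 (lift2 l43 l44) (dag3 \<Phi>) * om l41 l42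
      = om l41 l42 * lift2 (conv l41 l42) (lift2 l43 l44) (dag3 \<Phi>)"
  proof (rule lift2_intertwine)
    show "c12 a * om l41 l42 = om l41 l42 * conv l41 l42 a" for a
      by (simp add: c12 mult.assoc om_inv)
    show "lift2 l43 l44 b * om l41 l42 = om l41 l42 * lift2 l43 l44 b" for b
      unfolding om_def by (rule commutingD) simp
  qed
  also have "lift2 (conv l41 l42) (lift2 l43 l44) (dag3 \<Phi>)
      = om l43 l44 * om (conv l41 l42) (conv l43 l44) * phii (conv l41 l42) l43 l44
        * omi (conv (conv l41 l42) l43) l44 * omi (conv l41 l42) l43"
    using dag3_phii(2)[of "conv l41 l42" l43 l44] by simp
  also have "om l41 l42 * \<dots>
        * (om (conv l41 l42) l43 * phi l41 l42 l43 * omi l41 (conv l42 l43) * omi l42 l43)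
      = om l41 l42 * (om l43 l44 * (om (conv l41 l42) (conv l43 l44) * phii (conv l41 l42) l43 l44))
        * (omi (conv (conv l41 l42) l43) l44 * phi l41 l42 l43) * omi l41 (conv l42 l43) * omi l42 l43"
    by (simp add: mult.assoc cancel_om)
  also have "omi (conv (conv l41 l42) l43) l44 * phi l41 l42 l43
      = phi l41 l42 l43 * omi (conv l41 (conv l42 l43)) l44"
    by (rule om_intertwine(2)) (simp_all add: conv_coassoc phi_commute)
  finally show ?thesis by (simp add: gamma_tensor_inv_def mult.assoc)
qed

text \<open>The two copies of \<beta> stand between legs 2, 3 and between legs 1, 4, so twisting
  them amounts to right multiplication by \<Omega> in these pairs.\<close>

lemma delta_of_twisted_beta: "delta_of \<beta>\<Omega> t = delta_of \<beta> (t * om l42 l43 * om l41 l44)"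
proof -
  note [simp] = l4 alg_hom_clinear
  have c: "clinear (lift2 l41 l44)" "clinear (lift2 l42 l43)" by (simp_all add: clinear_lift2)
  have eq: "\<beta>\<Omega> = right_sum S \<beta> \<Omega>" by (rule twisted_beta_right_sum[OF antipode_antihom])
  note M = right_sum[OF antipode_antihom]
  have 1: "delta_of \<beta> ((x \<otimes> y \<otimes> z \<otimes> t) * lift2 l41 l44 v) = (x * right_sum S \<beta> v * S t) \<otimes> (y * \<beta> * S z)" for x y z t v
    by (rule tensor_ext[of "\<lambda>v. delta_of \<beta> ((x \<otimes> y \<otimes> z \<otimes> t) * lift2 l41 l44 v)"])
      ((intro additive_clinear clinear_compose[OF delta_of(1)] clinear_compose[OF M(1)] lin c)+,
       simp add: lift2_pure, simp add: l4_apply delta_of M S_mult mult.assoc)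
  have 2: "delta_of \<beta> ((x \<otimes> y \<otimes> z \<otimes> t) * (lift2 l42 l43 u * lift2 l41 l44 v))
      = (x * right_sum S \<beta> v * S t) \<otimes> (y * right_sum S \<beta> u * S z)" for x y z t u v
    by (rule tensor_ext[of "\<lambda>u. delta_of \<beta> ((x \<otimes> y \<otimes> z \<otimes> t) * (lift2 l42 l43 u * lift2 l41 l44 v))"])
      ((intro additive_clinear clinear_compose[OF delta_of(1)] clinear_compose[OF M(1)] lin c)+,
       simp add: lift2_pure flip: mult.assoc,
       simp add: l4_apply 1 M S_mult mult.assoc)
  show ?thesis
    by (rule spanning_ext[OF spanning_pure4, of "delta_of \<beta>\<Omega>"])
      ((intro additive_clinear clinear_compose[OF delta_of(1)] delta_of(1) lin)+,
       auto simp: om_def mult.assoc 2 delta_of eq)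
qed

text \<open>On the right, \<Omega> in legs 23 and 14, which comes from the twisted \<beta>, cancels
  the inverses left by conjugation once the coproduct in legs 23 is removed. On the left, \<Omega>
  in legs 12 and 34 emerges as \<Omega> and its reflection, and \<Omega> in legs 12,34 makes \<beta>
  the twisted \<beta> under \<Delta>.\<close>

lemma delta_of_dag_gamma_tensor: "delta_of \<beta>\<Omega> (dag4 gamma_tensor) = \<Omega> * \<Delta> \<beta>\<Omega> * minv F * reflect S \<Omega>"
proof -
  note [simp] = l4 legs conv_eta
  let ?A = "om l41 l42 * (om l43 l44 * (om (conv l41 l42) (conv l43 l44) * gamma_tensor_inv))"
  \<comment> \<open>\<Omega> in legs 1, 4 commutes with the coproduct in legs 2, 3. Kept inside the
    functional it does not obstruct the removal of that coproduct, and it cancels the last remaining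
    inverse.\<close>
  define \<Theta> where "\<Theta> x = delta_of \<beta> (x * om l41 l44)" for x
  have \<Theta>: "clinear \<Theta>" unfolding \<Theta>_def[abs_def] by (intro clinear_compose[OF delta_of(1)] lin)
  have k: "rcong \<Theta> (conv l42 l43) eta"
    unfolding \<Theta>_def[abs_def]
    by (rule rcong_shift[OF delta_of_kills(1)])
      (simp_all add: om_def commutingD[of "conv l42 l43" "lift2 l41 l44"] eta_mult_left eta_mult_right)
  have k': "rcong \<Theta> (conv l41 (conv l42 l43)) l41"
    using rcong_conv2[OF \<Theta> k, of l41] by simp
  have "delta_of \<beta>\<Omega> (dag4 gamma_tensor)
      = \<Theta> (?A * (omi (conv l41 (conv l42 l43)) l44 * omi l41 (conv l42 l43)))"
    by (simp add: delta_of_twisted_beta dag4_gamma_tensor \<Theta>_def mult.assoc cancel_om)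
  also have "\<dots> = \<Theta> (?A * omi (conv l41 (conv l42 l43)) l44 * omi l41 eta)"
    using rcongD[OF rcong_lift2_2[OF additive_clinear[OF \<Theta>] k],
        of "?A * omi (conv l41 (conv l42 l43)) l44" l41 \<Omega>i]
    by (simp add: omi_def mult.assoc)
  also have "\<dots> = \<Theta> (?A * omi (conv l41 (conv l42 l43)) l44)" by (simp add: om_eta)
  also have "\<dots> = \<Theta> (?A * omi l41 l44)"
    using rcongD[OF rcong_lift2_1[OF additive_clinear[OF \<Theta>] k', of l44], of ?A \<Omega>i]
    by (simp add: omi_def)
  also have "\<dots> = delta_of \<beta> ?A" by (simp add: \<Theta>_def mult.assoc om_inv)
  also have "\<dots> = \<Omega> * (delta_of \<beta> (om (conv l41 l42) (conv l43 l44) * gamma_tensor_inv) * reflect S \<Omega>)"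
    by (simp add: om_def delta_of_mult1 delta_of_mult2)
  also have "delta_of \<beta> (om (conv l41 l42) (conv l43 l44) * gamma_tensor_inv) = \<Delta> \<beta>\<Omega> * minv F"
  proof -
    note Fi = minvertible_minv[OF minvertible_F]
    \<comment> \<open>Expressing both \<delta> and the reflected coproduct through F makes an inner
      F^-1 F cancel, which leaves \<Delta>(x \<beta> S(y)) F^-1.\<close>
    have d: "\<delta> = \<Delta> \<beta> * minv F"
      by (simp add: F_delta[symmetric] mult.assoc Fi)
    have s: "reflect S (\<Delta> y) = F * \<Delta> (S y) * minv F" for y
      using F_coproduct[of y] by (metis Fi(1) mult.assoc mult_1_right)
    have "delta_of \<beta> (conv l41 l42 x * conv l43 l44 y * gamma_tensor_inv) = \<Delta> (x * \<beta> * S y) * minv F" for x y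
    proof -
      have "delta_of \<beta> (conv l41 l42 x * conv l43 l44 y * gamma_tensor_inv) = \<Delta> x * (\<delta> * reflect S (\<Delta> y))"
        by (simp add: conv_def delta_of_mult1 delta_of_mult2 \<delta>_def mult.assoc)
      also have "\<delta> * reflect S (\<Delta> y) = \<Delta> \<beta> * (minv F * F) * \<Delta> (S y) * minv F"
        by (simp add: d s mult.assoc)
      finally show ?thesis by (simp add: Fi alg_hom_mult[OF coproduct_hom] mult.assoc)
    qed
    then have "delta_of \<beta> (om (conv l41 l42) (conv l43 l44) * gamma_tensor_inv) = tlift (\<lambda>x y. \<Delta> (x * \<beta> * S y) * minv F) \<Omega>"
      by (simp add: om_def functional_lift2_left[OF additive_clinear[OF delta_of(1)]])
    also have "\<dots> = \<Delta> (right_sum S \<beta> \<Omega>) * minv F"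
      by (simp add: right_sum_def additive_tlift[OF alg_hom_additive[OF coproduct_hom]]
          additive_tlift[OF additive_mult_right])
    finally show ?thesis by (simp add: twisted_beta_right_sum[OF antipode_antihom])
  qed
  finally show ?thesis by (simp add: mult.assoc)
qed

section \<open>The right-hand side of the theorem\<close>

lemma F0: "second_drinfeld_twist \<Delta> \<Phi> S \<alpha> \<beta> = R F"
  by (simp add: second_drinfeld_twist_def reflect_def F_def)

lemma F0_inv: "minv (R F) = R (minv F)" "R F * R (minv F) = 1" "R (minv F) * R F = 1"
  using minvertible_minv[OF minvertible_F] minv_eqI[of "R F" "R (minv F)"]
  by (simp_all add: R flip: R(3))

lemma R_coproduct: "R (minv F) * R (\<Delta> a) = \<Delta> (Si a) * R (minv F)"
proof -
  have "R (\<Delta> (S h)) * R F = R F * \<Delta> h" for h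
    using arg_cong[OF F_coproduct[of h], of R] by (simp add: R R_reflect)
  from this[of "Si a"] have *: "R (\<Delta> a) * R F = R F * \<Delta> (Si a)" by (simp add: S_Si)
  have "R (minv F) * R (\<Delta> a) = R (minv F) * (R (\<Delta> a) * R F) * R (minv F)"
    by (simp add: F0_inv mult.assoc)
  also have "\<dots> = \<Delta> (Si a) * R (minv F)"
    unfolding * by (simp add: F0_inv flip: mult.assoc)
  finally show ?thesis .
qed

definition "G = \<Omega> * \<Delta> (Si (minv w)) * R (minv F) * R \<Omega> * W"

lemma dag_coproduct: "dag2 (\<Delta> a) = \<Omega> * \<Delta> (dag a) * \<Omega>i"
  using coproduct_dag by (simp add: twisted_coproduct_def)

text \<open>The common start of both verifications: \<Omega>^-1 meets \<Omega>, and the conjugate of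
  a meets S^-1(w^-1) under one \<Delta>, where \<open>dag_S\<close> or \<open>dag_alpha\<close> can
  absorb the latter.\<close>

lemma dag_coproduct_G: "dag2 (\<Delta> a) * G = \<Omega> * \<Delta> (dag a * Si (minv w)) * R (minv F) * R \<Omega> * W"
proof -
  have "dag2 (\<Delta> a) * G = \<Omega> * \<Delta> (dag a) * (\<Omega>i * \<Omega>) * \<Delta> (Si (minv w)) * R (minv F) * R \<Omega> * W"
    by (simp add: dag_coproduct G_def mult.assoc)
  then show ?thesis by (simp add: \<Omega>_inv alg_hom_mult[OF coproduct_hom] mult.assoc)
qed

lemma G_intertwines: "dag2 (\<Delta> (S h)) * G = G * dag2 (reflect S (\<Delta> h))"
proof -
  have "dag (S h) * Si (minv w) = Si (minv w) * Si (dag h)"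
    by (simp add: dag_S mult.assoc w_inv)
  then have "dag2 (\<Delta> (S h)) * G
      = \<Omega> * \<Delta> (Si (minv w)) * (\<Delta> (Si (dag h)) * R (minv F)) * R \<Omega> * W"
    by (simp add: dag_coproduct_G alg_hom_mult[OF coproduct_hom] mult.assoc)
  also have "\<dots> = \<Omega> * \<Delta> (Si (minv w)) * R (minv F) * R (\<Omega> * \<Delta> (dag h)) * W"
    unfolding R_coproduct[symmetric] by (simp add: R mult.assoc)
  also have "\<Omega> * \<Delta> (dag h) = dag2 (\<Delta> h) * \<Omega>"
    by (simp add: dag_coproduct mult.assoc \<Omega>_inv)
  also have "\<Omega> * \<Delta> (Si (minv w)) * R (minv F) * R \<dots> * W
      = \<Omega> * \<Delta> (Si (minv w)) * R (minv F) * R \<Omega> * (R (dag2 (\<Delta> h)) * W)"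
    by (simp add: R mult.assoc)
  also have "\<dots> = G * dag2 (reflect S (\<Delta> h))"
    unfolding dag_reflect[symmetric] by (simp add: G_def mult.assoc)
  finally show ?thesis .
qed

text \<open>After \<open>dag_alpha\<close> only the twisted \<beta> is left under \<Delta>. Moved
  through F^-1 it gives the reflected form of the value already computed for the conjugate of
  \<gamma>.\<close>

lemma G_alpha: "dag2 (\<Delta> \<alpha>) * G = dag2 \<gamma>"
proof -
  have "dag \<alpha> * Si (minv w) = Si \<beta>\<Omega>" by (simp add: dag_alpha mult.assoc w_inv)
  then have "dag2 (\<Delta> \<alpha>) * G = \<Omega> * (\<Delta> (Si \<beta>\<Omega>) * R (minv F)) * R \<Omega> * W"
    by (simp add: dag_coproduct_G mult.assoc)
  also have "\<dots> = R (\<Omega> * \<Delta> \<beta>\<Omega> * minv F * reflect S \<Omega>) * W"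
    unfolding R_coproduct[symmetric] by (simp add: R R_reflect mult.assoc)
  also have "\<dots> = dag2 \<gamma>" by (simp add: \<gamma>_def dag_gamma_of delta_of_dag_gamma_tensor)
  finally show ?thesis .
qed

text \<open>Uniqueness is applied to the conjugate of \<open>G\<close>, since conjugation reverses
  products and thereby brings the two equations into the form that characterises F.\<close>

lemma dag_F: "dag2 F = G"
proof -
  note c = conjugationD(3,4)[OF conj2]
  have "dag2 G = F"
  proof (rule F_unique)
    show "dag2 G * \<Delta> (S h) = reflect S (\<Delta> h) * dag2 G" for h
      using arg_cong[OF G_intertwines[of h], of dag2] by (simp add: c)
    show "dag2 G * \<Delta> \<alpha> = \<gamma>"
      using arg_cong[OF G_alpha, of dag2] by (simp add: c)
  qed
  then show ?thesis using c(1)[of G] by simp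
qed

end

theorem theorem7:
  fixes eps :: "'h::complex_algebra_1 \<Rightarrow> complex"
    and \<Delta> :: "'h \<Rightarrow> 'h \<otimes> 'h"
    and \<Phi> :: "'h \<otimes> 'h \<otimes> 'h"
    and S :: "'h \<Rightarrow> 'h"
    and \<alpha> \<beta> :: 'h
    and dag :: "'h \<Rightarrow> 'h"
    and \<Omega> :: "'h \<otimes> 'h"
  assumes "quasi_hopf_star_algebra eps \<Delta> \<Phi> S \<alpha> \<beta> dag \<Omega>"
  shows "let F\<^sub>\<delta> = drinfeld_twist \<Delta> \<Phi> S \<alpha> \<beta>;
             F\<^sub>0 = second_drinfeld_twist \<Delta> \<Phi> S \<alpha> \<beta>;
             w = canonical_w S \<alpha> \<beta> dag \<Omega>;
             W = inv S w \<otimes> inv S w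
         in tmap dag dag F\<^sub>\<delta> =
            \<Omega> * \<Delta> (inv S (minv w)) * minv F\<^sub>0 * tmap (inv S) (inv S) (tswap \<Omega>) * W"
proof -
  interpret quasi_hopf_star_algebra eps \<Delta> \<Phi> S \<alpha> \<beta> dag \<Omega> by (fact assms)
  show ?thesis
    unfolding Let_def F0 F_def[symmetric] w_def[symmetric] F0_inv(1) reflect_def[symmetric]
    by (rule dag_F[unfolded G_def])
qed

end
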